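(* Consider the Gumbel-max watermark model of the context with $\varepsilon_n\asymp n^{-p}$, and suppose Assumptions (A) and (B) hold with constants $p\ge 0$ and $0\le q\le 1$ satisfying $q+2p<1$. Fix any $\delta>0$, any $s\in[-1,2]$, and any sequence $c_n^+$ with $0\le c_n^+\le 1/n$. Then the Tr-GoF test, which rejects $H_0$ if and only if $n\cdot S_n^+(s)\ge (1+\delta)\log\log n$, has Type I error plus Type II error tending to $0$ as $n\to\infty$.
   Context: Notation: $a_n \asymp b_n$ means there are constants $C_1,C_2>0$ with $C_1 a_n\le b_n\le C_2 a_n$ for all $n$. $\mathcal{W}$ is a finite vocabulary. For a probability vector $\mathbf{P}=(P_w)_{w\in\mathcal{W}}$, $\mu_{1,\mathbf{P}}$ is the distribution on $[0,1]$ with CDF $F_{1,\mathbf{P}}(r)=\sum_w P_w r^{1/P_w}$; $\mu_0=U(0,1)$. Watermark model: for $t=1,\dots,n$ a random next-token distribution $\mathbf{P}_t$ is produced, $\xi_t=(U_{t,w})_{w\in\mathcal{W}}$ has i.i.d. $U(0,1)$ entries, the decoder is $\mathcal{S}(\mathbf{P},\xi)=\arg\max_w \frac{\log U_w}{P_w}$, the observed token is $w_t$ and $Y_t=U_{t,w_t}$. Let $\mathcal{F}_{t-1}=\sigma(\{w_j,\xi_j,\mathbf{P}_{j+1}\}_{j=1}^{t-1})$. Assumption (A): (a) $\xi_1,\dots,\xi_n$ are i.i.d. and $\xi_t$ is independent of $\mathcal{F}_{t-1}$; (b) with probability $\varepsilon_n$, $w_t=\mathcal{S}(\mathbf{P}_t,\xi_t)$;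 otherwise $w_t$ is drawn from $\mathbf{P}_t$ and, conditionally on $\mathcal{F}_{t-1}$, is independent of $\xi_t$. Assumption (B): $\Delta(\mathbf{P}_t):=1-\max_w P_{t,w}=\Delta_n$ for all $t\le n$, with $\Delta_n\asymp n^{-q}$. $H_1^{\mathrm{mix}}$ is the law of $Y_{1:n}$ under this model; $H_0$: $Y_1,\dots,Y_n$ i.i.d. $U(0,1)$. Tr-GoF statistic: set $\mathrm{p}_t=1-Y_t$, sort $\mathrm{p}_{(1)}<\dots<\mathrm{p}_{(n)}$, set $\mathrm{p}_{(n+1)}=1$, and $S_n^+(s)=\sup_{t\in\{1,\dots,n\}:\,\mathrm{p}_{(t+1)}\ge c_n^+} K_s^+(t/n,\mathrm{p}_{(t)})$, where $K_s^+(u,v)=K_s(u,v)$ if $0<v<u<1$ and $K_s^+(u,v)=0$ otherwise, $K_s(u,v)=v\,\phi_s(u/v)+(1-v)\,\phi_s\big(\frac{1-u}{1-v}\big)$, and $\phi_s(x)=x\log x-x+1$ if $s=1$, $\phi_s(x)=\frac{1-s+sx-x^s}{s(1-s)}$ if $s\ne 0,1$, $\phi_s(x)=-\log x+x-1$ if $s=0$. *)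

theory Defs
  imports "HOL-Probability.Probability"
begin

text \<open>S(P,xi) = argmax_w log(U_w)/P_w; tokens with P_w = 0 have value -infinity and are
  never selected, so the argmax is taken over the support of P (ties have probability 0).\<close>
definition gumbel_dec :: "('w \<Rightarrow> real) \<Rightarrow> ('w \<Rightarrow> real) \<Rightarrow> 'w" where
  "gumbel_dec P U = (SOME w. P w > 0 \<and> (\<forall>v. P v > 0 \<longrightarrow> ln (U v) / P v \<le> ln (U w) / P w))"

definition prob_vec :: "('w::finite \<Rightarrow> real) \<Rightarrow> bool" where
  "prob_vec P \<longleftrightarrow> (\<forall>w. P w \<ge> 0) \<and> (\<Sum>w\<in>UNIV. P w) = 1"

definition Delta_of :: "('w::finite \<Rightarrow> real) \<Rightarrow> real" where
  "Delta_of P = 1 - Max (range P)"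

definition phi :: "real \<Rightarrow> real \<Rightarrow> real" where
  "phi s x = (if s = 1 then x * ln x - x + 1
              else if s = 0 then - ln x + x - 1
              else (1 - s + s * x - x powr s) / (s * (1 - s)))"

definition Kdiv :: "real \<Rightarrow> real \<Rightarrow> real \<Rightarrow> real" where
  "Kdiv s u v = v * phi s (u / v) + (1 - v) * phi s ((1 - u) / (1 - v))"

definition Kplus :: "real \<Rightarrow> real \<Rightarrow> real \<Rightarrow> real" where
  "Kplus s u v = (if 0 < v \<and> v < u \<and> u < 1 then Kdiv s u v else 0)"

definition pord :: "nat \<Rightarrow> (nat \<Rightarrow> real) \<Rightarrow> nat \<Rightarrow> real" where
  "pord n y k = (if k = n + 1 then 1 else sort (map (\<lambda>t. 1 - y t) [1..<n+1]) ! (k - 1))"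

definition Splus :: "real \<Rightarrow> real \<Rightarrow> nat \<Rightarrow> (nat \<Rightarrow> real) \<Rightarrow> real" where
  "Splus s c n y = Max ((\<lambda>t. Kplus s (real t / real n) (pord n y t)) `
                         {t \<in> {1..n}. pord n y (t + 1) \<ge> c})"

definition trgof_reject :: "real \<Rightarrow> real \<Rightarrow> real \<Rightarrow> nat \<Rightarrow> (nat \<Rightarrow> real) \<Rightarrow> bool" where
  "trgof_reject s c \<delta> n y \<longleftrightarrow> real n * Splus s c n y \<ge> (1 + \<delta>) * ln (ln (real n))"

definition H0_law :: "nat \<Rightarrow> (nat \<Rightarrow> real) measure" where
  "H0_law n = PiM {1..n} (\<lambda>_. uniform_measure lborel {0..1::real})"

text \<open>F_{t-1}: sigma-algebra generated by P_1..P_t, w_1..w_{t-1}, xi_1..xi_{t-1}.\<close>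
definition Fsig :: "'a measure \<Rightarrow> (nat \<Rightarrow> 'a \<Rightarrow> 'w \<Rightarrow> real) \<Rightarrow> (nat \<Rightarrow> 'a \<Rightarrow> 'w \<Rightarrow> real)
                     \<Rightarrow> (nat \<Rightarrow> 'a \<Rightarrow> 'w) \<Rightarrow> nat \<Rightarrow> 'a set set" where
  "Fsig M P U W t = sigma_sets (space M)
     ((\<Union>j\<in>{1..t}. {P j -` B \<inter> space M | B. B \<in> sets (PiM UNIV (\<lambda>_. borel))})
    \<union> (\<Union>j\<in>{1..<t}. {W j -` B \<inter> space M | B. True})
    \<union> (\<Union>j\<in>{1..<t}. {U j -` B \<inter> space M | B. B \<in> sets (PiM UNIV (\<lambda>_. borel))}))"

definition sig_of :: "'a measure \<Rightarrow> ('a \<Rightarrow> 'w \<Rightarrow> real) \<Rightarrow> 'a set set" where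
  "sig_of M X = sigma_sets (space M) {X -` B \<inter> space M | B. B \<in> sets (PiM UNIV (\<lambda>_. borel))}"

text \<open>Assumptions (A) and (B) for a single n: M is the probability space, P t the next-token
  distribution, U t = xi_t, W t = w_t; eps is epsilon_n and D is Delta_n.\<close>
definition wm_model :: "'a measure \<Rightarrow> nat \<Rightarrow> real \<Rightarrow> real \<Rightarrow> (nat \<Rightarrow> 'a \<Rightarrow> 'w::finite \<Rightarrow> real)
     \<Rightarrow> (nat \<Rightarrow> 'a \<Rightarrow> 'w \<Rightarrow> real) \<Rightarrow> (nat \<Rightarrow> 'a \<Rightarrow> 'w) \<Rightarrow> bool" where
  "wm_model M n eps D P U W \<longleftrightarrow>
     prob_space M \<and> 0 \<le> eps \<and> eps \<le> 1 \<and>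
     (\<forall>t\<in>{1..n}.
        P t \<in> measurable M (PiM UNIV (\<lambda>_. borel)) \<and>
        U t \<in> measurable M (PiM UNIV (\<lambda>_. borel)) \<and>
        W t \<in> measurable M (count_space UNIV) \<and>
        (\<forall>\<omega>\<in>space M. prob_vec (P t \<omega>) \<and> Delta_of (P t \<omega>) = D) \<and>
        \<comment> \<open>(A)(a): xi_t has i.i.d. U(0,1) entries and is independent of F_{t-1}\<close>
        distr M (PiM UNIV (\<lambda>_. borel)) (U t) = PiM UNIV (\<lambda>_. uniform_measure lborel {0..1::real}) \<and>
        prob_space.indep_set M (Fsig M P U W t) (sig_of M (U t)) \<and>
        \<comment> \<open>(A)(b): conditionally on F_{t-1} and xi_t, w_t has law
            eps * delta_{S(P_t,xi_t)} + (1 - eps) * P_t\<close>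
        (\<forall>A\<in>sigma_sets (space M) (Fsig M P U W t \<union> sig_of M (U t)). \<forall>w.
            measure M (A \<inter> {\<omega>\<in>space M. W t \<omega> = w}) =
            (\<integral>\<omega>. indicator A \<omega> * (eps * (if gumbel_dec (P t \<omega>) (U t \<omega>) = w then 1 else 0)
                                      + (1 - eps) * P t \<omega> w) \<partial>M))) \<and>
     \<comment> \<open>(A)(a): xi_1, ..., xi_n i.i.d.\<close>
     prob_space.indep_vars M (\<lambda>_. PiM UNIV (\<lambda>_. borel)) U {1..n}"

definition Yobs :: "(nat \<Rightarrow> 'a \<Rightarrow> 'w \<Rightarrow> real) \<Rightarrow> (nat \<Rightarrow> 'a \<Rightarrow> 'w) \<Rightarrow> 'a \<Rightarrow> nat \<Rightarrow> real" where
  "Yobs U W \<omega> t = U t \<omega> (W t \<omega>)"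

end

theory Submission
  imports Defs "HOL-Real_Asymp.Real_Asymp"
begin

text \<open>The factor 1 + \<delta> is spent as four factors \<theta> with \<theta>^4 \<le> 1 +
  \<delta>: one replaces 1/v + 1/(1-u) by its dominant term, one pays for the variation of v inside
  a block, one for the gap between Bennett's exponent and the Gaussian one, and one stays. With L =
  log log n there are about e^L blocks, so an exponent L would leave a constant; the surplus
  \<theta> L makes the sum vanish. The bad sets are unions over a continuum of v. Instead of proving
  them measurable, each is covered by an event built from finite grids, and only that event is
  estimated. The two ends are not mirror images: the left is normalised by the level v, the right by
  the empirical fraction 1 - u. Hence two peeling lemmas, and only the left end needs an event that
  keeps p-values away from it. Under the watermark the tokens depend on the past, so the counted
  indicators are not independent. A lower bound for their conditional probabilities suffices for the
  generating function at x \<le> 1. The statistic ignores u = 1, so the event that all p-values lie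
  below Delta is bounded separately.\<close>

text \<open>
  Since \<open>phi s\<close> lies between \<open>phi (-1)\<close> and \<open>phi 2\<close>, for \<open>v < u\<close> the divergence satisfies
  \<open>(u - v)\<^sup>2 / (2 u) \<le> K_s(u, v) \<le> (u - v)\<^sup>2 / 2 * (1 / v + 1 / (1 - u))\<close>.

  Under \<open>H_0\<close> let \<open>N(v)\<close> be the number of sample points below \<open>v\<close>. As \<open>v\<close> decreases, \<open>N(v) / v\<close> is a
  martingale, so \<open>exp (r N(v) / v)\<close> is a submartingale and Doob's inequality bounds the deviation of
  \<open>N\<close> from its mean uniformly over \<open>v \<ge> a\<close> by the Bennett bound at \<open>v = a\<close>. Peeling \<open>[0, 1]\<close> into about \<open>log n\<close> geometric
  blocks whose ratio is close to 1 keeps the sharp constant: a block contributes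
  \<open>1 / (log n) powr c\<close> for some \<open>c > 1\<close>, and the few blocks near the end points, where the Gaussian regime fails,
  contribute much less. The same bound for the points counted from the right handles the factor \<open>1 / (1 - u)\<close>.

  Under the watermark, the p-values below \<open>v = Delta\<close> are counted. A pathwise comparison with the most likely token shows that
  each of them has conditional probability at least \<open>v (1 + c eps)\<close>; a Chernoff bound then produces
  an excess of order \<open>eps Delta\<close>, hence \<open>n K \<ge> C n Delta eps\<^sup>2\<close>, which grows like \<open>n\<close> to the power \<open>1 - q - 2 p > 0\<close>.
\<close>

section \<open>Divergence bounds\<close>

text \<open>The quotient is nondecreasing in \<open>\<sigma>\<close> and equals \<open>z - 1\<close>
  at \<open>\<sigma> = 1\<close>. Negative \<open>\<sigma>\<close> follows from
  \<open>ln z \<le> z - 1\<close> and \<open>1 + x \<le> exp x\<close>, positive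
  \<open>\<sigma>\<close> from convexity of \<open>exp\<close> between 0 and
  \<open>ln z\<close>.\<close>

lemma powr_bernoulli:
  fixes z \<sigma> :: real
  assumes "z > 0" "\<sigma> \<le> 1" "\<sigma> \<noteq> 0"
  shows "(z powr \<sigma> - 1) / \<sigma> \<le> z - 1"
proof (cases "\<sigma> < 0")
  case True
  have "1 + \<sigma> * (z - 1) \<le> 1 + \<sigma> * ln z"
    using ln_le_minus_one[OF assms(1)] True by (simp add: mult_left_mono_neg)
  also have "\<dots> \<le> z powr \<sigma>"
    using exp_ge_add_one_self[of "\<sigma> * ln z"] assms by (simp add: powr_def)
  finally show ?thesis using True by (simp add: neg_divide_le_eq mult.commute)
next
  case False
  then have s: "\<sigma> > 0" using assms by simp
  have "exp ((1 - \<sigma>) *\<^sub>R 0 + \<sigma> *\<^sub>R ln z) \<le> (1 - \<sigma>) * exp 0 + \<sigma> * exp (ln z)"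
    using s assms by (intro convex_onD[OF exp_convex]) auto
  then have "z powr \<sigma> \<le> 1 + \<sigma> * (z - 1)"
    using assms by (simp add: powr_def algebra_simps)
  then show ?thesis using s by (simp add: pos_divide_le_eq mult.commute)
qed

text \<open>The derivative of \<open>phi s\<close>. Away from \<open>s = 1\<close>, its comparisons
  with \<open>s = 2\<close> and \<open>s = - 1\<close> are instances of
  \<open>powr_bernoulli\<close>; at \<open>s = 0\<close> the second branch gives
  \<open>1 - 1 / x\<close>.\<close>

definition phi' :: "real \<Rightarrow> real \<Rightarrow> real" where
  "phi' s x = (if s = 1 then ln x else (x powr (s - 1) - 1) / (s - 1))"

lemma phi_has_derivative:
  assumes "x > 0"
  shows "(phi s has_real_derivative phi' s x) (at x)"
proof -
  consider "s = 1" | "s = 0" | "s \<noteq> 0" "s \<noteq> 1" by blast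
  then show ?thesis
  proof cases
    case 1
    have "((\<lambda>x. x * ln x - x + 1) has_real_derivative ln x) (at x)"
      using assms by (auto intro!: derivative_eq_intros)
    then show ?thesis using 1 by (simp add: phi_def[abs_def] phi'_def)
  next
    case 2
    have "((\<lambda>x. - ln x + x - 1) has_real_derivative 1 - 1 / x) (at x)"
      using assms by (auto intro!: derivative_eq_intros)
    then show ?thesis using 2 assms by (simp add: phi_def[abs_def] phi'_def powr_minus_divide)
  next
    case 3
    have "((\<lambda>x. (1 - s + s * x - x powr s) / (s * (1 - s))) has_real_derivative
       (s - s * x powr (s - 1)) / (s * (1 - s))) (at x)"
      using assms 3 by (intro DERIV_cdivide) (auto intro!: derivative_eq_intros simp: powr_diff)
    moreover have "(s - s * x powr (s - 1)) / (s * (1 - s)) = phi' s x"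
      using 3 by (simp add: phi'_def field_simps)
    ultimately show ?thesis using 3 by (simp add: phi_def[abs_def])
  qed
qed

lemma phi'_le:
  assumes "x > 0" "s \<le> 2"
  shows "phi' s x \<le> x - 1"
  using powr_bernoulli[of x "s - 1"] ln_le_minus_one[of x] assms by (simp add: phi'_def)

text \<open>The left side is \<open>phi' (- 1) x\<close>. With base \<open>1 / x\<^sup>2\<close> the
  exponent \<open>s - 1\<close> becomes \<open>(1 - s) / 2\<close>, which is at most 1 because
  \<open>- 1 \<le> s\<close>; the change of sign turns the upper bound of
  \<open>powr_bernoulli\<close> into a lower one.\<close>

lemma phi'_ge:
  assumes "x > 0" "- 1 \<le> s"
  shows "(1 - 1 / x\<^sup>2) / 2 \<le> phi' s x"
proof (cases "s = 1")
  case True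
  have "ln (1 / x\<^sup>2) \<le> 1 / x\<^sup>2 - 1" using assms by (intro ln_le_minus_one) simp
  then show ?thesis using True assms by (simp add: phi'_def ln_div ln_realpow)
next
  case False
  have "((1 / x\<^sup>2) powr ((1 - s) / 2) - 1) / ((1 - s) / 2) \<le> 1 / x\<^sup>2 - 1"
    using assms False by (intro powr_bernoulli) auto
  moreover have "(1 / x\<^sup>2) powr ((1 - s) / 2) = x powr (s - 1)"
    using assms by (simp add: powr_def ln_div ln_realpow field_simps)
  moreover have "(a - 1) / ((1 - s) / 2) = - 2 * ((a - 1) / (s - 1))" for a
    using False by (simp add: divide_simps) (simp add: algebra_simps)
  ultimately have "- 2 * phi' s x \<le> 1 / x\<^sup>2 - 1" using False by (simp add: phi'_def)
  then show ?thesis by simp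
qed

lemma phi_one [simp]: "phi s 1 = 0"
  by (simp add: phi_def)

lemma deriv_le_imp_le:
  fixes f g :: "real \<Rightarrow> real"
  assumes "a \<le> b" "\<And>x. a \<le> x \<Longrightarrow> x \<le> b \<Longrightarrow> (f has_real_derivative f' x) (at x)"
    "\<And>x. a \<le> x \<Longrightarrow> x \<le> b \<Longrightarrow> (g has_real_derivative g' x) (at x)"
    "\<And>x. a \<le> x \<Longrightarrow> x \<le> b \<Longrightarrow> f' x \<le> g' x"
  shows "f b - f a \<le> g b - g a"
proof -
  have "g a - f a \<le> g b - f b"
    using assms by (intro DERIV_nonneg_imp_nondecreasing[of a b "\<lambda>x. g x - f x"])
      (auto intro!: exI derivative_eq_intros)
  then show ?thesis by simp
qed

lemma chisq_has_derivative: "((\<lambda>x. (x - 1)\<^sup>2 / 2) has_real_derivative x - 1) (at x)" for x :: real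
  by (auto intro!: derivative_eq_intros)

lemma neyman_has_derivative:
  fixes x :: real assumes "x > 0"
  shows "((\<lambda>x. (x - 1)\<^sup>2 / (2 * x)) has_real_derivative (1 - 1 / x\<^sup>2) / 2) (at x)"
  using assms by (auto intro!: derivative_eq_intros simp: field_simps power2_eq_square)

text \<open>The outer functions are \<open>phi (- 1)\<close> and \<open>phi 2\<close>. All three
  vanish at 1, so it is enough to order the derivatives; to the left of 1 the same derivative bounds
  give the opposite order.\<close>

lemma phi_bounds_ge1:
  assumes "x \<ge> 1" "- 1 \<le> s" "s \<le> 2"
  shows "(x - 1)\<^sup>2 / (2 * x) \<le> phi s x" "phi s x \<le> (x - 1)\<^sup>2 / 2"
  using deriv_le_imp_le[of 1 x "\<lambda>x. (x - 1)\<^sup>2 / (2 * x)" "\<lambda>x. (1 - 1 / x\<^sup>2) / 2" "phi s" "phi' s"]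
    deriv_le_imp_le[of 1 x "phi s" "phi' s" "\<lambda>x. (x - 1)\<^sup>2 / 2" "\<lambda>x. x - 1"]
    assms phi'_le phi'_ge neyman_has_derivative chisq_has_derivative phi_has_derivative
  by auto

lemma phi_bounds_le1:
  assumes "0 < x" "x \<le> 1" "- 1 \<le> s" "s \<le> 2"
  shows "(x - 1)\<^sup>2 / 2 \<le> phi s x" "phi s x \<le> (x - 1)\<^sup>2 / (2 * x)"
  using deriv_le_imp_le[of x 1 "\<lambda>x. (x - 1)\<^sup>2 / (2 * x)" "\<lambda>x. (1 - 1 / x\<^sup>2) / 2" "phi s" "phi' s"]
    deriv_le_imp_le[of x 1 "phi s" "phi' s" "\<lambda>x. (x - 1)\<^sup>2 / 2" "\<lambda>x. x - 1"]
    assms phi'_le phi'_ge neyman_has_derivative chisq_has_derivative phi_has_derivative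
  by auto

text \<open>The two ratios lie on opposite sides of 1. Above 1 the quadratic bound leaves the
  denominator \<open>v\<close>; below 1 the bound divided by the ratio turns \<open>1 - v\<close>
  into \<open>1 - u\<close>.\<close>

lemma Kdiv_upper:
  assumes "0 < v" "v < u" "u < 1" "- 1 \<le> s" "s \<le> 2"
  shows "Kdiv s u v \<le> (u - v)\<^sup>2 / 2 * (1 / v + 1 / (1 - u))"
proof -
  have "v * phi s (u / v) \<le> v * ((u / v - 1)\<^sup>2 / 2)"
    using assms by (intro mult_left_mono phi_bounds_ge1) auto
  also have "\<dots> = (u - v)\<^sup>2 / 2 * (1 / v)"
    using assms by (simp add: field_simps power2_eq_square)
  finally have 1: "v * phi s (u / v) \<le> (u - v)\<^sup>2 / 2 * (1 / v)" .
  let ?x = "(1 - u) / (1 - v)"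
  have "(1 - v) * phi s ?x \<le> (1 - v) * ((?x - 1)\<^sup>2 / (2 * ?x))"
    using assms by (intro mult_left_mono phi_bounds_le1) auto
  also have "?x - 1 = (v - u) / (1 - v)" using assms by (simp add: field_simps)
  also have "(1 - v) * (((v - u) / (1 - v))\<^sup>2 / (2 * ?x)) = (v - u)\<^sup>2 / 2 * (1 / (1 - u))"
    using assms by (simp add: power_divide power2_eq_square)
  also have "(v - u)\<^sup>2 = (u - v)\<^sup>2" by (rule power2_commute)
  finally show ?thesis using 1 unfolding Kdiv_def distrib_left by linarith
qed

lemma Kdiv_lower:
  assumes "0 < v" "v < u" "u < 1" "- 1 \<le> s" "s \<le> 2"
  shows "(u - v)\<^sup>2 / (2 * u) \<le> Kdiv s u v"
proof -
  have "(u - v)\<^sup>2 / (2 * u) = v * ((u / v - 1)\<^sup>2 / (2 * (u / v)))"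
    using assms by (simp add: field_simps power2_eq_square)
  also have "\<dots> \<le> v * phi s (u / v)"
    using assms by (intro mult_left_mono phi_bounds_ge1) auto
  finally have 1: "(u - v)\<^sup>2 / (2 * u) \<le> v * phi s (u / v)" .
  have "0 \<le> ((1 - u) / (1 - v) - 1)\<^sup>2 / 2" by simp
  also have "\<dots> \<le> phi s ((1 - u) / (1 - v))"
    using assms by (intro phi_bounds_le1) auto
  finally have "0 \<le> (1 - v) * phi s ((1 - u) / (1 - v))" using assms by simp
  then show ?thesis using 1 unfolding Kdiv_def by simp
qed

text \<open>The right side is Bennett's rate function. The bound is \<open>y\<^sup>2 / 2\<close> to
  leading order, which keeps the sharp constant for small \<open>y\<close>, and it still grows
  linearly for large \<open>y\<close>, where counts behave like Poisson variables.\<close>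

lemma bennett_lower:
  fixes y :: real
  assumes "y \<ge> 0"
  shows "y\<^sup>2 / (2 + y) \<le> (1 + y) * ln (1 + y) - y"
proof -
  have "2 * x / (2 + x) \<le> ln (1 + x)" if "x \<ge> 0" for x :: real
  proof -
    have "((\<lambda>x. 2 * x / (2 + x)) has_real_derivative 4 / (2 + x)\<^sup>2) (at x)" if "x \<ge> 0" for x :: real
      using that by (auto intro!: derivative_eq_intros simp: field_simps power2_eq_square)
    moreover have "((\<lambda>x. ln (1 + x)) has_real_derivative 1 / (1 + x)) (at x)" if "x \<ge> 0" for x :: real
      using that by (auto intro!: derivative_eq_intros simp: field_simps power2_eq_square)
    moreover have "4 / (2 + x)\<^sup>2 \<le> 1 / (1 + x)" if "x \<ge> 0" for x :: real
      using that by (simp add: divide_simps power2_eq_square) (simp add: algebra_simps)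
    ultimately show ?thesis
      using deriv_le_imp_le[of 0 x "\<lambda>x. 2 * x / (2 + x)" "\<lambda>x. 4 / (2 + x)\<^sup>2" "\<lambda>x. ln (1 + x)" "\<lambda>x. 1 / (1 + x)"]
        \<open>x \<ge> 0\<close> by simp
  qed
  from mult_left_mono[OF this[OF assms], of "1 + y"] assms
  have "(1 + y) * (2 * y / (2 + y)) - y \<le> (1 + y) * ln (1 + y) - y" by simp
  moreover have "(1 + y) * (2 * y / (2 + y)) - y = y\<^sup>2 / (2 + y)"
    using assms by (simp add: field_simps power2_eq_square)
  ultimately show ?thesis by simp
qed

lemma bennett_lower_neg:
  fixes z :: real
  assumes "0 \<le> z" "z < 1"
  shows "z\<^sup>2 / 2 \<le> (1 - z) * ln (1 - z) + z"
proof -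
  have "z\<^sup>2 / 2 - 0\<^sup>2 / 2 \<le> ((1 - z) * ln (1 - z) + z) - ((1 - 0) * ln (1 - 0) + 0)"
  proof (rule deriv_le_imp_le[where f' = "\<lambda>z. z" and g' = "\<lambda>z. - ln (1 - z)"])
    fix x assume x: "0 \<le> x" "x \<le> z"
    show "((\<lambda>z. z\<^sup>2 / 2) has_real_derivative x) (at x)"
      by (auto intro!: derivative_eq_intros)
    show "((\<lambda>z. (1 - z) * ln (1 - z) + z) has_real_derivative - ln (1 - x)) (at x)"
      using x assms by (auto intro!: derivative_eq_intros)
    show "x \<le> - ln (1 - x)"
      using ln_le_minus_one[of "1 - x"] x assms by simp
  qed (use assms in simp)
  then show ?thesis by simp
qed

section \<open>A maximal inequality for the uniform empirical process\<close>

text \<open>Exchanges the weights one coordinate at a time. The test function sees a coordinate only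
  through \<open>\<sigma>\<close>, so the weights need to be compared only against functions of
  \<open>\<sigma> y\<close>.\<close>

lemma nn_integral_PiM_prod_mono:
  fixes \<mu> :: "real measure" and \<phi>1 \<phi>2 :: "real \<Rightarrow> ennreal" and \<sigma> :: "real \<Rightarrow> real"
  assumes "prob_space \<mu>" and sets: "sets \<mu> = sets borel"
    and [measurable]: "\<sigma> \<in> borel_measurable borel" "\<phi>1 \<in> borel_measurable borel" "\<phi>2 \<in> borel_measurable borel"
    and coord: "\<And>k :: real \<Rightarrow> ennreal. k \<in> borel_measurable borel \<Longrightarrow>
       (\<integral>\<^sup>+ y. k (\<sigma> y) * \<phi>1 y \<partial>\<mu>) \<le> (\<integral>\<^sup>+ y. k (\<sigma> y) * \<phi>2 y \<partial>\<mu>)"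
    and "finite I" and "F \<in> borel_measurable (PiM I (\<lambda>_. borel :: real measure))"
  shows "(\<integral>\<^sup>+ x. F (\<lambda>i\<in>I. \<sigma> (x i)) * (\<Prod>i\<in>I. \<phi>1 (x i)) \<partial>PiM I (\<lambda>_. \<mu>))
       \<le> (\<integral>\<^sup>+ x. F (\<lambda>i\<in>I. \<sigma> (x i)) * (\<Prod>i\<in>I. \<phi>2 (x i)) \<partial>PiM I (\<lambda>_. \<mu>))"
  using assms(7,8)
proof (induction I arbitrary: F)
  case empty
  then show ?case by simp
next
  case (insert j I)
  interpret prob_space \<mu> by fact
  interpret product_sigma_finite "\<lambda>_. \<mu>" ..
  note [measurable] = insert.prems
  interpret Pi: prob_space "PiM I (\<lambda>_. \<mu>)" by (intro prob_space_PiM prob_space_axioms)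
  interpret PS: pair_sigma_finite "PiM I (\<lambda>_. \<mu>)" \<mu> ..
  have sI: "sets (PiM J (\<lambda>_. \<mu>)) = sets (PiM J (\<lambda>_. borel))" for J
    by (intro sets_PiM_cong sets refl)
  have [measurable_cong]: "sets \<mu> = sets borel" by fact
  let ?P = "PiM I (\<lambda>_. \<mu>)"
  let ?r = "\<lambda>x. \<lambda>i\<in>I. \<sigma> (x i)"
  have r: "(\<lambda>i\<in>insert j I. \<sigma> ((x(j := y)) i)) = (?r x)(j := \<sigma> y)" for x y
    using insert.hyps by (auto simp: fun_eq_iff restrict_def)
  have p: "(\<Prod>i\<in>insert j I. \<phi> ((x(j := y)) i)) = \<phi> y * (\<Prod>i\<in>I. \<phi> (x i))" for \<phi> :: "real \<Rightarrow> ennreal" and x y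
    using insert.hyps by (auto simp: prod.insert intro!: prod.cong arg_cong2[where f = "(*)"])
  have [measurable]: "(\<lambda>x. ?r x) \<in> measurable ?P (PiM I (\<lambda>_. borel))"
    by (measurable)
  have Fm: "F \<in> borel_measurable (PiM (insert j I) (\<lambda>_. borel))" by fact
  have upd [measurable]: "(\<lambda>(x, y). F (x(j := y))) \<in> borel_measurable (PiM I (\<lambda>_. borel) \<Otimes>\<^sub>M borel)"
    by measurable
  have updr [measurable]: "(\<lambda>(x, y). F ((?r x)(j := \<sigma> y))) \<in> borel_measurable (?P \<Otimes>\<^sub>M \<mu>)"
  proof -
    have "(\<lambda>(x, y). (?r x, \<sigma> y)) \<in> measurable (?P \<Otimes>\<^sub>M \<mu>) (PiM I (\<lambda>_. borel) \<Otimes>\<^sub>M borel)"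
      by measurable
    from measurable_compose[OF this upd] show ?thesis by (simp add: case_prod_beta)
  qed
  have jm: "(\<lambda>(x, y). F ((?r x)(j := \<sigma> y)) * (\<phi> y * (\<Prod>i\<in>I. \<phi>' (x i)))) \<in> borel_measurable (?P \<Otimes>\<^sub>M \<mu>)"
    if [measurable]: "\<phi> \<in> borel_measurable borel" "\<phi>' \<in> borel_measurable borel" for \<phi> \<phi>' :: "real \<Rightarrow> ennreal"
  proof -
    have "(\<lambda>(x, y). \<phi> y * (\<Prod>i\<in>I. \<phi>' (x i))) \<in> borel_measurable (?P \<Otimes>\<^sub>M \<mu>)"
      by measurable
    from borel_measurable_times_ennreal[OF updr this] show ?thesis by (simp add: case_prod_beta)
  qed
  have upd2: "(\<lambda>y. F (x(j := y))) \<in> borel_measurable borel" if "x \<in> space (PiM I (\<lambda>_. borel))" for x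
    using measurable_compose[OF measurable_Pair1'[OF that] upd] by simp
  have upd3: "(\<lambda>x. F (x(j := y))) \<in> borel_measurable (PiM I (\<lambda>_. borel))" for y
    using measurable_compose[OF measurable_Pair2'[of y borel] upd] by simp
  have "(\<integral>\<^sup>+ x. F (\<lambda>i\<in>insert j I. \<sigma> (x i)) * (\<Prod>i\<in>insert j I. \<phi>1 (x i)) \<partial>PiM (insert j I) (\<lambda>_. \<mu>))
     = (\<integral>\<^sup>+ x. \<integral>\<^sup>+ y. F ((?r x)(j := \<sigma> y)) * (\<phi>1 y * (\<Prod>i\<in>I. \<phi>1 (x i))) \<partial>\<mu> \<partial>?P)"
    by (subst product_nn_integral_insert[OF insert.hyps]) (simp_all only: r p, measurable)
  also have "\<dots> = (\<integral>\<^sup>+ x. (\<integral>\<^sup>+ y. F ((?r x)(j := \<sigma> y)) * \<phi>1 y \<partial>\<mu>) * (\<Prod>i\<in>I. \<phi>1 (x i)) \<partial>?P)"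
    by (intro nn_integral_cong, subst nn_integral_multc[symmetric]) (auto simp: mult.assoc)
  \<comment> \<open>Coordinate \<open>j\<close> is exchanged first, with the others frozen; after
    Fubini the induction hypothesis exchanges the rest with \<open>y\<close> frozen.\<close>
  also have "\<dots> \<le> (\<integral>\<^sup>+ x. (\<integral>\<^sup>+ y. F ((?r x)(j := \<sigma> y)) * \<phi>2 y \<partial>\<mu>) * (\<Prod>i\<in>I. \<phi>1 (x i)) \<partial>?P)"
    by (intro nn_integral_mono mult_right_mono coord upd2) (auto simp: space_PiM)
  also have "\<dots> = (\<integral>\<^sup>+ x. \<integral>\<^sup>+ y. F ((?r x)(j := \<sigma> y)) * (\<phi>2 y * (\<Prod>i\<in>I. \<phi>1 (x i))) \<partial>\<mu> \<partial>?P)"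
    by (intro nn_integral_cong, subst nn_integral_multc[symmetric]) (auto simp: mult.assoc)
  also have "\<dots> = (\<integral>\<^sup>+ y. \<integral>\<^sup>+ x. F ((?r x)(j := \<sigma> y)) * (\<phi>2 y * (\<Prod>i\<in>I. \<phi>1 (x i))) \<partial>?P \<partial>\<mu>)"
    by (rule PS.Fubini'[symmetric]) (auto intro: jm)
  also have "\<dots> = (\<integral>\<^sup>+ y. (\<integral>\<^sup>+ x. F ((?r x)(j := \<sigma> y)) * (\<Prod>i\<in>I. \<phi>1 (x i)) \<partial>?P) * \<phi>2 y \<partial>\<mu>)"
    by (intro nn_integral_cong, subst nn_integral_multc[symmetric]) (auto simp: ac_simps)
  also have "\<dots> \<le> (\<integral>\<^sup>+ y. (\<integral>\<^sup>+ x. F ((?r x)(j := \<sigma> y)) * (\<Prod>i\<in>I. \<phi>2 (x i)) \<partial>?P) * \<phi>2 y \<partial>\<mu>)"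
    by (intro nn_integral_mono mult_right_mono insert.IH upd3) auto
  also have "\<dots> = (\<integral>\<^sup>+ y. \<integral>\<^sup>+ x. F ((?r x)(j := \<sigma> y)) * (\<phi>2 y * (\<Prod>i\<in>I. \<phi>2 (x i))) \<partial>?P \<partial>\<mu>)"
    by (intro nn_integral_cong, subst nn_integral_multc[symmetric]) (auto simp: ac_simps)
  also have "\<dots> = (\<integral>\<^sup>+ x. \<integral>\<^sup>+ y. F ((?r x)(j := \<sigma> y)) * (\<phi>2 y * (\<Prod>i\<in>I. \<phi>2 (x i))) \<partial>\<mu> \<partial>?P)"
    by (rule PS.Fubini') (auto intro: jm)
  also have "\<dots> = (\<integral>\<^sup>+ x. F (\<lambda>i\<in>insert j I. \<sigma> (x i)) * (\<Prod>i\<in>insert j I. \<phi>2 (x i)) \<partial>PiM (insert j I) (\<lambda>_. \<mu>))"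
    by (subst product_nn_integral_insert[OF insert.hyps]) (simp_all only: r p, measurable)
  finally show ?case .
qed

text \<open>The map \<open>\<tau>\<close> is a parameter because the results are used twice on the
  same sample: with \<open>1 - y\<close> for the p-values and with \<open>y\<close> for the points
  counted from the right.\<close>

locale unif_sample = prob_space \<mu> for \<mu> :: "real measure" +
  fixes \<tau> :: "real \<Rightarrow> real" and I :: "nat set"
  assumes sets_\<mu> [measurable_cong]: "sets \<mu> = sets borel"
    and \<tau> [measurable]: "\<tau> \<in> borel_measurable borel"
    and cdf: "\<And>b. 0 \<le> b \<Longrightarrow> b \<le> 1 \<Longrightarrow> emeasure \<mu> {y. \<tau> y \<le> b} = ennreal b"
    and finI: "finite I"
begin

abbreviation Q :: "(nat \<Rightarrow> real) measure" where "Q \<equiv> PiM I (\<lambda>_. \<mu>)"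

definition N :: "real \<Rightarrow> (nat \<Rightarrow> real) \<Rightarrow> nat" where
  "N g x = card {i \<in> I. \<tau> (x i) \<le> g}"

definition wt :: "real \<Rightarrow> real \<Rightarrow> real \<Rightarrow> real" where
  "wt r g y = (if \<tau> y \<le> g then exp (r / g) else 1)"

lemma wt_measurable [measurable]: "wt r g \<in> borel_measurable borel"
  unfolding wt_def[abs_def] by measurable

sublocale Q: prob_space Q
  by (intro prob_space_PiM prob_space_axioms)

lemma N_eq_sum: "real (N g x) = (\<Sum>i\<in>I. if \<tau> (x i) \<le> g then 1 else 0)"
  unfolding N_def using finI by (simp add: sum.If_cases Int_def)

lemma N_measurable [measurable]: "(\<lambda>x. real (N g x)) \<in> borel_measurable Q"
  unfolding N_eq_sum by measurable

lemma exp_N: "exp (r * real (N g x) / g) = (\<Prod>i\<in>I. wt r g (x i))"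
proof -
  have "r * real (N g x) / g = (\<Sum>i\<in>I. if \<tau> (x i) \<le> g then r / g else 0)"
    unfolding N_eq_sum by (auto simp: sum_distrib_left sum_divide_distrib intro!: sum.cong)
  then show ?thesis
    using finI by (auto simp: exp_sum wt_def intro!: prod.cong)
qed

lemma nn_integral_wt:
  assumes "0 < a" "a \<le> b" "b \<le> 1"
  shows "(\<integral>\<^sup>+ y. indicator {y. \<tau> y \<le> b} y * ennreal (wt r a y) \<partial>\<mu>) = ennreal (b + a * (exp (r / a) - 1))"
proof -
  have m: "emeasure \<mu> {y. a < \<tau> y \<and> \<tau> y \<le> b} = ennreal (b - a)"
  proof -
    have "emeasure \<mu> ({y. \<tau> y \<le> b} - {y. \<tau> y \<le> a}) = emeasure \<mu> {y. \<tau> y \<le> b} - emeasure \<mu> {y. \<tau> y \<le> a}"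
      using assms by (intro emeasure_Diff) (auto simp: cdf)
    also have "{y. \<tau> y \<le> b} - {y. \<tau> y \<le> a} = {y. a < \<tau> y \<and> \<tau> y \<le> b}" by auto
    finally show ?thesis using assms by (simp add: cdf ennreal_minus)
  qed
  have "(\<integral>\<^sup>+ y. indicator {y. \<tau> y \<le> b} y * ennreal (wt r a y) \<partial>\<mu>)
     = (\<integral>\<^sup>+ y. ennreal (exp (r / a)) * indicator {y. \<tau> y \<le> a} y + indicator {y. a < \<tau> y \<and> \<tau> y \<le> b} y \<partial>\<mu>)"
    using assms by (intro nn_integral_cong) (auto simp: wt_def indicator_def)
  also have "\<dots> = ennreal (exp (r / a)) * ennreal a + ennreal (b - a)"
    using assms by (subst nn_integral_add) (auto simp: nn_integral_cmult cdf m)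
  also have "\<dots> = ennreal (b + a * (exp (r / a) - 1))"
    using assms by (simp add: ennreal_mult[symmetric] ennreal_plus[symmetric] algebra_simps del: ennreal_plus)
  finally show ?thesis .
qed

text \<open>Given that \<open>\<tau> y \<le> b\<close>, the value \<open>\<tau> y\<close> is uniform on \<open>[0, b]\<close>; the claim is Jensen's inequality.\<close>

lemma coord_mono:
  fixes k :: "real \<Rightarrow> ennreal"
  assumes ab: "0 < a" "a \<le> b" "b \<le> 1" and [measurable]: "k \<in> borel_measurable borel"
  shows "(\<integral>\<^sup>+ y. k (max b (\<tau> y)) * ennreal (wt r b y) \<partial>\<mu>) \<le> (\<integral>\<^sup>+ y. k (max b (\<tau> y)) * ennreal (wt r a y) \<partial>\<mu>)"
proof -
  \<comment> \<open>Above \<open>b\<close> the weight is 1 for every level \<open>c \<le> b\<close>,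
    so only the contributions of \<open>\<tau> y \<le> b\<close> have to be compared.\<close>
  have split: "(\<integral>\<^sup>+ y. k (max b (\<tau> y)) * ennreal (wt r c y) \<partial>\<mu>)
     = k b * ennreal (b + c * (exp (r / c) - 1)) + (\<integral>\<^sup>+ y. k (\<tau> y) * indicator {y. b < \<tau> y} y \<partial>\<mu>)"
    if "0 < c" "c \<le> b" for c
  proof -
    have "(\<integral>\<^sup>+ y. k (max b (\<tau> y)) * ennreal (wt r c y) \<partial>\<mu>)
      = (\<integral>\<^sup>+ y. k b * (indicator {y. \<tau> y \<le> b} y * ennreal (wt r c y)) + k (\<tau> y) * indicator {y. b < \<tau> y} y \<partial>\<mu>)"
      using that by (intro nn_integral_cong) (auto simp: wt_def indicator_def max_def)
    also have "\<dots> = k b * (\<integral>\<^sup>+ y. indicator {y. \<tau> y \<le> b} y * ennreal (wt r c y) \<partial>\<mu>)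
       + (\<integral>\<^sup>+ y. k (\<tau> y) * indicator {y. b < \<tau> y} y \<partial>\<mu>)"
      by (subst nn_integral_add) (auto simp: nn_integral_cmult)
    finally show ?thesis using that ab by (simp add: nn_integral_wt)
  qed
  have "b * exp (r / b) \<le> b + a * (exp (r / a) - 1)"
  proof -
    have "exp ((1 - a / b) *\<^sub>R 0 + (a / b) *\<^sub>R (r / a)) \<le> (1 - a / b) * exp 0 + (a / b) * exp (r / a)"
      using ab by (intro convex_onD[OF exp_convex]) auto
    then have "exp (r / b) \<le> (1 - a / b) + (a / b) * exp (r / a)"
      using ab by simp
    from mult_left_mono[OF this, of b] ab show ?thesis
      by (simp add: algebra_simps)
  qed
  then show ?thesis
    unfolding split[OF ab(1,2)] split[OF order.strict_trans2[OF ab(1,2)] order_refl]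
    by (intro add_mono mult_left_mono ennreal_leI) (auto simp: algebra_simps)
qed

text \<open>The submartingale step. The event depends only on counts at levels at least
  \<open>b\<close>, hence only on \<open>max b (\<tau> (x i))\<close>, which is the coarsening under
  which \<open>coord_mono\<close> compares the weights.\<close>

lemma nn_integral_exp_N_mono:
  fixes r T :: real
  assumes ab: "0 < a" "a \<le> b" "b \<le> 1" and G: "finite G" "\<And>g. g \<in> G \<Longrightarrow> b \<le> g"
  defines "E \<equiv> {x. \<exists>g\<in>G. T \<le> r * real (N g x) / g}"
  shows "(\<integral>\<^sup>+ x. indicator E x * ennreal (exp (r * real (N b x) / b)) \<partial>Q)
       \<le> (\<integral>\<^sup>+ x. indicator E x * ennreal (exp (r * real (N a x) / a)) \<partial>Q)"
proof -
  let ?c = "\<lambda>g z. (\<Sum>i\<in>I. if z i \<le> g then 1 else 0 :: real)"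
  define F :: "(nat \<Rightarrow> real) \<Rightarrow> ennreal"
    where "F = indicator {z \<in> space (PiM I (\<lambda>_. borel)). \<exists>g\<in>G. T \<le> r * ?c g z / g}"
  have F: "F \<in> borel_measurable (PiM I (\<lambda>_. borel))"
    unfolding F_def using G by (intro borel_measurable_indicator) measurable
  have eq: "indicator E x = F (\<lambda>i\<in>I. max b (\<tau> (x i)))" for x
  proof -
    have "?c g (\<lambda>i\<in>I. max b (\<tau> (x i))) = real (N g x)" if "g \<in> G" for g
      unfolding N_eq_sum using G(2)[OF that] by (intro sum.cong) auto
    then show ?thesis unfolding F_def E_def by (auto simp: indicator_def space_PiM)
  qed
  show ?thesis
    unfolding eq exp_N
    using nn_integral_PiM_prod_mono[OF prob_space_axioms sets_\<mu>, of "\<lambda>y. max b (\<tau> y)" "\<lambda>y. ennreal (wt r b y)" "\<lambda>y. ennreal (wt r a y)" I F]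
      coord_mono[OF ab] finI F
    by (simp add: prod_ennreal wt_def)
qed

text \<open>Doob's argument, adding the grid points from right to left: where only the new point \<open>b\<close> crosses,
  the exponential at \<open>b\<close> is at least 1, and the previous lemma then moves its argument from \<open>b\<close> to \<open>a\<close>.\<close>

lemma maximal_aux:
  fixes r T :: real
  assumes "finite G" "0 < a" "\<And>g. g \<in> G \<Longrightarrow> a \<le> g \<and> g \<le> 1"
  shows "emeasure Q {x \<in> space Q. \<exists>g\<in>G. T \<le> r * real (N g x) / g}
    \<le> (\<integral>\<^sup>+ x. indicator {x. \<exists>g\<in>G. T \<le> r * real (N g x) / g} x * ennreal (exp (r * real (N a x) / a - T)) \<partial>Q)"
  using assms
proof (induction G arbitrary: a rule: finite_linorder_min_induct)
  case empty
  then show ?case by simp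
next
  case (insert b G)
  note [measurable] = \<open>finite G\<close>
  let ?E = "\<lambda>G. {x. \<exists>g\<in>G. T \<le> r * real (N g x) / g}"
  have b: "0 < b" "a \<le> b" "b \<le> 1" using insert.prems by auto force+
  have 1: "emeasure Q {x \<in> space Q. x \<in> ?E G} \<le> (\<integral>\<^sup>+ x. indicator (?E G) x * ennreal (exp (r * real (N b x) / b - T)) \<partial>Q)"
    using insert.IH[of b] insert.hyps insert.prems b by force
  let ?C = "{x \<in> space Q. x \<notin> ?E G \<and> T \<le> r * real (N b x) / b}"
  have E_meas [measurable]: "{x \<in> space Q. x \<in> ?E H} \<in> sets Q" if "finite H" for H
    using that by (simp only: mem_Collect_eq) measurable
  have C_meas [measurable]: "?C \<in> sets Q"
  proof -
    have "?C = {x \<in> space Q. T \<le> r * real (N b x) / b} - {x \<in> space Q. x \<in> ?E G}" by auto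
    also have "\<dots> \<in> sets Q" using E_meas[OF \<open>finite G\<close>] by (intro sets.Diff) measurable
    finally show ?thesis .
  qed
  have ind: "indicator (?E H) x = (indicator {x \<in> space Q. x \<in> ?E H} x :: ennreal)" if "x \<in> space Q" for H x
    using that by (auto simp: indicator_def)
  have 2: "emeasure Q ?C \<le> (\<integral>\<^sup>+ x. indicator ?C x * ennreal (exp (r * real (N b x) / b - T)) \<partial>Q)"
  proof -
    have "emeasure Q ?C = (\<integral>\<^sup>+ x. indicator ?C x \<partial>Q)"
      by (rule nn_integral_indicator[symmetric]) fact
    also have "\<dots> \<le> (\<integral>\<^sup>+ x. indicator ?C x * ennreal (exp (r * real (N b x) / b - T)) \<partial>Q)"
      by (intro nn_integral_mono) (auto simp: indicator_def)
    finally show ?thesis .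
  qed
  have "{x \<in> space Q. x \<in> ?E (insert b G)} = {x \<in> space Q. x \<in> ?E G} \<union> ?C" by auto
  then have "emeasure Q {x \<in> space Q. x \<in> ?E (insert b G)} = emeasure Q {x \<in> space Q. x \<in> ?E G} + emeasure Q ?C"
    using E_meas[OF \<open>finite G\<close>] C_meas by (simp only:) (rule plus_emeasure[symmetric], auto)
  also have "\<dots> \<le> (\<integral>\<^sup>+ x. indicator (?E G) x * ennreal (exp (r * real (N b x) / b - T)) \<partial>Q) +
     (\<integral>\<^sup>+ x. indicator ?C x * ennreal (exp (r * real (N b x) / b - T)) \<partial>Q)"
    by (intro add_mono 1 2)
  also have "\<dots> = (\<integral>\<^sup>+ x. indicator {x \<in> space Q. x \<in> ?E G} x * ennreal (exp (r * real (N b x) / b - T)) \<partial>Q) +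
     (\<integral>\<^sup>+ x. indicator ?C x * ennreal (exp (r * real (N b x) / b - T)) \<partial>Q)"
    using ind by (intro arg_cong2[where f = "(+)"] nn_integral_cong) simp_all
  also have "\<dots> = (\<integral>\<^sup>+ x. indicator {x \<in> space Q. x \<in> ?E G} x * ennreal (exp (r * real (N b x) / b - T)) +
      indicator ?C x * ennreal (exp (r * real (N b x) / b - T)) \<partial>Q)"
    using E_meas[OF \<open>finite G\<close>] C_meas by (intro nn_integral_add[symmetric] borel_measurable_times_ennreal borel_measurable_indicator) measurable
  also have "\<dots> = (\<integral>\<^sup>+ x. indicator (?E (insert b G)) x * ennreal (exp (r * real (N b x) / b - T)) \<partial>Q)"
    by (intro nn_integral_cong) (auto simp: indicator_def)
  also have "\<dots> \<le> (\<integral>\<^sup>+ x. indicator (?E (insert b G)) x * ennreal (exp (r * real (N a x) / a - T)) \<partial>Q)"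
  proof -
    have s: "(\<integral>\<^sup>+ x. indicator (?E (insert b G)) x * ennreal (exp (r * real (N c x) / c - T)) \<partial>Q)
      = (\<integral>\<^sup>+ x. indicator (?E (insert b G)) x * ennreal (exp (r * real (N c x) / c)) \<partial>Q) * ennreal (exp (- T))" for c
    proof -
      have "(\<integral>\<^sup>+ x. indicator (?E (insert b G)) x * ennreal (exp (r * real (N c x) / c - T)) \<partial>Q)
        = (\<integral>\<^sup>+ x. (indicator {x \<in> space Q. x \<in> ?E (insert b G)} x * ennreal (exp (r * real (N c x) / c))) * ennreal (exp (- T)) \<partial>Q)"
        by (intro nn_integral_cong) (auto simp: indicator_def exp_diff exp_minus ennreal_mult[symmetric] divide_inverse)
      also have "\<dots> = (\<integral>\<^sup>+ x. indicator {x \<in> space Q. x \<in> ?E (insert b G)} x * ennreal (exp (r * real (N c x) / c)) \<partial>Q) * ennreal (exp (- T))"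
        using E_meas[of "insert b G"] \<open>finite G\<close>
        by (intro nn_integral_multc borel_measurable_times_ennreal borel_measurable_indicator) (auto simp del: mem_Collect_eq)
      also have "(\<integral>\<^sup>+ x. indicator {x \<in> space Q. x \<in> ?E (insert b G)} x * ennreal (exp (r * real (N c x) / c)) \<partial>Q)
         = (\<integral>\<^sup>+ x. indicator (?E (insert b G)) x * ennreal (exp (r * real (N c x) / c)) \<partial>Q)"
        by (intro nn_integral_cong) (auto simp: indicator_def)
      finally show ?thesis .
    qed
    have "b \<le> g" if "g \<in> insert b G" for g using that insert.hyps by force
    then show ?thesis unfolding s
      using b \<open>finite G\<close> \<open>0 < a\<close> by (intro mult_right_mono nn_integral_exp_N_mono) auto
  qed
  finally show ?case by simp
qed

text \<open>After \<open>maximal_aux\<close> the event is dropped, and the moment generating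
  function at \<open>a\<close> factorises over the sample; \<open>1 + x \<le> exp x\<close> brings
  it to Poisson form. The sign of \<open>r\<close> is free: positive for upper deviations, negative
  for lower ones.\<close>

lemma maximal_grid:
  fixes a r T :: real
  assumes "finite G" "0 < a" "a \<le> 1" "\<And>g. g \<in> G \<Longrightarrow> a \<le> g \<and> g \<le> 1"
  shows "measure Q {x \<in> space Q. \<exists>g\<in>G. T \<le> r * real (N g x) / g} \<le> exp (real (card I) * a * (exp (r / a) - 1) - T)"
proof -
  interpret product_sigma_finite "\<lambda>_. \<mu>" ..
  have w: "(\<integral>\<^sup>+ y. ennreal (wt r a y) \<partial>\<mu>) = ennreal (1 + a * (exp (r / a) - 1))"
  proof -
    have "AE y in \<mu>. \<tau> y \<le> 1"
      using cdf[of 1] sets_eq_imp_space_eq[OF sets_\<mu>] by (intro AE_I_eq_1) auto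
    then have "(\<integral>\<^sup>+ y. ennreal (wt r a y) \<partial>\<mu>) = (\<integral>\<^sup>+ y. indicator {y. \<tau> y \<le> 1} y * ennreal (wt r a y) \<partial>\<mu>)"
      by (intro nn_integral_cong_AE) auto
    then show ?thesis using assms by (simp add: nn_integral_wt)
  qed
  have "emeasure Q {x \<in> space Q. \<exists>g\<in>G. T \<le> r * real (N g x) / g}
    \<le> (\<integral>\<^sup>+ x. indicator {x. \<exists>g\<in>G. T \<le> r * real (N g x) / g} x * ennreal (exp (r * real (N a x) / a - T)) \<partial>Q)"
    using assms by (intro maximal_aux) auto
  also have "\<dots> \<le> (\<integral>\<^sup>+ x. ennreal (exp (- T)) * (\<Prod>i\<in>I. ennreal (wt r a (x i))) \<partial>Q)"
    by (intro nn_integral_mono)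
      (auto simp: indicator_def prod_ennreal wt_def exp_N[unfolded wt_def, symmetric] ennreal_mult[symmetric] exp_minus exp_diff divide_inverse mult.commute)
  also have "\<dots> = ennreal (exp (- T)) * (\<integral>\<^sup>+ x. (\<Prod>i\<in>I. ennreal (wt r a (x i))) \<partial>Q)"
    by (subst nn_integral_cmult) auto
  also have "\<dots> = ennreal (exp (- T)) * ennreal (1 + a * (exp (r / a) - 1)) ^ card I"
    by (subst product_nn_integral_prod[OF finI]) (auto simp: w)
  also have "\<dots> \<le> ennreal (exp (- T)) * ennreal (exp (a * (exp (r / a) - 1))) ^ card I"
    by (intro mult_left_mono power_mono ennreal_leI exp_ge_add_one_self) auto
  also have "\<dots> = ennreal (exp (real (card I) * a * (exp (r / a) - 1) - T))"
    by (simp add: ennreal_power ennreal_mult[symmetric] exp_of_nat_mult[symmetric] exp_add[symmetric] algebra_simps)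
  finally show ?thesis
    by (subst (asm) Q.emeasure_eq_measure) (simp add: ennreal_le_iff)
qed
end

section \<open>From finite grids to all levels\<close>

lemma exp_ln2_diff: "exp (ln 2 - x) = 2 * exp (- x)" for x :: real
  by (simp add: exp_diff exp_minus divide_inverse)

context unif_sample begin

lemma N_mono: "v \<le> g \<Longrightarrow> N v x \<le> N g x"
  unfolding N_def using finI by (intro card_mono) auto

lemma grid_above:
  assumes "0 < m" "a \<le> v" "v \<le> 1" "0 < a"
  obtains g where "g \<in> (\<lambda>i. max a (real i / real m)) ` {..m}" "v \<le> g" "g \<le> v + 1 / m"
proof -
  define i where "i = nat \<lceil>v * m\<rceil>"
  have "v * m \<le> m" using assms by (simp add: mult_left_le_one_le)
  then have "\<lceil>v * m\<rceil> \<le> int m" by (simp add: ceiling_le_iff)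
  then have i: "i \<le> m" by (simp only: i_def nat_le_iff)
  have "0 < v * m" using assms by simp
  then have "0 \<le> \<lceil>v * m\<rceil>" by simp
  then have "real i = of_int \<lceil>v * m\<rceil>" by (simp add: i_def)
  then have "v * m \<le> real i" "real i \<le> v * m + 1" by linarith+
  then have "v \<le> real i / m" "real i / m \<le> v + 1 / m" using assms by (auto simp: field_simps)
  moreover have "max a (real i / m) \<in> (\<lambda>i. max a (real i / real m)) ` {..m}" using i by blast
  ultimately show thesis using assms by (intro that[of "max a (real i / m)"]) auto
qed

text \<open>The rounding is strict because lower deviations count \<open>\<tau> (x i) < v\<close>
  whereas \<open>N g x\<close> counts \<open>\<tau> (x i) \<le> g\<close>; with \<open>g < v\<close>
  the latter is at most the former.\<close>

lemma grid_below:
  assumes "0 < m" "a < v" "v \<le> 1" "0 < a"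
  obtains g where "g \<in> (\<lambda>i. max a (real i / real m)) ` {..m}" "g < v" "v \<le> g + 1 / m"
proof -
  define i where "i = nat (\<lceil>v * m\<rceil> - 1)"
  have "v * m \<le> m" using assms by (simp add: mult_left_le_one_le)
  then have "\<lceil>v * m\<rceil> \<le> int m" by (simp add: ceiling_le_iff)
  then have i: "i \<le> m" by (simp add: i_def)
  have "0 < v * m" using assms by simp
  then have "0 < \<lceil>v * m\<rceil>" by simp
  then have "real i = of_int \<lceil>v * m\<rceil> - 1" by (simp add: i_def)
  then have "v * m \<le> real i + 1" "real i < v * m" by linarith+
  then have "v \<le> real i / m + 1 / m" "real i / m < v" using assms by (auto simp: field_simps)
  then show thesis using i assms by (intro that[of "max a (real i / m)"]) auto
qed

lemma grid_sets: "{x \<in> space Q. \<exists>g\<in>(\<lambda>i. max a (real i / real m)) ` {..m}. T \<le> r * real (N g x) / g} \<in> sets Q"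
  by measurable

text \<open>Rounding \<open>v\<close> up to a grid point lowers the threshold slightly. The mesh is
  so fine that this costs at most \<open>ln 2\<close> in the exponent, which is the factor
  2.\<close>

lemma maximal_upper:
  fixes a y :: real
  assumes "0 < a" "a \<le> 1" "0 \<le> y"
  shows "\<exists>S\<in>sets Q. {x \<in> space Q. \<exists>v\<in>{a..1}. (1 + y) * real (card I) * v \<le> real (N v x)} \<subseteq> S
     \<and> measure Q S \<le> 2 * exp (- (real (card I) * a * y\<^sup>2 / (2 + y)))"
proof (cases "y = 0")
  case True
  show ?thesis using True by (intro bexI[of _ "space Q"]) (auto simp: Q.prob_space)
next
  case False
  then have y: "y > 0" using assms by simp
  define \<rho> c where "\<rho> = ln (1 + y)" and "c = real (card I)"
  have \<rho>: "0 < \<rho>" "exp \<rho> = 1 + y" using y by (auto simp: \<rho>_def)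
  have c: "0 \<le> c" by (simp add: c_def)
  define m where "m = nat \<lceil>c * \<rho> * (1 + y) / ln 2\<rceil> + 1"
  have m: "0 < m" and "c * \<rho> * (1 + y) / ln 2 \<le> m" unfolding m_def by (auto, linarith)
  then have m2: "c * \<rho> * (1 + y) / m \<le> ln 2" by (simp add: field_simps)
  define G where "G = (\<lambda>i. max a (real i / real m)) ` {..m}"
  \<comment> \<open>The relative rounding error:
    \<open>1 / m = \<zeta> * a \<le> \<zeta> * v\<close>.\<close>
  define \<zeta> where "\<zeta> = 1 / (a * m)"
  have \<zeta>: "0 < \<zeta>" using assms m by (simp add: \<zeta>_def)
  \<comment> \<open>The optimal Chernoff parameter at level \<open>a\<close> is
    \<open>ln (1 + y) = \<rho>\<close>, and the moment generating function is evaluated at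
    \<open>r / a\<close>.\<close>
  define r T where "r = \<rho> * a" and "T = r * (1 + y) * c / (1 + \<zeta>)"
  have r: "0 < r" using \<rho> assms by (simp add: r_def)
  let ?S = "{x \<in> space Q. \<exists>g\<in>G. T \<le> r * real (N g x) / g}"
  have sub: "{x \<in> space Q. \<exists>v\<in>{a..1}. (1 + y) * real (card I) * v \<le> real (N v x)} \<subseteq> ?S"
  proof safe
    fix x v assume x: "x \<in> space Q" "v \<in> {a..1}" "(1 + y) * real (card I) * v \<le> real (N v x)"
    then obtain g where g: "g \<in> G" "v \<le> g" "g \<le> v + 1 / m"
      using grid_above[OF m, of a v] assms unfolding G_def by auto
    have "1 / m \<le> v * \<zeta>" using x assms m by (simp add: \<zeta>_def field_simps)
    then have "g \<le> v * (1 + \<zeta>)" using g by (simp add: algebra_simps)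
    then have "T * g \<le> T * (v * (1 + \<zeta>))"
      using r y c \<zeta> by (intro mult_left_mono) (auto simp: T_def)
    also have "\<dots> = r * ((1 + y) * c * v)" using \<zeta> by (simp add: T_def)
    also have "\<dots> \<le> r * real (N v x)" using x r by (auto simp: c_def)
    also have "\<dots> \<le> r * real (N g x)" using N_mono[OF g(2), of x] r by simp
    finally have "T \<le> r * real (N g x) / g" using g x assms by (simp add: field_simps)
    then show "\<exists>g\<in>G. T \<le> r * real (N g x) / g" using g by blast
  qed
  have "measure Q ?S \<le> exp (card I * a * (exp (r / a) - 1) - T)"
    by (rule maximal_grid) (use assms m in \<open>auto simp: G_def\<close>)
  also have "card I * a * (exp (r / a) - 1) - T = c * a * y - T"
    using assms \<rho> by (simp add: r_def c_def)
  also have "\<dots> \<le> ln 2 - c * a * y\<^sup>2 / (2 + y)"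
  proof -
    have "1 - \<zeta> \<le> 1 / (1 + \<zeta>)" using \<zeta> by (simp add: field_simps)
    then have "r * (1 + y) * c * (1 - \<zeta>) \<le> r * (1 + y) * c * (1 / (1 + \<zeta>))"
      using r y c by (intro mult_left_mono) auto
    then have "r * (1 + y) * c * (1 - \<zeta>) \<le> T" by (simp add: T_def)
    moreover have "r * (1 + y) * c * \<zeta> = c * \<rho> * (1 + y) / m"
      using assms by (simp add: \<zeta>_def r_def)
    ultimately have "r * (1 + y) * c - ln 2 \<le> T" using m2 by (simp add: algebra_simps)
    moreover have "c * a * (y\<^sup>2 / (2 + y)) \<le> c * a * ((1 + y) * \<rho> - y)"
      using bennett_lower[of y] assms c unfolding \<rho>_def by (intro mult_left_mono) auto
    ultimately show ?thesis by (simp add: algebra_simps r_def)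
  qed
  finally have "measure Q ?S \<le> exp (ln 2 - c * a * y\<^sup>2 / (2 + y))" by simp
  also have "\<dots> = 2 * exp (- (real (card I) * a * y\<^sup>2 / (2 + y)))" 
    unfolding c_def by (rule exp_ln2_diff)
  finally have le: "measure Q ?S \<le> \<dots>" .
  have "?S \<in> sets Q" unfolding G_def by (rule grid_sets)
  with sub le show ?thesis by (intro bexI[of _ ?S] conjI)
qed

lemma maximal_lower:
  fixes a z :: real
  assumes "0 < a" "a \<le> 1" "0 \<le> z" "z < 1"
  shows "\<exists>S\<in>sets Q. {x \<in> space Q. \<exists>v\<in>{a<..1}. real (card {i \<in> I. \<tau> (x i) < v}) \<le> (1 - z) * real (card I) * v} \<subseteq> S
     \<and> measure Q S \<le> 2 * exp (- (real (card I) * a * z\<^sup>2 / 2))"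
proof (cases "z = 0")
  case True
  show ?thesis using True by (intro bexI[of _ "space Q"]) (auto simp: Q.prob_space)
next
  case False
  then have z: "z > 0" using assms by simp
  define \<rho> c where "\<rho> = ln (1 - z)" and "c = real (card I)"
  have \<rho>: "\<rho> < 0" "exp \<rho> = 1 - z" using z assms by (auto simp: \<rho>_def)
  have c: "0 \<le> c" by (simp add: c_def)
  define m where "m = nat \<lceil>c * (- \<rho>) * (1 - z) / ln 2\<rceil> + 1"
  have m: "0 < m" and "c * (- \<rho>) * (1 - z) / ln 2 \<le> m" unfolding m_def by (auto, linarith)
  then have m2: "c * (- \<rho>) * (1 - z) / m \<le> ln 2" by (simp add: field_simps)
  define G where "G = (\<lambda>i. max a (real i / real m)) ` {..m}"
  define \<zeta> where "\<zeta> = 1 / (a * m)"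
  have \<zeta>: "0 < \<zeta>" using assms m by (simp add: \<zeta>_def)
  \<comment> \<open>With \<open>r\<close> negative, \<open>T\<close> is nonpositive and rounding
    \<open>v\<close> down enters as a multiplication by \<open>1 + \<zeta>\<close>, which again
    lowers the threshold.\<close>
  define r T where "r = \<rho> * a" and "T = r * (1 - z) * c * (1 + \<zeta>)"
  have r: "r < 0" using \<rho> assms by (simp add: r_def mult_neg_pos)
  let ?S = "{x \<in> space Q. \<exists>g\<in>G. T \<le> r * real (N g x) / g}"
  have sub: "{x \<in> space Q. \<exists>v\<in>{a<..1}. real (card {i \<in> I. \<tau> (x i) < v}) \<le> (1 - z) * real (card I) * v} \<subseteq> ?S"
  proof safe
    fix x v assume x: "x \<in> space Q" "v \<in> {a<..1}" "real (card {i \<in> I. \<tau> (x i) < v}) \<le> (1 - z) * real (card I) * v"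
    then obtain g where g: "g \<in> G" "g < v" "v \<le> g + 1 / m"
      using grid_below[OF m, of a v] assms unfolding G_def by auto
    have ga: "a \<le> g" using g by (auto simp: G_def)
    have "1 / m \<le> g * \<zeta>" using ga assms m by (simp add: \<zeta>_def field_simps)
    then have vg: "v \<le> g * (1 + \<zeta>)" using g by (simp add: algebra_simps)
    have "N g x \<le> card {i \<in> I. \<tau> (x i) < v}"
      unfolding N_def using finI g by (intro card_mono) auto
    then have "real (N g x) \<le> (1 - z) * c * v" using x by (simp add: c_def)
    also have "\<dots> \<le> (1 - z) * c * (g * (1 + \<zeta>))"
      using vg assms c by (intro mult_left_mono) auto
    finally have "r * ((1 - z) * c * (g * (1 + \<zeta>))) \<le> r * real (N g x)"
      using r by (intro mult_left_mono_neg) auto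
    then have "T \<le> r * real (N g x) / g" using ga assms by (simp add: T_def field_simps)
    then show "\<exists>g\<in>G. T \<le> r * real (N g x) / g" using g by blast
  qed
  have "measure Q ?S \<le> exp (card I * a * (exp (r / a) - 1) - T)"
    by (rule maximal_grid) (use assms m in \<open>auto simp: G_def\<close>)
  also have "card I * a * (exp (r / a) - 1) - T = c * a * (- z) - T"
    using assms \<rho> by (simp add: r_def c_def)
  also have "\<dots> \<le> ln 2 - c * a * z\<^sup>2 / 2"
  proof -
    have "r * (1 - z) * c * \<zeta> = - (c * (- \<rho>) * (1 - z) / m)"
      using assms by (simp add: \<zeta>_def r_def)
    then have "r * (1 - z) * c - ln 2 \<le> T" using m2 by (simp add: T_def algebra_simps)
    moreover have "c * a * (z\<^sup>2 / 2) \<le> c * a * ((1 - z) * \<rho> + z)"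
      using bennett_lower_neg[of z] assms c unfolding \<rho>_def by (intro mult_left_mono) auto
    ultimately show ?thesis by (simp add: algebra_simps r_def)
  qed
  finally have "measure Q ?S \<le> exp (ln 2 - c * a * z\<^sup>2 / 2)" by simp
  also have "\<dots> = 2 * exp (- (real (card I) * a * z\<^sup>2 / 2))" 
    unfolding c_def by (rule exp_ln2_diff)
  finally have le: "measure Q ?S \<le> \<dots>" .
  have "?S \<in> sets Q" unfolding G_def by (rule grid_sets)
  with sub le show ?thesis by (intro bexI[of _ ?S] conjI)
qed

end

section \<open>Peeling\<close>

lemma geometric_block:
  fixes a0 \<theta> v :: real
  assumes "0 < a0" "1 < \<theta>" "a0 < v" "v \<le> 1"
  obtains k where "k < nat \<lceil>ln (1 / a0) / ln \<theta>\<rceil>" "a0 * \<theta> ^ k < v" "v \<le> a0 * \<theta> ^ Suc k"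
proof -
  obtain m where "v / a0 < \<theta> ^ m" using real_arch_pow[OF assms(2)] by blast
  then have ex: "\<exists>m. v \<le> a0 * \<theta> ^ m" using assms by (intro exI[of _ m]) (simp add: field_simps)
  define m0 where "m0 = (LEAST m. v \<le> a0 * \<theta> ^ m)"
  have m0: "v \<le> a0 * \<theta> ^ m0" unfolding m0_def using ex by (rule LeastI_ex)
  then have "m0 \<noteq> 0" using assms by (intro notI) simp
  then obtain k where k: "m0 = Suc k" by (cases m0) auto
  have lt: "a0 * \<theta> ^ k < v" using not_less_Least[of k "\<lambda>m. v \<le> a0 * \<theta> ^ m"] k unfolding m0_def by simp
  then have "\<theta> ^ k < 1 / a0" using assms by (simp add: field_simps)
  then have "ln (\<theta> ^ k) < ln (1 / a0)" using assms by (subst ln_less_cancel_iff) auto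
  then have "real k * ln \<theta> < ln (1 / a0)" using assms by (simp add: ln_realpow)
  then have "real k < ln (1 / a0) / ln \<theta>" using assms by (simp add: pos_less_divide_eq)
  then have "k < nat \<lceil>ln (1 / a0) / ln \<theta>\<rceil>" by linarith
  then show thesis using that lt m0 k by simp
qed

text \<open>Blocks that start below \<open>b\<close> are charged the worst exponent
  \<open>e a0\<close>, but there are only about \<open>ln (b / a0) / ln \<theta>\<close> of them;
  for all others \<open>e b\<close> is available.\<close>

lemma geometric_sum_le:
  fixes a0 \<theta> b :: real and e :: "real \<Rightarrow> real"
  assumes "0 < a0" "a0 \<le> 1" "1 < \<theta>" "a0 \<le> b" and mono: "\<And>a a'. a0 \<le> a \<Longrightarrow> a \<le> a' \<Longrightarrow> e a \<le> e a'"
  shows "(\<Sum>k<nat \<lceil>ln (1 / a0) / ln \<theta>\<rceil>. exp (- e (a0 * \<theta> ^ k)))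
    \<le> (ln (b / a0) / ln \<theta> + 1) * exp (- e a0) + (ln (1 / a0) / ln \<theta> + 1) * exp (- e b)"
proof -
  define K where "K = nat \<lceil>ln (1 / a0) / ln \<theta>\<rceil>"
  define K1 where "K1 = nat \<lceil>ln (b / a0) / ln \<theta>\<rceil>"
  have lt: "0 < ln \<theta>" using assms by simp
  have K: "real K \<le> ln (1 / a0) / ln \<theta> + 1"
    unfolding K_def using assms lt by (simp add: of_nat_nat)
  have K1: "real K1 \<le> ln (b / a0) / ln \<theta> + 1"
    unfolding K1_def using assms lt by (simp add: of_nat_nat)
  have big: "b \<le> a0 * \<theta> ^ k" if "K1 \<le> k" for k
  proof -
    have "ln (b / a0) / ln \<theta> \<le> k" using that unfolding K1_def by linarith
    then have "ln (b / a0) \<le> ln (\<theta> ^ k)" using lt assms by (simp add: field_simps ln_realpow)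
    then have "b / a0 \<le> \<theta> ^ k" using assms by (subst (asm) ln_le_cancel_iff) auto
    then show ?thesis using assms by (simp add: field_simps)
  qed
  have small: "a0 \<le> a0 * \<theta> ^ k" for k using assms by simp
  have "(\<Sum>k<K. exp (- e (a0 * \<theta> ^ k))) \<le> (\<Sum>k<K. (if k < K1 then exp (- e a0) else 0) + exp (- e b))"
    using mono[OF order_refl small] mono[OF \<open>a0 \<le> b\<close> big] by (intro sum_mono) (auto simp: add_increasing2 not_less)
  also have "\<dots> = real (card ({..<K} \<inter> {k. k < K1})) * exp (- e a0) + real K * exp (- e b)"
    by (simp add: sum.distrib sum.If_cases)
  also have "\<dots> \<le> real K1 * exp (- e a0) + real K * exp (- e b)"
    using card_mono[of "{..<K1}" "{..<K} \<inter> {k. k < K1}"] by (intro add_mono mult_right_mono) auto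
  also have "\<dots> \<le> (ln (b / a0) / ln \<theta> + 1) * exp (- e a0) + (ln (1 / a0) / ln \<theta> + 1) * exp (- e b)"
    using K K1 by (intro add_mono mult_right_mono) auto
  finally show ?thesis unfolding K_def .
qed

text \<open>A union bound over the blocks, where \<open>e a\<close> is the exponent available on the
  block that starts at \<open>a\<close>. It increases with \<open>a\<close> because counts are
  closer to Gaussian where more points are expected.\<close>

lemma (in prob_space) peeling:
  fixes a0 \<theta> b :: real and e :: "real \<Rightarrow> real"
  assumes "0 < a0" "a0 \<le> 1" "1 < \<theta>" "a0 \<le> b" and mono: "\<And>a a'. a0 \<le> a \<Longrightarrow> a \<le> a' \<Longrightarrow> e a \<le> e a'"
    and block: "\<And>a. a0 \<le> a \<Longrightarrow> a \<le> 1 \<Longrightarrow>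
      \<exists>S\<in>events. {x \<in> space M. \<exists>v. a < v \<and> v \<le> 1 \<and> v \<le> \<theta> * a \<and> Bad v x} \<subseteq> S \<and> prob S \<le> 2 * exp (- e a)"
  shows "\<exists>S\<in>events. {x \<in> space M. \<exists>v. a0 < v \<and> v \<le> 1 \<and> Bad v x} \<subseteq> S \<and>
     prob S \<le> 2 * ((ln (b / a0) / ln \<theta> + 1) * exp (- e a0) + (ln (1 / a0) / ln \<theta> + 1) * exp (- e b))"
proof -
  define K where "K = nat \<lceil>ln (1 / a0) / ln \<theta>\<rceil>"
  have le1: "a0 * \<theta> ^ k \<le> 1" if "k < K" for k
  proof -
    have "real k < ln (1 / a0) / ln \<theta>" using that unfolding K_def by linarith
    then have "ln (\<theta> ^ k) \<le> ln (1 / a0)" using assms by (simp add: field_simps ln_realpow)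
    then have "\<theta> ^ k \<le> 1 / a0" using assms by (subst (asm) ln_le_cancel_iff) auto
    then show ?thesis using assms by (simp add: field_simps)
  qed
  let ?B = "\<lambda>k. {x \<in> space M. \<exists>v. a0 * \<theta> ^ k < v \<and> v \<le> 1 \<and> v \<le> \<theta> * (a0 * \<theta> ^ k) \<and> Bad v x}"
  have "\<forall>k\<in>{..<K}. \<exists>S. S \<in> events \<and> ?B k \<subseteq> S \<and> prob S \<le> 2 * exp (- e (a0 * \<theta> ^ k))"
    using block le1 assms(1,3) by (simp add: Bex_def)
  from bchoice[OF this] obtain S where S: "\<And>k. k < K \<Longrightarrow> S k \<in> events"
     "\<And>k. k < K \<Longrightarrow> ?B k \<subseteq> S k" "\<And>k. k < K \<Longrightarrow> prob (S k) \<le> 2 * exp (- e (a0 * \<theta> ^ k))"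
    by (auto simp del: mem_Collect_eq)
  have "{x \<in> space M. \<exists>v. a0 < v \<and> v \<le> 1 \<and> Bad v x} \<subseteq> (\<Union>k<K. S k)"
  proof safe
    fix x v assume x: "x \<in> space M" "a0 < v" "v \<le> 1" "Bad v x"
    obtain k where "k < K" "a0 * \<theta> ^ k < v" "v \<le> a0 * \<theta> ^ Suc k"
      using geometric_block[of a0 \<theta> v] assms x unfolding K_def by blast
    then show "x \<in> (\<Union>k<K. S k)" using S(2)[of k] x by (auto simp: mult.left_commute)
  qed
  moreover have "(\<Union>k<K. S k) \<in> events" using S(1) by auto
  moreover have "prob (\<Union>k<K. S k) \<le> (\<Sum>k<K. prob (S k))"
    using S(1) by (intro finite_measure_subadditive_finite) auto
  moreover have "\<dots> \<le> (\<Sum>k<K. 2 * exp (- e (a0 * \<theta> ^ k)))" using S(3) by (intro sum_mono) auto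
  moreover have "\<dots> \<le> 2 * ((ln (b / a0) / ln \<theta> + 1) * exp (- e a0) + (ln (1 / a0) / ln \<theta> + 1) * exp (- e b))"
    unfolding K_def sum_distrib_left[symmetric]
    by (intro mult_left_mono geometric_sum_le assms(1-4)) (auto intro: mono)
  ultimately show ?thesis by (intro bexI[of _ "\<Union>k<K. S k"]) auto
qed

section \<open>Peeling for the counts of a uniform sample\<close>

context unif_sample begin

text \<open>An excess \<open>D\<close> with \<open>D\<^sup>2 \<ge> 2 * \<Lambda> * v / n\<close> is
  a relative excess of at least \<open>sqrt (2 * \<Lambda> / (n * v))\<close>. On a block
  \<open>v \<le> \<theta> * a\<close> bounds this below by one number, so a single use of
  \<open>maximal_upper\<close> at \<open>a\<close> covers the block, and \<open>e a\<close> is its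
  exponent.\<close>

lemma peel_upper:
  fixes a0 \<theta> b \<Lambda> n :: real
  assumes "0 < a0" "a0 \<le> 1" "1 < \<theta>" "a0 \<le> b" "0 \<le> \<Lambda>" "0 < n" "n = real (card I)"
  defines "e \<equiv> \<lambda>a. (\<Lambda> / \<theta>) / (1 + sqrt (2 * \<Lambda> / (n * \<theta> * a)) / 2)"
  shows "\<exists>S\<in>sets Q. {x \<in> space Q. \<exists>v. a0 < v \<and> v \<le> 1 \<and>
      (\<exists>D\<ge>0. 2 * \<Lambda> * v / n \<le> D\<^sup>2 \<and> n * (v + D) \<le> real (N v x))} \<subseteq> S \<and>
     measure Q S \<le> 2 * ((ln (b / a0) / ln \<theta> + 1) * exp (- e a0) + (ln (1 / a0) / ln \<theta> + 1) * exp (- e b))"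
proof (rule Q.peeling)
  fix a a' assume a: "a0 \<le> a" "a \<le> a'"
  have "2 * \<Lambda> / (n * \<theta> * a') \<le> 2 * \<Lambda> / (n * \<theta> * a)"
    using a assms by (intro divide_left_mono) auto
  then show "e a \<le> e a'" unfolding e_def
    using a assms by (intro divide_left_mono add_left_mono divide_right_mono mult_pos_pos add_pos_nonneg) auto
next
  fix a assume a: "a0 \<le> a" "a \<le> 1"
  then have a0: "0 < a" using assms by simp
  define y where "y = sqrt (2 * \<Lambda> / (n * \<theta> * a))"
  have y: "0 \<le> y" "y\<^sup>2 = 2 * \<Lambda> / (n * \<theta> * a)" using a0 assms by (auto simp: y_def)
  obtain S where S: "S \<in> sets Q" "{x \<in> space Q. \<exists>v\<in>{a..1}. (1 + y) * real (card I) * v \<le> real (N v x)} \<subseteq> S"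
    "measure Q S \<le> 2 * exp (- (real (card I) * a * y\<^sup>2 / (2 + y)))"
    using maximal_upper[OF a0 a(2) y(1)] by blast
  have "real (card I) * a * y\<^sup>2 / (2 + y) = e a"
  proof -
    have "n * a * y\<^sup>2 = 2 * (\<Lambda> / \<theta>)" using a0 assms y(2) by simp
    then show ?thesis unfolding e_def y_def[symmetric] assms(7)[symmetric] using y(1) by (simp add: field_simps)
  qed
  moreover have "{x \<in> space Q. \<exists>v. a < v \<and> v \<le> 1 \<and> v \<le> \<theta> * a \<and>
      (\<exists>D\<ge>0. 2 * \<Lambda> * v / n \<le> D\<^sup>2 \<and> n * (v + D) \<le> real (N v x))} \<subseteq> S"
  proof (rule order_trans[OF _ S(2)], safe)
    fix x v D assume x: "x \<in> space Q" "a < v" "v \<le> 1" "v \<le> \<theta> * a" "0 \<le> D"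
      "2 * \<Lambda> * v / n \<le> D\<^sup>2" "n * (v + D) \<le> real (N v x)"
    have "(y * v)\<^sup>2 = (2 * \<Lambda> * v / n) * (v / (\<theta> * a))" unfolding power_mult_distrib y(2) by (simp add: power2_eq_square)
    also have "\<dots> \<le> (2 * \<Lambda> * v / n) * 1"
      using x a0 assms by (intro mult_left_mono) auto
    also have "\<dots> \<le> D\<^sup>2" using x by simp
    finally have "y * v \<le> D" using \<open>0 \<le> D\<close> by (rule power2_le_imp_le)
    then have "n * (v + y * v) \<le> n * (v + D)" using assms by (intro mult_left_mono) auto
    also have "\<dots> \<le> real (N v x)" by fact
    finally have "(1 + y) * real (card I) * v \<le> real (N v x)"
      unfolding assms(7)[symmetric] by (simp add: algebra_simps)
    then show "\<exists>v\<in>{a..1}. (1 + y) * real (card I) * v \<le> real (N v x)" using x by (intro bexI[of _ v]) auto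
  qed
  ultimately show "\<exists>S\<in>Q.events. {x \<in> space Q. \<exists>v. a < v \<and> v \<le> 1 \<and> v \<le> \<theta> * a \<and>
      (\<exists>D\<ge>0. 2 * \<Lambda> * v / n \<le> D\<^sup>2 \<and> n * (v + D) \<le> real (N v x))} \<subseteq> S \<and> Q.prob S \<le> 2 * exp (- e a)"
    using S by (intro bexI[of _ S]) auto
qed (use assms in auto)

text \<open>The deviation is normalised by the empirical fraction \<open>u\<close>, not by the level
  \<open>v\<close>, to match the factor \<open>1 / (1 - u)\<close> of \<open>Kdiv_upper\<close>.
  This is why the exponent differs from that of \<open>peel_upper\<close>.\<close>

lemma peel_lower:
  fixes a0 \<theta> b \<Lambda> n :: real
  assumes "0 < a0" "a0 \<le> 1" "1 < \<theta>" "a0 \<le> b" "0 \<le> \<Lambda>" "0 < n" "n = real (card I)"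
  defines "e \<equiv> \<lambda>a. (\<Lambda> / \<theta>) / (1 + sqrt (2 * \<Lambda> / (n * \<theta> * a)))\<^sup>2"
  shows "\<exists>S\<in>sets Q. {x \<in> space Q. \<exists>v. a0 < v \<and> v \<le> 1 \<and>
      (\<exists>u\<ge>0. u \<le> v \<and> 2 * \<Lambda> * u / n \<le> (v - u)\<^sup>2 \<and> real (card {i \<in> I. \<tau> (x i) < v}) \<le> n * u)} \<subseteq> S \<and>
     measure Q S \<le> 2 * ((ln (b / a0) / ln \<theta> + 1) * exp (- e a0) + (ln (1 / a0) / ln \<theta> + 1) * exp (- e b))"
proof (rule Q.peeling)
  fix a a' assume a: "a0 \<le> a" "a \<le> a'"
  have "2 * \<Lambda> / (n * \<theta> * a') \<le> 2 * \<Lambda> / (n * \<theta> * a)"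
    using a assms by (intro divide_left_mono) auto
  moreover have "0 \<le> 2 * \<Lambda> / (n * \<theta> * a')" using a assms by auto
  ultimately show "e a \<le> e a'" unfolding e_def
    using a assms by (intro divide_left_mono power_mono add_left_mono mult_pos_pos zero_less_power add_pos_nonneg) auto
next
  fix a assume a: "a0 \<le> a" "a \<le> 1"
  then have a0: "0 < a" using assms by simp
  define y where "y = sqrt (2 * \<Lambda> / (n * \<theta> * a))"
  have y: "0 \<le> y" "y\<^sup>2 = 2 * \<Lambda> / (n * \<theta> * a)" using a0 assms by (auto simp: y_def)
  \<comment> \<open>This \<open>z\<close> satisfies
    \<open>z\<^sup>2 \<le> y\<^sup>2 * (1 - z)\<close>. If \<open>u\<close> exceeded
    \<open>(1 - z) * v\<close>, then \<open>v - u\<close> would be below \<open>z * v\<close>, too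
    small for the normaliser \<open>u\<close>.\<close>
  define z where "z = y / (1 + y)"
  have z: "0 \<le> z" "z < 1" "1 - z = 1 / (1 + y)" using y by (auto simp: z_def field_simps)
  obtain S where S: "S \<in> sets Q" "{x \<in> space Q. \<exists>v\<in>{a<..1}. real (card {i \<in> I. \<tau> (x i) < v}) \<le> (1 - z) * real (card I) * v} \<subseteq> S"
    "measure Q S \<le> 2 * exp (- (real (card I) * a * z\<^sup>2 / 2))"
    using maximal_lower[OF a0 a(2) z(1,2)] by blast
  have "real (card I) * a * z\<^sup>2 / 2 = e a"
  proof -
    have "n * a * y\<^sup>2 = 2 * (\<Lambda> / \<theta>)" using a0 assms y(2) by simp
    then show ?thesis unfolding e_def y_def[symmetric] z_def assms(7)[symmetric] using y(1) by (simp add: power_divide)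
  qed
  moreover have "{x \<in> space Q. \<exists>v. a < v \<and> v \<le> 1 \<and> v \<le> \<theta> * a \<and>
      (\<exists>u\<ge>0. u \<le> v \<and> 2 * \<Lambda> * u / n \<le> (v - u)\<^sup>2 \<and> real (card {i \<in> I. \<tau> (x i) < v}) \<le> n * u)} \<subseteq> S"
  proof (rule order_trans[OF _ S(2)], safe)
    fix x v u assume x: "x \<in> space Q" "a < v" "v \<le> 1" "v \<le> \<theta> * a" "0 \<le> u" "u \<le> v"
      "2 * \<Lambda> * u / n \<le> (v - u)\<^sup>2" "real (card {i \<in> I. \<tau> (x i) < v}) \<le> n * u"
    have "u \<le> (1 - z) * v"
    proof (rule ccontr)
      assume "\<not> u \<le> (1 - z) * v"
      then have u: "(1 - z) * v < u" by simp
      then have "v - u < z * v" by (simp add: algebra_simps)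
      then have "(v - u)\<^sup>2 < (z * v)\<^sup>2" using x by (intro power_strict_mono) auto
      also have "\<dots> = (y * v)\<^sup>2 * (1 / (1 + y)\<^sup>2)" by (simp add: z_def power_mult_distrib power_divide)
      also have "\<dots> \<le> (y * v)\<^sup>2 * (1 / (1 + y))"
        using y(1) by (intro mult_left_mono divide_left_mono) (auto simp: power2_eq_square)
      also have "(y * v)\<^sup>2 * (1 / (1 + y)) = (2 * \<Lambda> * ((1 - z) * v) / n) * (v / (\<theta> * a))"
        unfolding power_mult_distrib y(2) z(3) by (simp add: power2_eq_square mult.assoc mult.left_commute mult.commute)
      also have "\<dots> \<le> (2 * \<Lambda> * ((1 - z) * v) / n) * 1"
        using x a0 assms z y(1) by (intro mult_left_mono) auto
      also have "\<dots> \<le> 2 * \<Lambda> * u / n"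
        using u assms by (simp add: divide_right_mono mult_left_mono)
      finally show False using x by simp
    qed
    then have "n * u \<le> n * ((1 - z) * v)" using assms by (intro mult_left_mono) auto
    then have "real (card {i \<in> I. \<tau> (x i) < v}) \<le> (1 - z) * real (card I) * v"
      using x unfolding assms(7)[symmetric] by (simp add: mult.left_commute mult.assoc)
    then show "\<exists>v\<in>{a<..1}. real (card {i \<in> I. \<tau> (x i) < v}) \<le> (1 - z) * real (card I) * v"
      using x by (intro bexI[of _ v]) auto
  qed
  ultimately show "\<exists>S\<in>Q.events. {x \<in> space Q. \<exists>v. a < v \<and> v \<le> 1 \<and> v \<le> \<theta> * a \<and>
      (\<exists>u\<ge>0. u \<le> v \<and> 2 * \<Lambda> * u / n \<le> (v - u)\<^sup>2 \<and> real (card {i \<in> I. \<tau> (x i) < v}) \<le> n * u)} \<subseteq> S \<and> Q.prob S \<le> 2 * exp (- e a)"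
    using S by (intro bexI[of _ S]) auto
qed (use assms in auto)

end

section \<open>Order statistics and the test statistic\<close>

text \<open>Moves counts from the sample to the sorted list, whose positions start at 0 while
  \<open>pord\<close> starts at 1.\<close>

lemma card_pord:
  fixes n :: nat and y :: "nat \<Rightarrow> real"
  defines "s \<equiv> sort (map (\<lambda>t. 1 - y t) [1..<n+1])"
  shows "card {t \<in> {1..n}. Pr (1 - y t)} = card {i. i < n \<and> Pr (s ! i)}"
proof -
  have "card {t \<in> {1..n}. Pr (1 - y t)} = card (set (filter (\<lambda>t. Pr (1 - y t)) [1..<n+1]))"
    by (rule arg_cong[where f = card]) auto
  also have "\<dots> = length (filter (\<lambda>t. Pr (1 - y t)) [1..<n+1])"
    by (intro distinct_card distinct_filter distinct_upt)
  also have "\<dots> = length (filter Pr (map (\<lambda>t. 1 - y t) [1..<n+1]))"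
    by (simp only: length_filter_map comp_def)
  also have "\<dots> = length (filter Pr s)"
    unfolding s_def filter_sort length_sort ..
  also have "\<dots> = card {i. i < n \<and> Pr (s ! i)}"
    unfolding length_filter_conv_card by (simp add: s_def)
  finally show ?thesis .
qed

lemma pord_nth: "k \<in> {1..n} \<Longrightarrow> pord n y k = sort (map (\<lambda>t. 1 - y t) [1..<n+1]) ! (k - 1)"
  by (auto simp: pord_def)

lemma card_le_pord:
  assumes "k \<in> {1..n}"
  shows "k \<le> card {t \<in> {1..n}. 1 - y t \<le> pord n y k}"
proof -
  let ?s = "sort (map (\<lambda>t. 1 - y t) [1..<n+1])"
  have "{..<k} \<subseteq> {i. i < n \<and> ?s ! i \<le> ?s ! (k - 1)}"
    using assms by (auto intro!: sorted_nth_mono simp del: map_map)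
  from card_mono[OF _ this] have "k \<le> card {i. i < n \<and> ?s ! i \<le> ?s ! (k - 1)}" by simp
  then show ?thesis unfolding pord_nth[OF assms] card_pord[where Pr = "\<lambda>x. x \<le> ?s ! (k - 1)" and y = y] .
qed

lemma card_gt_pord:
  assumes "k \<in> {1..n}"
  shows "card {t \<in> {1..n}. pord n y k < 1 - y t} \<le> n - k"
proof -
  let ?s = "sort (map (\<lambda>t. 1 - y t) [1..<n+1])"
  have "{i. i < n \<and> ?s ! (k - 1) < ?s ! i} \<subseteq> {k..<n}"
  proof safe
    fix i assume i: "i < n" "?s ! (k - 1) < ?s ! i"
    have "i \<le> k - 1 \<Longrightarrow> ?s ! i \<le> ?s ! (k - 1)"
      using assms by (intro sorted_nth_mono) (auto simp del: map_map)
    then have "k - 1 < i" using i(2) by linarith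
    then show "i \<in> {k..<n}" using i(1) assms by simp
  qed
  from card_mono[OF _ this] have "card {i. i < n \<and> ?s ! (k - 1) < ?s ! i} \<le> n - k" by simp
  then show ?thesis unfolding pord_nth[OF assms] card_pord[where Pr = "\<lambda>x. ?s ! (k - 1) < x" and y = y] .
qed

lemma pord_less_iff:
  assumes "k \<in> {1..n}"
  shows "pord n y k < v \<longleftrightarrow> k \<le> card {t \<in> {1..n}. 1 - y t < v}"
proof
  assume v: "pord n y k < v"
  have "k \<le> card {t \<in> {1..n}. 1 - y t \<le> pord n y k}" by (rule card_le_pord) fact
  also have "\<dots> \<le> card {t \<in> {1..n}. 1 - y t < v}" using v by (intro card_mono) auto
  finally show "k \<le> card {t \<in> {1..n}. 1 - y t < v}" .
next
  assume k: "k \<le> card {t \<in> {1..n}. 1 - y t < v}"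
  let ?s = "sort (map (\<lambda>t. 1 - y t) [1..<n+1])"
  have k': "k \<le> card {i. i < n \<and> ?s ! i < v}"
    using k unfolding card_pord[where Pr = "\<lambda>x. x < v" and y = y] .
  show "pord n y k < v"
  proof (rule ccontr)
    assume "\<not> pord n y k < v"
    then have v: "v \<le> ?s ! (k - 1)" by (simp add: pord_nth[OF assms])
    have "{i. i < n \<and> ?s ! i < v} \<subseteq> {..<k - 1}"
    proof safe
      fix i assume i: "i < n" "?s ! i < v"
      have "k - 1 \<le> i \<Longrightarrow> ?s ! (k - 1) \<le> ?s ! i"
        using i by (intro sorted_nth_mono) (auto simp del: map_map)
      then show "i < k - 1" using i v by (auto simp: not_le[symmetric])
    qed
    from card_mono[OF _ this] have "card {i. i < n \<and> ?s ! i < v} \<le> k - 1" by simp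
    then have "k \<le> k - 1" using k' by linarith
    then show False using assms by auto
  qed
qed

lemma trgof_reject_iff:
  assumes "0 < n" "c \<le> 1"
  shows "trgof_reject s c \<delta> n y \<longleftrightarrow> (\<exists>t\<in>{1..n}. c \<le> pord n y (t + 1) \<and>
     (1 + \<delta>) * ln (ln (real n)) \<le> real n * Kplus s (real t / real n) (pord n y t))"
proof -
  let ?T = "{t \<in> {1..n}. pord n y (t + 1) \<ge> c}"
  let ?f = "\<lambda>t. Kplus s (real t / real n) (pord n y t)"
  \<comment> \<open>The convention that the order statistic of index \<open>n + 1\<close> is 1
    admits the index \<open>n\<close> for every \<open>c \<le> 1\<close>, so the maximum is over a
    nonempty set.\<close>
  have ne: "n \<in> ?T" using assms by (simp add: pord_def)
  have "(1 + \<delta>) * ln (ln (real n)) \<le> real n * Max (?f ` ?T) \<longleftrightarrow> (1 + \<delta>) * ln (ln (real n)) / real n \<le> Max (?f ` ?T)"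
    using assms by (simp add: field_simps)
  also have "\<dots> \<longleftrightarrow> (\<exists>t\<in>?T. (1 + \<delta>) * ln (ln (real n)) / real n \<le> ?f t)"
    using ne by (subst Max_ge_iff) auto
  also have "\<dots> \<longleftrightarrow> (\<exists>t\<in>{1..n}. c \<le> pord n y (t + 1) \<and> (1 + \<delta>) * ln (ln (real n)) \<le> real n * ?f t)"
    using assms by (auto simp: field_simps)
  finally show ?thesis unfolding trgof_reject_def Splus_def .
qed

text \<open>Near either end one of \<open>1 / v\<close> and \<open>1 / (1 - u)\<close> dominates and
  the other is at most \<open>2 * \<kappa>\<close> times as large; since
  \<open>1 + 2 * \<kappa> = \<theta>\<close> this loses one factor \<open>\<theta>\<close>. In the
  middle both are bounded and a crude deviation bound is enough.\<close>

lemma Kdiv_large_cases: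
  fixes n L u v \<theta> \<kappa> :: real
  assumes v: "0 < v" "v < u" "u < 1" and s: "- 1 \<le> s" "s \<le> 2" and n: "0 < n" and L: "0 < L"
    and \<theta>: "1 < \<theta>" "\<theta> \<le> 3 / 2" and \<kappa>: "\<kappa> = (\<theta> - 1) / 2"
    and K: "\<theta> ^ 4 * L \<le> n * Kdiv s u v"
    and large: "32 * \<theta> ^ 3 * L * \<kappa> \<le> n" "sqrt (\<kappa> * L / (2 * n)) \<le> \<kappa> / 2"
  shows "2 * (\<theta> ^ 3 * L) * v / n \<le> (u - v)\<^sup>2 \<or>
     \<kappa> \<le> v \<and> sqrt (\<kappa> * L / (2 * n)) * v \<le> u - v \<or>
     2 * (\<theta> ^ 3 * L) * (1 - u) / n \<le> (u - v)\<^sup>2"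
proof (rule ccontr)
  define D where "D = u - v"
  assume neg: "\<not> ?thesis"
  then have n1: "D\<^sup>2 * n < 2 * (\<theta> ^ 3 * L) * v" and n3: "D\<^sup>2 * n < 2 * (\<theta> ^ 3 * L) * (1 - u)"
    and n2: "\<kappa> \<le> v \<Longrightarrow> D < sqrt (\<kappa> * L / (2 * n)) * v"
    using n by (auto simp: D_def not_le pos_less_divide_eq)
  have D: "0 < D" using v by (simp add: D_def)
  have k: "0 < \<kappa>" "\<kappa> \<le> 1 / 4" "1 + 2 * \<kappa> = \<theta>" using \<theta> by (auto simp: \<kappa> field_simps)
  have "n * Kdiv s u v \<le> n * (D\<^sup>2 / 2 * (1 / v + 1 / (1 - u)))"
    unfolding D_def using Kdiv_upper[OF v s] n by (intro mult_left_mono) auto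
  with K have K': "2 * \<theta> ^ 4 * L \<le> (D\<^sup>2 * n) * (1 / v + 1 / (1 - u))"
    by (simp add: algebra_simps)
  have t0: "0 < \<theta> ^ 3 * L" using \<theta> L by simp
  consider "v < \<kappa>" "u \<le> 1 / 2" | "v < \<kappa>" "1 / 2 < u" | "\<kappa> \<le> v" "v \<le> 1 - \<kappa>" | "1 - \<kappa> < v" by linarith
  then show False
  proof cases
    case 1
    have "1 / v + 1 / (1 - u) \<le> \<theta> / v"
    proof -
      have "1 / (1 - u) \<le> 2" using 1 v by (simp add: field_simps)
      also have "2 \<le> 2 * \<kappa> / v" using 1 v by (simp add: field_simps)
      finally have "1 / v + 1 / (1 - u) \<le> 1 / v + 2 * \<kappa> / v" by simp
      also have "\<dots> = \<theta> / v" using k by (simp add: add_divide_distrib[symmetric])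
      finally show ?thesis .
    qed
    then have "(D\<^sup>2 * n) * (1 / v + 1 / (1 - u)) \<le> (D\<^sup>2 * n) * (\<theta> / v)"
      using n by (intro mult_left_mono) auto
    also have "\<dots> < (2 * (\<theta> ^ 3 * L) * v) * (\<theta> / v)"
      using n1 \<theta> v by (intro mult_strict_right_mono) auto
    also have "\<dots> = 2 * \<theta> ^ 4 * L" using v by (simp add: power4_eq_xxxx power3_eq_cube)
    finally show False using K' by simp
  next
    case 2
    \<comment> \<open>A jump from below \<open>\<kappa>\<close> to above 1/2 has length at least
      1/4; for large \<open>n\<close> this is more than the failure of the first alternative
      allows.\<close>
    have "1 / 4 \<le> D" using 2 k by (simp add: D_def)
    then have "(1 / 4)\<^sup>2 \<le> D\<^sup>2" by (intro power_mono) auto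
    then have "n / 16 \<le> D\<^sup>2 * n" using n by (simp add: power2_eq_square)
    also have "\<dots> < 2 * (\<theta> ^ 3 * L) * v" by (rule n1)
    also have "\<dots> < 2 * (\<theta> ^ 3 * L) * \<kappa>" using 2 t0 by (intro mult_strict_left_mono) auto
    finally show False using large by simp
  next
    case 3
    \<comment> \<open>The deviation is at most \<open>\<kappa> / 2\<close>, so \<open>u\<close>
      stays away from 1 and the reciprocals add up to at most \<open>3 / \<kappa>\<close>; the
      product with \<open>\<kappa> * L / 2\<close> is then below \<open>2 * L\<close>.\<close>
    have Dy: "D < sqrt (\<kappa> * L / (2 * n))"
    proof -
      have "sqrt (\<kappa> * L / (2 * n)) * v \<le> sqrt (\<kappa> * L / (2 * n)) * 1"
        using v k L n by (intro mult_left_mono) auto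
      then show ?thesis using n2 3 by simp
    qed
    then have "D\<^sup>2 < (sqrt (\<kappa> * L / (2 * n)))\<^sup>2" using D by (intro power_strict_mono) auto
    then have D2: "D\<^sup>2 * n < \<kappa> * L / 2" using k L n by (simp add: field_simps)
    have "\<kappa> / 2 \<le> 1 - u" using Dy large 3 by (simp add: D_def)
    then have "1 / v + 1 / (1 - u) \<le> 1 / \<kappa> + 1 / (\<kappa> / 2)"
      using 3 k v by (intro add_mono divide_left_mono) auto
    then have "(D\<^sup>2 * n) * (1 / v + 1 / (1 - u)) \<le> (D\<^sup>2 * n) * (3 / \<kappa>)"
      using n k by (intro mult_left_mono) (auto simp: field_simps)
    also have "\<dots> \<le> (\<kappa> * L / 2) * (3 / \<kappa>)" using D2 k by (intro mult_right_mono) auto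
    also have "\<dots> = 3 / 2 * L" using k by simp
    also have "\<dots> < 2 * 1 * L" using L by simp
    also have "\<dots> \<le> 2 * \<theta> ^ 4 * L" using L \<theta> by (intro mult_right_mono mult_left_mono one_le_power) auto
    finally show False using K' by simp
  next
    case 4
    have "1 / v + 1 / (1 - u) \<le> \<theta> / (1 - u)"
    proof -
      have "1 / v \<le> 2" using 4 v k by (simp add: field_simps)
      also have "2 \<le> 2 * \<kappa> / (1 - u)" using 4 v by (simp add: field_simps)
      finally have "1 / v + 1 / (1 - u) \<le> 2 * \<kappa> / (1 - u) + 1 / (1 - u)" by simp
      also have "\<dots> = \<theta> / (1 - u)" using k by (simp add: add_divide_distrib[symmetric] add.commute)
      finally show ?thesis .
    qed
    then have "(D\<^sup>2 * n) * (1 / v + 1 / (1 - u)) \<le> (D\<^sup>2 * n) * (\<theta> / (1 - u))"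
      using n by (intro mult_left_mono) auto
    also have "\<dots> < (2 * (\<theta> ^ 3 * L) * (1 - u)) * (\<theta> / (1 - u))"
      using n3 \<theta> v by (intro mult_strict_right_mono) auto
    also have "\<dots> = 2 * \<theta> ^ 4 * L" using v by (simp add: power4_eq_xxxx power3_eq_cube)
    finally show False using K' by simp
  qed
qed

section \<open>Type I error\<close>

text \<open>Here \<open>L\<close> stands for log log n. Between the levels
  \<open>1 / (n * ln L)\<close> and \<open>L ^ 3 / n\<close> the number of blocks grows like
  \<open>ln L\<close>. The exponent at the lower level is only of order
  \<open>sqrt (L / ln L)\<close>, which still exceeds \<open>L powr (1/3)\<close>.\<close>

lemma small_blocks_tendsto: "c > 0 \<Longrightarrow> ((\<lambda>L::real. (ln (L ^ 3 * ln L) / c + 1) * exp (- (L powr (1/3)))) \<longlongrightarrow> 0) at_top"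
  by real_asymp

lemma small_block_exponent_upper: "\<forall>\<^sub>F L::real in at_top. L powr (1/3) \<le> L / (1 + sqrt (5 * L * ln L) / 2)"
  by real_asymp

text \<open>About \<open>exp L = ln n\<close> blocks remain, which is why the exponent must exceed
  \<open>L\<close> by a factor \<open>\<theta> > 1\<close>.\<close>

lemma large_blocks_tendsto: assumes "1 < \<theta>" "0 < c" shows "((\<lambda>L::real. ((exp L + ln (ln L)) / c + 1) * exp (- (\<theta> * L))) \<longlongrightarrow> 0) at_top"
  using assms by real_asymp

lemma small_block_exponent_lower: "\<forall>\<^sub>F L::real in at_top. L powr (1/3) \<le> L / (1 + sqrt (sqrt (7 * L)))^2"
  by real_asymp

lemma filterlim_ln_ln: "filterlim (\<lambda>n::nat. ln (ln (real n))) at_top at_top"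
  by real_asymp

lemma peel_bound_mono:
  fixes \<theta> L K K' A A' e1 e2 :: real
  assumes "1 < \<theta>" "K \<le> K'" "A \<le> A'" "0 \<le> K'" "0 \<le> A'" "L powr (1/3) \<le> e1" "\<theta> * L \<le> e2"
  shows "(K / ln \<theta> + 1) * exp (- e1) + (A / ln \<theta> + 1) * exp (- e2)
     \<le> (K' / ln \<theta> + 1) * exp (- (L powr (1/3))) + (A' / ln \<theta> + 1) * exp (- (\<theta> * L))"
proof -
  have l: "0 < ln \<theta>" using assms by simp
  have "(K / ln \<theta> + 1) * exp (- e1) \<le> (K' / ln \<theta> + 1) * exp (- e1)"
    using assms l by (intro mult_right_mono add_right_mono divide_right_mono) auto
  also have "\<dots> \<le> (K' / ln \<theta> + 1) * exp (- (L powr (1/3)))"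
    using assms l by (intro mult_left_mono) auto
  finally have 1: "(K / ln \<theta> + 1) * exp (- e1) \<le> (K' / ln \<theta> + 1) * exp (- (L powr (1/3)))" .
  have "(A / ln \<theta> + 1) * exp (- e2) \<le> (A' / ln \<theta> + 1) * exp (- e2)"
    using assms l by (intro mult_right_mono add_right_mono divide_right_mono) auto
  also have "\<dots> \<le> (A' / ln \<theta> + 1) * exp (- (\<theta> * L))"
    using assms l by (intro mult_left_mono) auto
  finally show ?thesis using 1 by linarith
qed

lemma unif_sample_uniform:
  assumes "\<tau> = (\<lambda>y. y) \<or> \<tau> = (\<lambda>y::real. 1 - y)"
  shows "unif_sample (uniform_measure lborel {0..1::real}) \<tau> {1..n}"
proof -
  interpret prob_space "uniform_measure lborel {0..1::real}"
    by (rule prob_space_uniform_measure) auto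
  show ?thesis
  proof unfold_locales
    fix b :: real assume b: "0 \<le> b" "b \<le> 1"
    then have "{0..1} \<inter> {y. y \<le> b} = {0..b}" "{0..1} \<inter> {y. 1 - y \<le> b} = {1 - b..1}" by auto
    moreover have "ennreal b / 1 = ennreal b" using divide_ennreal[of b 1] b by simp
    ultimately show "emeasure (uniform_measure lborel {0..1}) {y. \<tau> y \<le> b} = ennreal b" using b assms
      by (auto simp: emeasure_uniform_measure)
  qed (use assms in auto)
qed

lemma measure_le_4:
  assumes "prob_space M" "A \<subseteq> S1 \<union> S2 \<union> S3 \<union> S4" "S1 \<in> sets M" "S2 \<in> sets M" "S3 \<in> sets M" "S4 \<in> sets M"
  shows "measure M A \<le> measure M S1 + measure M S2 + measure M S3 + measure M S4"
proof -
  interpret prob_space M by fact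
  have "measure M A \<le> measure M (S1 \<union> S2 \<union> S3 \<union> S4)"
    using assms by (intro finite_measure_mono) auto
  also have "\<dots> \<le> measure M S1 + measure M S2 + measure M S3 + measure M S4"
    using assms measure_Un_le[of "S1 \<union> S2 \<union> S3" M S4] measure_Un_le[of "S1 \<union> S2" M S3] measure_Un_le[of S1 M S2]
    by (simp add: sets.Un)
  finally show ?thesis .
qed

text \<open>A bound at one \<open>n\<close>, with all asymptotic requirements as hypotheses. The
  four covering events are: a p-value too close to 0, an excess over small or moderate levels, an
  excess over levels at least \<open>\<kappa>\<close>, and a deviation seen from the right
  end.\<close>

lemma type_I_bound:
  fixes n :: nat and L \<theta> \<kappa> \<delta> s c :: real
  assumes n: "0 < n" and L: "L = ln (ln (real n))" and n': "real n = exp (exp L)" and L3: "3 \<le> L"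
    and \<theta>: "1 < \<theta>" "\<theta> \<le> 3 / 2" and \<kappa>: "\<kappa> = (\<theta> - 1) / 2"
    and \<theta>\<delta>: "\<theta> ^ 4 \<le> 1 + \<delta>" and s: "- 1 \<le> s" "s \<le> 2" and c: "c \<le> 1"
    and E1: "L powr (1/3) \<le> L / (1 + sqrt (5 * L * ln L) / 2)"
    and E2: "L powr (1/3) \<le> L / (1 + sqrt (sqrt (7 * L)))\<^sup>2"
    and L\<theta>: "1 + 2 * \<theta> / L \<le> sqrt \<theta>"
    and n1: "108 * L * \<kappa> \<le> n" and n2: "sqrt (\<kappa> * L / (2 * real n)) \<le> \<kappa> / 2" and n3: "sqrt (7 * L) \<le> n"
  shows "measure (H0_law n) {y \<in> space (H0_law n). trgof_reject s c \<delta> n y}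
    \<le> exp 1 / ln L + 4 * ((ln (L ^ 3 * ln L) / ln \<theta> + 1) * exp (- (L powr (1/3)))
       + ((exp L + ln (ln L)) / ln \<theta> + 1) * exp (- (\<theta> * L))) + 2 * exp (- (\<kappa>\<^sup>2 * L / 6))"
proof -
  let ?\<mu> = "uniform_measure lborel {0..1::real}"
  interpret A: unif_sample ?\<mu> "\<lambda>y. 1 - y" "{1..n}" by (rule unif_sample_uniform) simp
  interpret B: unif_sample ?\<mu> "\<lambda>y. y" "{1..n}" by (rule unif_sample_uniform) simp
  have L0: "0 < L" and lnL: "1 \<le> ln L"
  proof -
    show "0 < L" using L3 by simp
    have "exp 1 \<le> (3::real)" using exp_le by simp
    then have "exp 1 \<le> L" using L3 by linarith
    then show "1 \<le> ln L" using \<open>0 < L\<close> by (simp add: ln_ge_iff)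
  qed
  have N: "0 < real n" using n by simp
  have lnn: "ln (real n) = exp L" unfolding n' by simp
  have k: "0 < \<kappa>" "\<kappa> \<le> 1 / 4" using \<theta> by (auto simp: \<kappa>)
  define \<Lambda> where "\<Lambda> = \<theta> ^ 3 * L"
  have t2: "\<theta>\<^sup>2 \<le> 9 / 4" using power_mono[OF \<theta>(2), of 2] \<theta> by (simp add: power2_eq_square)
  have t3: "\<theta> ^ 3 \<le> 27 / 8" using power_mono[OF \<theta>(2), of 3] \<theta> by (simp add: power3_eq_cube)
  have t1: "1 \<le> \<theta>\<^sup>2" "1 \<le> \<theta> ^ 3" using \<theta> by auto
  have \<Lambda>: "0 < \<Lambda>" "L \<le> \<Lambda>" "2 * \<Lambda> \<le> 7 * L" "\<Lambda> / \<theta> = \<theta>\<^sup>2 * L"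
    using L0 \<theta> t3 t1 mult_right_mono[OF t3, of L] mult_right_mono[OF t1(2), of L]
    by (auto simp: \<Lambda>_def power3_eq_cube power2_eq_square)
  define tL where "tL = (ln (L ^ 3 * ln L) / ln \<theta> + 1) * exp (- (L powr (1/3)))
       + ((exp L + ln (ln L)) / ln \<theta> + 1) * exp (- (\<theta> * L))"
  \<comment> \<open>About \<open>L ^ 3\<close> points are expected below \<open>b\<close>, so from
    here on the relative deviation is of order \<open>1 / L\<close> and Bennett's exponent is
    Gaussian up to a factor \<open>\<theta>\<close>.\<close>
  define b where "b = L ^ 3 / n"
  have b1: "1 \<le> L ^ 3" using L3 by (intro one_le_power) auto
  have lb: "0 \<le> ln (L ^ 3 * ln L)" using mult_mono[OF b1 lnL] b1 L0 by (intro ln_ge_zero) simp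
  have b2: "\<theta> * L \<le> (\<Lambda> / \<theta>) / (1 + sqrt (2 * \<Lambda> / (n * \<theta> * b)))\<^sup>2"
       "\<theta> * L \<le> (\<Lambda> / \<theta>) / (1 + sqrt (2 * \<Lambda> / (n * \<theta> * b)) / 2)"
  proof -
    have "2 * \<Lambda> / (n * \<theta> * b) = 2 * (\<theta> / L)\<^sup>2"
      using n \<theta> L0 by (simp add: b_def \<Lambda>_def power2_eq_square power3_eq_cube)
    also have "\<dots> \<le> 4 * (\<theta> / L)\<^sup>2" by simp
    also have "\<dots> = (2 * \<theta> / L)\<^sup>2" by (simp add: power2_eq_square)
    finally have "sqrt (2 * \<Lambda> / (n * \<theta> * b)) \<le> 2 * \<theta> / L"
      using \<theta> L0 by (intro real_le_lsqrt) auto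
    then have y: "1 + sqrt (2 * \<Lambda> / (n * \<theta> * b)) \<le> sqrt \<theta>" "0 \<le> sqrt (2 * \<Lambda> / (n * \<theta> * b))"
      using L\<theta> \<theta> \<Lambda> n L0 by (auto simp: b_def)
    then have "(1 + sqrt (2 * \<Lambda> / (n * \<theta> * b)))\<^sup>2 \<le> (sqrt \<theta>)\<^sup>2" by (intro power_mono) auto
    then have y2: "(1 + sqrt (2 * \<Lambda> / (n * \<theta> * b)))\<^sup>2 \<le> \<theta>" using \<theta> by simp
    have key: "\<theta> * L \<le> (\<Lambda> / \<theta>) / d" if "0 < d" "d \<le> \<theta>" for d
      using that \<theta> L0 unfolding \<Lambda>(4) by (simp add: pos_le_divide_eq power2_eq_square mult_left_mono)
    show "\<theta> * L \<le> (\<Lambda> / \<theta>) / (1 + sqrt (2 * \<Lambda> / (n * \<theta> * b)))\<^sup>2"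
      using y y2 by (intro key zero_less_power) linarith+
    have "sqrt \<theta> \<le> \<theta>" using \<theta> by (simp add: real_le_lsqrt power2_eq_square)
    then show "\<theta> * L \<le> (\<Lambda> / \<theta>) / (1 + sqrt (2 * \<Lambda> / (n * \<theta> * b)) / 2)"
      using y by (intro key) linarith+
  qed

  \<comment> \<open>On average \<open>1 / ln L\<close> p-values lie below \<open>a1\<close>, so with
    high probability there is none, and the peeling can start here.\<close>
  define a1 where "a1 = 1 / (n * ln L)"
  have na1: "n * a1 = 1 / ln L" using n by (simp add: a1_def)
  have a1: "0 < a1" "a1 \<le> 1" "a1 \<le> b"
  proof -
    show "0 < a1" using n lnL by (simp add: a1_def)
    have "a1 \<le> 1 / n" using n lnL by (simp add: a1_def field_simps)
    moreover have "1 / n \<le> b" using n b1 by (simp add: b_def divide_right_mono)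
    moreover have "1 / real n \<le> 1" using n by simp
    ultimately show "a1 \<le> 1" "a1 \<le> b" by linarith+
  qed

  obtain S1 where S1: "S1 \<in> sets A.Q" "{x \<in> space A.Q. 1 \<le> real (A.N a1 x)} \<subseteq> S1" "measure A.Q S1 \<le> exp 1 / ln L"
  proof -
    \<comment> \<open>A Chernoff bound at the single level \<open>a1\<close>; the factor
      \<open>exp \<rho> = ln L\<close> cancels the mean \<open>1 / ln L\<close>.\<close>
    define \<rho> where "\<rho> = ln (ln L)"
    have \<rho>: "0 \<le> \<rho>" "exp \<rho> = ln L" using lnL by (auto simp: \<rho>_def)
    let ?S = "{x \<in> space A.Q. \<exists>g\<in>{a1}. \<rho> \<le> (\<rho> * a1) * real (A.N g x) / g}"
    have "measure A.Q ?S \<le> exp (real (card {1..n}) * a1 * (exp (\<rho> * a1 / a1) - 1) - \<rho>)"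
      by (rule A.maximal_grid) (use a1 in auto)
    also have "real (card {1..n}) * a1 * (exp (\<rho> * a1 / a1) - 1) - \<rho> \<le> 1 - \<rho>"
      using a1 na1 \<rho> lnL by (simp add: field_simps)
    also have "exp (1 - \<rho>) = exp 1 / ln L" using \<rho> by (simp add: exp_diff)
    finally have m: "measure A.Q ?S \<le> exp 1 / ln L" by simp
    have "{x \<in> space A.Q. 1 \<le> real (A.N a1 x)} \<subseteq> ?S"
      using a1 \<rho> by (auto simp: mult_le_cancel_left1)
    moreover have "?S \<in> sets A.Q" by measurable
    ultimately show thesis using that m by blast
  qed

  obtain S2 where S2: "S2 \<in> sets A.Q"
    "{x \<in> space A.Q. \<exists>v::real. a1 < v \<and> v \<le> 1 \<and> (\<exists>D\<ge>0::real. 2 * \<Lambda> * v / real n \<le> D\<^sup>2 \<and> real n * (v + D) \<le> real (A.N v x))} \<subseteq> S2"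
    "measure A.Q S2 \<le> 2 * tL"
  proof -
    let ?e = "\<lambda>a. (\<Lambda> / \<theta>) / (1 + sqrt (2 * \<Lambda> / (n * \<theta> * a)) / 2)"
    have ba: "b / a1 = L ^ 3 * ln L" using n by (simp add: b_def a1_def)
    have ia: "ln (1 / a1) = exp L + ln (ln L)" using n lnL lnn by (simp add: a1_def ln_mult)
    have "L powr (1/3) \<le> ?e a1"
    proof -
      have "2 * \<Lambda> / (n * \<theta> * a1) = 2 * \<theta>\<^sup>2 * L * ln L"
        using n \<theta> lnL by (simp add: a1_def \<Lambda>_def power2_eq_square power3_eq_cube)
      also have "\<dots> = (2 * \<theta>\<^sup>2) * (L * ln L)" by simp
      also have "\<dots> \<le> 5 * (L * ln L)" using t2 L0 lnL L3 by (intro mult_right_mono mult_nonneg_nonneg) auto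
      finally have "sqrt (2 * \<Lambda> / (n * \<theta> * a1)) \<le> sqrt (5 * L * ln L)" by (simp add: mult.assoc)
      moreover have "0 \<le> 2 * \<Lambda> / (n * \<theta> * a1)" using \<Lambda> n \<theta> a1 by simp
      ultimately have "L / (1 + sqrt (5 * L * ln L) / 2) \<le> (1 * L) / (1 + sqrt (2 * \<Lambda> / (n * \<theta> * a1)) / 2)"
        using L0 by (simp only: mult_1, intro divide_left_mono add_left_mono mult_pos_pos add_pos_nonneg) auto
      also have "\<dots> \<le> ?e a1"
        unfolding \<Lambda>(4) using t1 L0 \<open>0 \<le> 2 * \<Lambda> / (n * \<theta> * a1)\<close>
        by (intro divide_right_mono mult_right_mono add_nonneg_nonneg) auto
      finally show ?thesis using E1 by linarith
    qed
    then have "2 * ((ln (b / a1) / ln \<theta> + 1) * exp (- ?e a1) + (ln (1 / a1) / ln \<theta> + 1) * exp (- ?e b)) \<le> 2 * tL"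
      unfolding tL_def ba ia using b2 \<theta> lnL lb
      by (intro mult_left_mono peel_bound_mono) auto
    moreover have "\<exists>S\<in>sets A.Q. {x \<in> space A.Q. \<exists>v::real. a1 < v \<and> v \<le> 1 \<and>
        (\<exists>D\<ge>0::real. 2 * \<Lambda> * v / real n \<le> D\<^sup>2 \<and> real n * (v + D) \<le> real (A.N v x))} \<subseteq> S \<and>
       measure A.Q S \<le> 2 * ((ln (b / a1) / ln \<theta> + 1) * exp (- ?e a1) + (ln (1 / a1) / ln \<theta> + 1) * exp (- ?e b))"
      using A.peel_upper[OF a1(1,2) \<theta>(1) a1(3) _ N, of \<Lambda>] \<Lambda> by simp
    ultimately show thesis using that by (meson order_trans)
  qed

  \<comment> \<open>Levels above the fixed \<open>\<kappa>\<close> need no peeling. Since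
    \<open>y \<le> 1\<close>, the denominator \<open>2 + y\<close> is at most 3, whence the
    6.\<close>
  obtain S3 where S3: "S3 \<in> sets A.Q"
    "{x \<in> space A.Q. \<exists>v\<in>{\<kappa>..1::real}. (1 + sqrt (\<kappa> * L / (2 * real n))) * real n * v \<le> real (A.N v x)} \<subseteq> S3"
    "measure A.Q S3 \<le> 2 * exp (- (\<kappa>\<^sup>2 * L / 6))"
  proof -
    define y where "y = sqrt (\<kappa> * L / (2 * real n))"
    have "y \<le> 1" using n2 k unfolding y_def by linarith
    moreover have "n * y\<^sup>2 = \<kappa> * L / 2" "0 \<le> y" using k L0 n by (auto simp: y_def)
    ultimately have y: "0 \<le> y" "y \<le> 1" "n * y\<^sup>2 = \<kappa> * L / 2" by blast+
    have "\<kappa>\<^sup>2 * L / 6 = n * \<kappa> * y\<^sup>2 / 3"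
    proof -
      have "n * \<kappa> * y\<^sup>2 = \<kappa> * (n * y\<^sup>2)" by simp
      then show ?thesis unfolding y(3) by (simp only: power2_eq_square)
    qed
    also have "\<dots> \<le> n * \<kappa> * y\<^sup>2 / (2 + y)" using y k n by (intro divide_left_mono) auto
    finally have le: "2 * exp (- (n * \<kappa> * y\<^sup>2 / (2 + y))) \<le> 2 * exp (- (\<kappa>\<^sup>2 * L / 6))" by simp
    have "\<exists>S\<in>sets A.Q. {x \<in> space A.Q. \<exists>v\<in>{\<kappa>..1::real}. (1 + y) * real n * v \<le> real (A.N v x)} \<subseteq> S
        \<and> measure A.Q S \<le> 2 * exp (- (n * \<kappa> * y\<^sup>2 / (2 + y)))"
      using A.maximal_upper[of \<kappa> y] k y by simp
    then show thesis using that le unfolding y_def by (meson order_trans)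
  qed

  \<comment> \<open>In the third alternative \<open>t < n\<close> gives
    \<open>1 - u \<ge> 1 / n\<close>, hence \<open>u - v \<ge> a2\<close>. So \<open>1 - v\<close>
    exceeds \<open>a2\<close> by itself, and no analogue of \<open>S1\<close> is needed.\<close>
  define a2 where "a2 = sqrt (2 * \<Lambda>) / n"
  have s2: "1 \<le> sqrt (2 * \<Lambda>)" "sqrt (2 * \<Lambda>) \<le> sqrt (7 * L)" using \<Lambda> L3 by auto
  have s7: "sqrt (7 * L) \<le> L ^ 3"
  proof (rule real_le_lsqrt)
    have "7 * L \<le> L ^ 3"
    proof -
      have "7 \<le> L * L" using mult_mono[OF L3 L3] L3 by simp
      from mult_right_mono[OF this, of L] L0 show ?thesis by (simp add: power3_eq_cube)
    qed
    also have "L ^ 3 * 1 \<le> L ^ 3 * L ^ 3" using b1 L0 by (intro mult_left_mono) auto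
    then have "L ^ 3 \<le> (L ^ 3)\<^sup>2" by (simp add: power2_eq_square)
    finally show "7 * L \<le> (L ^ 3)\<^sup>2" .
  qed (use L0 in auto)
  have a2: "0 < a2" "a2 \<le> 1" "a2 \<le> b"
  proof -
    have "sqrt (2 * \<Lambda>) \<le> n" "sqrt (2 * \<Lambda>) \<le> L ^ 3" using s2(2) n3 s7 by linarith+
    then show "0 < a2" "a2 \<le> 1" "a2 \<le> b"
      using n \<Lambda>(1) by (auto simp: a2_def b_def intro!: divide_right_mono)
  qed
  \<comment> \<open>Both interpretations have the same product measure. \<open>B\<close> reads the
    sample as \<open>y\<close>, so p-values above \<open>v\<close> become points below
    \<open>1 - v\<close>.\<close>
  obtain S4 where S4: "S4 \<in> sets A.Q"
    "{x \<in> space A.Q. \<exists>v::real. a2 < v \<and> v \<le> 1 \<and> (\<exists>u\<ge>0::real. u \<le> v \<and> 2 * \<Lambda> * u / real n \<le> (v - u)\<^sup>2 \<and>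
       real (card {i \<in> {1..n}. x i < v}) \<le> real n * u)} \<subseteq> S4"
    "measure A.Q S4 \<le> 2 * tL"
  proof -
    let ?e = "\<lambda>a. (\<Lambda> / \<theta>) / (1 + sqrt (2 * \<Lambda> / (n * \<theta> * a)))\<^sup>2"
    have ba: "ln (b / a2) \<le> ln (L ^ 3 * ln L)"
    proof -
      have "b / a2 = L ^ 3 / sqrt (2 * \<Lambda>)" using n by (simp add: b_def a2_def)
      also have "\<dots> \<le> L ^ 3 / 1" using s2 L0 by (intro divide_left_mono) auto
      also have "\<dots> \<le> L ^ 3 * ln L" using lnL L0 by simp
      finally show ?thesis using a2 L0 b1 by (subst ln_le_cancel_iff) (auto simp: b_def n intro: mult_pos_pos[of "L ^ 3"] less_le_trans[OF zero_less_one lnL])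
    qed
    have ia: "ln (1 / a2) \<le> exp L + ln (ln L)"
    proof -
      have "1 / a2 = n / sqrt (2 * \<Lambda>)" by (simp add: a2_def)
      also have "\<dots> \<le> n / 1" using s2 n by (intro divide_left_mono) auto
      finally have "1 / a2 \<le> n" by simp
      then have "ln (1 / a2) \<le> ln n" using a2 n by (subst ln_le_cancel_iff) auto
      then show ?thesis using lnn lnL by (smt (verit) ln_ge_zero)
    qed
    have "L powr (1/3) \<le> ?e a2"
    proof -
      have "sqrt (2 * \<Lambda>) * sqrt (2 * \<Lambda>) = 2 * \<Lambda>" using \<Lambda> by simp
      then have "2 * \<Lambda> / (n * \<theta> * a2) = sqrt (2 * \<Lambda>) / \<theta>"
        using n s2 \<theta> by (simp add: a2_def) (simp add: field_simps)
      also have "\<dots> \<le> sqrt (2 * \<Lambda>) / 1" using \<theta> \<Lambda> by (intro divide_left_mono) auto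
      also have "\<dots> \<le> sqrt (7 * L)" using s2 by simp
      finally have "sqrt (2 * \<Lambda> / (n * \<theta> * a2)) \<le> sqrt (sqrt (7 * L))" by simp
      moreover have g0: "0 \<le> 2 * \<Lambda> / (n * \<theta> * a2)" using \<Lambda> n \<theta> a2 by simp
      ultimately have "L / (1 + sqrt (sqrt (7 * L)))\<^sup>2 \<le> (1 * L) / (1 + sqrt (2 * \<Lambda> / (n * \<theta> * a2)))\<^sup>2"
        using L0 by (simp only: mult_1, intro divide_left_mono power_mono add_left_mono mult_pos_pos zero_less_power add_pos_nonneg) auto
      also have "\<dots> \<le> ?e a2"
        unfolding \<Lambda>(4) using t1 L0 by (intro divide_right_mono mult_right_mono) auto
      finally show ?thesis using E2 by linarith
    qed
    then have "2 * ((ln (b / a2) / ln \<theta> + 1) * exp (- ?e a2) + (ln (1 / a2) / ln \<theta> + 1) * exp (- ?e b)) \<le> 2 * tL"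
      unfolding tL_def using b2 \<theta> lnL ba ia lb
      by (intro mult_left_mono peel_bound_mono) auto
    moreover have "\<exists>S\<in>sets A.Q. {x \<in> space A.Q. \<exists>v::real. a2 < v \<and> v \<le> 1 \<and> (\<exists>u\<ge>0::real. u \<le> v \<and> 2 * \<Lambda> * u / real n \<le> (v - u)\<^sup>2 \<and>
       real (card {i \<in> {1..n}. x i < v}) \<le> real n * u)} \<subseteq> S \<and>
       measure A.Q S \<le> 2 * ((ln (b / a2) / ln \<theta> + 1) * exp (- ?e a2) + (ln (1 / a2) / ln \<theta> + 1) * exp (- ?e b))"
      using B.peel_lower[OF a2(1,2) \<theta>(1) a2(3) _ N, of \<Lambda>] \<Lambda> by simp
    ultimately show thesis using that by (meson order_trans)
  qed

  have "{y \<in> space (H0_law n). trgof_reject s c \<delta> n y} \<subseteq> S1 \<union> S2 \<union> S3 \<union> S4"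
  proof (rule subsetI, rule ccontr)
    fix y assume "y \<in> {y \<in> space (H0_law n). trgof_reject s c \<delta> n y}" "y \<notin> S1 \<union> S2 \<union> S3 \<union> S4"
    then have y: "y \<in> space (H0_law n)" and rej: "trgof_reject s c \<delta> n y"
      and nS: "y \<notin> S1" "y \<notin> S2" "y \<notin> S3" "y \<notin> S4" by auto
    have ys: "y \<in> space A.Q" using y by (simp add: H0_law_def)
    obtain t where t: "t \<in> {1..n}" "(1 + \<delta>) * L \<le> real n * Kplus s (real t / real n) (pord n y t)"
      using rej trgof_reject_iff[OF n c] unfolding L by blast
    define u v where "u = real t / real n" and "v = pord n y t"
    have tu: "real t = n * u" using n by (simp add: u_def)
    have KL: "\<theta> ^ 4 * L \<le> real n * Kplus s u v"
      using t(2) mult_right_mono[OF \<theta>\<delta>, of L] L0 unfolding u_def v_def by linarith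
    moreover have "0 < \<theta> ^ 4 * L" using \<theta> L0 by simp
    ultimately have "Kplus s u v \<noteq> 0" by auto
    then have uv: "0 < v" "v < u" "u < 1" and "Kplus s u v = Kdiv s u v"
      by (auto simp: Kplus_def split: if_splits)
    then have KL: "\<theta> ^ 4 * L \<le> real n * Kdiv s u v" using KL by simp
    have large: "32 * \<theta> ^ 3 * L * \<kappa> \<le> n"
    proof -
      have "32 * \<theta> ^ 3 * (L * \<kappa>) \<le> 108 * (L * \<kappa>)" using t3 L0 k by (intro mult_right_mono) auto
      then show ?thesis using n1 by (simp add: mult_ac)
    qed
    have cnt1: "t \<le> A.N v y" unfolding A.N_def v_def by (rule card_le_pord[OF t(1)])
    have cnt2: "real (card {i \<in> {1..n}. y i < 1 - v}) \<le> n * (1 - u)"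
    proof -
      have "{i \<in> {1..n}. y i < 1 - v} = {i \<in> {1..n}. v < 1 - y i}" by auto
      then have "card {i \<in> {1..n}. y i < 1 - v} \<le> n - t" using card_gt_pord[OF t(1), of y] by (simp add: v_def)
      then have "real (card {i \<in> {1..n}. y i < 1 - v}) \<le> real (n - t)" by (simp only: of_nat_le_iff)
      also have "\<dots> = n * (1 - u)" using t(1) tu by (simp add: of_nat_diff algebra_simps)
      finally show ?thesis .
    qed
    have va: "a1 < v"
    proof (rule ccontr)
      assume "\<not> a1 < v"
      then have "A.N v y \<le> A.N a1 y" by (intro A.N_mono) simp
      then have "1 \<le> real (A.N a1 y)" using cnt1 t(1) by simp
      then show False using S1(2) ys nS by blast
    qed
    from Kdiv_large_cases[OF uv s N L0 \<theta> \<kappa> KL large n2]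
    consider "2 * \<Lambda> * v / n \<le> (u - v)\<^sup>2" | "\<kappa> \<le> v" "sqrt (\<kappa> * L / (2 * real n)) * v \<le> u - v"
      | "2 * \<Lambda> * (1 - u) / n \<le> (u - v)\<^sup>2" unfolding \<Lambda>_def by blast
    then show False
    proof cases
      case 1
      have "real n * (v + (u - v)) \<le> real (A.N v y)" using cnt1 tu by simp
      then have "\<exists>D\<ge>0::real. 2 * \<Lambda> * v / real n \<le> D\<^sup>2 \<and> real n * (v + D) \<le> real (A.N v y)"
        using uv 1 by (intro exI[of _ "u - v"]) auto
      then have "a1 < v \<and> v \<le> 1 \<and> (\<exists>D\<ge>0::real. 2 * \<Lambda> * v / real n \<le> D\<^sup>2 \<and> real n * (v + D) \<le> real (A.N v y))"
        using va uv by simp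
      then have "y \<in> {x \<in> space A.Q. \<exists>v::real. a1 < v \<and> v \<le> 1 \<and>
          (\<exists>D\<ge>0::real. 2 * \<Lambda> * v / real n \<le> D\<^sup>2 \<and> real n * (v + D) \<le> real (A.N v x))}"
        using ys by blast
      then show False using S2(2) nS by blast
    next
      case 2
      have "(1 + sqrt (\<kappa> * L / (2 * real n))) * real n * v = n * (v + sqrt (\<kappa> * L / (2 * real n)) * v)"
        by (simp add: algebra_simps)
      also have "\<dots> \<le> n * u" using 2 N by (intro mult_left_mono) auto
      also have "\<dots> \<le> real (A.N v y)" using cnt1 tu by simp
      finally have "\<exists>v\<in>{\<kappa>..1::real}. (1 + sqrt (\<kappa> * L / (2 * real n))) * real n * v \<le> real (A.N v y)"
        using 2 uv by (intro bexI[of _ v]) auto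
      then show False using S3(2) nS ys by blast
    next
      case 3
      have "t < n" using uv n by (simp add: u_def)
      then have "1 \<le> n * (1 - u)" using tu by (simp add: right_diff_distrib)
      then have u1: "1 / n \<le> 1 - u" using n by (simp add: field_simps)
      have "a2\<^sup>2 = 2 * \<Lambda> * (1 / n) / n" using \<Lambda> by (simp add: a2_def power_divide power2_eq_square)
      also have "\<dots> \<le> 2 * \<Lambda> * (1 - u) / n" using u1 \<Lambda> n by (intro divide_right_mono mult_left_mono) auto
      also have "\<dots> \<le> (u - v)\<^sup>2" by (rule 3)
      finally have "a2 \<le> u - v" using uv by (intro power2_le_imp_le[of a2 "u - v"]) auto
      then have "a2 < 1 - v" using uv by linarith
      moreover have "(u - v)\<^sup>2 = ((1 - v) - (1 - u))\<^sup>2" by (simp add: power2_commute)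
      ultimately have "a2 < 1 - v \<and> 1 - v \<le> 1 \<and> (0 \<le> 1 - u \<and> 1 - u \<le> 1 - v \<and>
         2 * \<Lambda> * (1 - u) / real n \<le> ((1 - v) - (1 - u))\<^sup>2 \<and> real (card {i \<in> {1..n}. y i < 1 - v}) \<le> real n * (1 - u))"
        using 3 cnt2 uv by simp
      then show False using S4(2) nS ys by blast
    qed
  qed
  then have "measure (H0_law n) {y \<in> space (H0_law n). trgof_reject s c \<delta> n y}
    \<le> measure A.Q S1 + measure A.Q S2 + measure A.Q S3 + measure A.Q S4"
    unfolding H0_law_def using S1 S2 S3 S4 by (intro measure_le_4 A.Q.prob_space_axioms) auto
  also have "\<dots> \<le> exp 1 / ln L + 2 * tL + 2 * exp (- (\<kappa>\<^sup>2 * L / 6)) + 2 * tL"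
    using S1 S2 S3 S4 by (intro add_mono) auto
  finally show ?thesis unfolding tL_def[symmetric] by linarith
qed

lemma type_I_tendsto:
  fixes \<delta> s :: real and c :: "nat \<Rightarrow> real"
  assumes "0 < \<delta>" and s: "- 1 \<le> s" "s \<le> 2" and c: "\<And>n. c n \<le> 1 / real n"
  shows "(\<lambda>n. measure (H0_law n) {y \<in> space (H0_law n). trgof_reject s (c n) \<delta> n y}) \<longlonglongrightarrow> 0"
proof -
  \<comment> \<open>The cap 3/2 gives \<open>\<kappa> \<le> 1 / 4\<close> and the numerical bounds
    on powers of \<open>\<theta>\<close> when \<open>\<delta>\<close> is large.\<close>
  define \<theta> where "\<theta> = min (3 / 2) (root 4 (1 + \<delta>))"
  define \<kappa> where "\<kappa> = (\<theta> - 1) / 2"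
  have "1 < root 4 (1 + \<delta>)" using assms(1) by (subst real_root_gt_1_iff) auto
  then have \<theta>: "1 < \<theta>" "\<theta> \<le> 3 / 2" by (auto simp: \<theta>_def)
  have "\<theta> ^ 4 \<le> root 4 (1 + \<delta>) ^ 4" using \<theta> by (intro power_mono) (auto simp: \<theta>_def)
  then have \<theta>\<delta>: "\<theta> ^ 4 \<le> 1 + \<delta>" using assms(1) by simp
  have k: "0 < \<kappa>" using \<theta> by (simp add: \<kappa>_def)
  define g where "g L = exp 1 / ln L + 4 * ((ln (L ^ 3 * ln L) / ln \<theta> + 1) * exp (- (L powr (1/3)))
       + ((exp L + ln (ln L)) / ln \<theta> + 1) * exp (- (\<theta> * L))) + 2 * exp (- (\<kappa>\<^sup>2 * L / 6))" for L :: real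
  have "((\<lambda>L::real. exp 1 / ln L) \<longlongrightarrow> 0) at_top" by real_asymp
  moreover have "((\<lambda>L::real. 2 * exp (- (\<kappa>\<^sup>2 * L / 6))) \<longlongrightarrow> 0) at_top" using k by real_asymp
  ultimately have "(g \<longlongrightarrow> 0 + 4 * (0 + 0) + 0) at_top"
    unfolding g_def using small_blocks_tendsto[of "ln \<theta>"] large_blocks_tendsto[of \<theta> "ln \<theta>"] \<theta> by (intro tendsto_intros) auto
  then have lim: "(\<lambda>n. g (ln (ln (real n)))) \<longlonglongrightarrow> 0"
    using filterlim_compose[OF _ filterlim_ln_ln] by simp
  have "\<forall>\<^sub>F n in sequentially. measure (H0_law n) {y \<in> space (H0_law n). trgof_reject s (c n) \<delta> n y} \<le> g (ln (ln (real n)))"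
  proof -
    have "\<forall>\<^sub>F L::real in at_top. 3 \<le> L \<and> L powr (1/3) \<le> L / (1 + sqrt (5 * L * ln L) / 2) \<and>
        L powr (1/3) \<le> L / (1 + sqrt (sqrt (7 * L)))\<^sup>2 \<and> 1 + 2 * \<theta> / L \<le> sqrt \<theta>"
    proof (intro eventually_conj small_block_exponent_upper small_block_exponent_lower eventually_ge_at_top)
      have "((\<lambda>L::real. 1 + 2 * \<theta> / L) \<longlongrightarrow> 1) at_top" by real_asymp
      moreover have "1 < sqrt \<theta>" using \<theta> by simp
      ultimately have "\<forall>\<^sub>F L::real in at_top. 1 + 2 * \<theta> / L < sqrt \<theta>" by (rule order_tendstoD(2))
      then show "\<forall>\<^sub>F L::real in at_top. 1 + 2 * \<theta> / L \<le> sqrt \<theta>" by eventually_elim simp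
    qed
    from eventually_compose_filterlim[OF this filterlim_ln_ln]
    have ev: "\<forall>\<^sub>F n in sequentially. 3 \<le> ln (ln (real n)) \<and>
        ln (ln (real n)) powr (1/3) \<le> ln (ln (real n)) / (1 + sqrt (5 * ln (ln (real n)) * ln (ln (ln (real n)))) / 2) \<and>
        ln (ln (real n)) powr (1/3) \<le> ln (ln (real n)) / (1 + sqrt (sqrt (7 * ln (ln (real n)))))\<^sup>2 \<and>
        1 + 2 * \<theta> / ln (ln (real n)) \<le> sqrt \<theta>" .
    have ev1: "\<forall>\<^sub>F n::nat in sequentially. 108 * ln (ln (real n)) * \<kappa> \<le> real n" using k by real_asymp
    have "((\<lambda>n::nat. sqrt (\<kappa> * ln (ln (real n)) / (2 * real n))) \<longlongrightarrow> 0) sequentially" using k by real_asymp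
    then have "\<forall>\<^sub>F n::nat in sequentially. sqrt (\<kappa> * ln (ln (real n)) / (2 * real n)) < \<kappa> / 2"
      using k by (intro order_tendstoD(2)) auto
    moreover have "\<forall>\<^sub>F n::nat in sequentially. sqrt (7 * ln (ln (real n))) \<le> real n" by real_asymp
    ultimately show ?thesis using ev ev1 eventually_gt_at_top[of "2::nat"]
    proof eventually_elim
      case (elim n)
      have n: "0 < n" using elim by simp
      have "c n \<le> 1" using c[of n] n by (rule_tac order_trans[OF c]) simp
      have "0 < ln (real n)" using elim by simp
      then have "real n = exp (exp (ln (ln (real n))))" using n by simp
      with elim n \<open>c n \<le> 1\<close> show ?case
        unfolding g_def by (intro type_I_bound[OF n refl _ _ \<theta> \<kappa>_def \<theta>\<delta> s]) auto
    qed
  qed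
  then show ?thesis
    by (intro tendsto_sandwich[OF _ _ tendsto_const lim]) auto
qed

section \<open>The Gumbel-max decoder\<close>

abbreviation unif :: "real measure" where "unif \<equiv> uniform_measure lborel {0..1}"

abbreviation unifs :: "('w \<Rightarrow> real) measure" where "unifs \<equiv> PiM UNIV (\<lambda>_. unif)"

lemma prob_space_unif: "prob_space unif"
  by (rule prob_space_uniform_measure) auto

lemma sets_unifs [measurable_cong]: "sets unifs = sets (PiM UNIV (\<lambda>_. borel))"
  by (intro sets_PiM_cong) auto

lemma prob_space_unifs: "prob_space unifs"
  by (intro prob_space_PiM prob_space_unif)

lemma space_unifs [simp]: "space (unifs :: ('w \<Rightarrow> real) measure) = UNIV"
  by (simp add: space_PiM)

lemma measure_unif_atMost: "0 \<le> b \<Longrightarrow> b \<le> 1 \<Longrightarrow> measure unif {..b} = b"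
proof -
  assume b: "0 \<le> b" "b \<le> 1"
  then have "{0..1} \<inter> {..b} = {0..b}" by auto
  then show ?thesis using b by (simp add: measure_uniform_measure)
qed

lemma measure_unif_greaterThan: "0 \<le> b \<Longrightarrow> b \<le> 1 \<Longrightarrow> measure unif {b<..} = 1 - b"
proof -
  assume b: "0 \<le> b" "b \<le> 1"
  then have "{0..1} \<inter> {b<..} = {b<..1}" by auto
  then show ?thesis using b by (simp add: measure_uniform_measure)
qed

lemma measure_unifs_box:
  fixes A :: "'w::finite \<Rightarrow> real set"
  assumes "\<And>w. A w \<in> sets borel"
  shows "measure unifs {u. \<forall>w. u w \<in> A w} = (\<Prod>w\<in>UNIV. measure unif (A w))"
proof -
  interpret prob_space unif by (rule prob_space_unif)
  interpret finite_product_prob_space "\<lambda>_. unif" "UNIV :: 'w set"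
    by unfold_locales auto
  have "{u. \<forall>w. u w \<in> A w} = PiE UNIV A" by auto
  then show ?thesis using assms by (simp add: finite_measure_PiM_emb)
qed

lemma measure_unifs_coord:
  fixes w :: "'w::finite"
  assumes "B \<in> sets borel"
  shows "measure unifs {u. u w \<in> B} = measure unif B"
proof -
  interpret prob_space unif by (rule prob_space_unif)
  have "{u. u w \<in> B} = {u. \<forall>v. u v \<in> (if v = w then B else UNIV)}" by auto
  also have "measure unifs \<dots> = (\<Prod>v\<in>UNIV. measure unif (if v = w then B else UNIV))"
    using assms by (intro measure_unifs_box) auto
  also have "\<dots> = (\<Prod>v\<in>UNIV. if v = w then measure unif B else 1)"
    using prob_space by (intro prod.cong) auto
  finally show ?thesis by simp
qed

lemma AE_unifs_Ioo: "AE u in (unifs :: ('w::finite \<Rightarrow> real) measure). \<forall>w. 0 < u w \<and> u w < 1"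
proof -
  have "AE x in unif. 0 < x \<and> x < 1"
    using AE_lborel_singleton[of "0::real"] AE_lborel_singleton[of "1::real"]
    by (subst AE_uniform_measure) auto
  then have "AE u in (unifs :: ('w \<Rightarrow> real) measure). 0 < u w \<and> u w < 1" for w
    by (intro AE_PiM_component prob_space_unif) auto
  then show ?thesis by (simp add: AE_all_countable)
qed

text \<open>The choice is a function of the set of maximisers. That set takes finitely many values,
  each described by finitely many inequalities, so ties need no separate treatment.\<close>

lemma gumbel_dec_measurable [measurable]:
  fixes p u :: "'a \<Rightarrow> 'w::finite \<Rightarrow> real"
  assumes [measurable]: "p \<in> measurable M (PiM UNIV (\<lambda>_. borel))" "u \<in> measurable M (PiM UNIV (\<lambda>_. borel))"
  shows "(\<lambda>x. gumbel_dec (p x) (u x)) \<in> measurable M (count_space UNIV)"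
proof -
  define T where "T x = {w. p x w > 0 \<and> (\<forall>v. p x v > 0 \<longrightarrow> ln (u x v) / p x v \<le> ln (u x w) / p x w)}" for x
  have [measurable]: "(\<lambda>x. p x w) \<in> borel_measurable M" "(\<lambda>x. u x w) \<in> borel_measurable M" for w
    by measurable
  have "T \<in> measurable M (count_space UNIV)"
  proof (subst measurable_count_space_eq2, simp, safe)
    fix A
    have "T -` {A} \<inter> space M = {x \<in> space M. \<forall>w. w \<in> A \<longleftrightarrow> w \<in> T x}" by auto
    also have "\<dots> \<in> sets M" unfolding T_def mem_Collect_eq by measurable
    finally show "T -` {A} \<inter> space M \<in> sets M" .
  qed simp
  then have "(\<lambda>x. SOME w. w \<in> T x) \<in> measurable M (count_space UNIV)"
    by (rule measurable_compose) simp
  then show ?thesis by (simp add: gumbel_dec_def T_def)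
qed

lemma gumbel_dec_props:
  fixes P :: "'w::finite \<Rightarrow> real"
  assumes "P w > 0"
  shows "P (gumbel_dec P U) > 0"
    and "P v > 0 \<Longrightarrow> ln (U v) / P v \<le> ln (U (gumbel_dec P U)) / P (gumbel_dec P U)"
proof -
  let ?f = "\<lambda>v. ln (U v) / P v"
  have "Max (?f ` {v. P v > 0}) \<in> ?f ` {v. P v > 0}" using assms by (intro Max_in) auto
  then obtain m where m: "P m > 0" "?f m = Max (?f ` {v. P v > 0})" by auto
  have "P m > 0 \<and> (\<forall>v. P v > 0 \<longrightarrow> ?f v \<le> ?f m)" using m by auto
  from someI[where P = "\<lambda>m. P m > 0 \<and> (\<forall>v. P v > 0 \<longrightarrow> ?f v \<le> ?f m)", OF this]
  have "P (gumbel_dec P U) > 0 \<and> (\<forall>v. P v > 0 \<longrightarrow> ?f v \<le> ?f (gumbel_dec P U))"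
    unfolding gumbel_dec_def .
  then show "P (gumbel_dec P U) > 0" "P v > 0 \<Longrightarrow> ?f v \<le> ?f (gumbel_dec P U)" by auto
qed

lemma prob_vec_top:
  fixes P :: "'w::finite \<Rightarrow> real"
  assumes "prob_vec P" "Delta_of P = D"
  obtains m where "P m = 1 - D" "\<And>w. P w \<le> P m" "1 / real CARD('w) \<le> 1 - D" "1 - D \<le> 1"
    "(\<Sum>w\<in>UNIV - {m}. P w) = D" "\<And>w. w \<noteq> m \<Longrightarrow> P w \<le> D"
proof -
  have "Max (range P) \<in> range P" by (rule Max_in) auto
  then obtain m where "Max (range P) = P m" by (rule imageE)
  then have m: "P m = Max (range P)" by simp
  have nn: "0 \<le> P w" for w using assms by (simp add: prob_vec_def)
  have le: "P w \<le> P m" for w unfolding m by simp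
  have Pm: "P m = 1 - D" using assms m by (simp add: Delta_of_def)
  have sum: "(\<Sum>w\<in>UNIV. P w) = 1" using assms by (simp add: prob_vec_def)
  then have "1 \<le> (\<Sum>w::'w\<in>UNIV. P m)" using le by (metis sum_mono)
  then have c: "1 / real CARD('w) \<le> 1 - D" using Pm by (simp add: field_simps)
  have s: "(\<Sum>w\<in>UNIV - {m}. P w) = D" using sum Pm by (simp add: sum_diff1)
  have "P w \<le> D" if "w \<noteq> m" for w
    using member_le_sum[of w "UNIV - {m}" P] that nn s by simp
  moreover have "1 - D \<le> 1" using s nn sum_nonneg[of "UNIV - {m}" P] by simp
  ultimately show thesis using that Pm le c s by blast
qed

text \<open>With \<open>N\<close> tokens the largest probability is at least \<open>1 / N\<close>,
  and \<open>exp (- P m) \<ge> exp (- 1)\<close>; the factor 1/2 comes from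
  \<open>1 - exp (- D) \<ge> D / 2\<close>.\<close>

definition gap_const :: "nat \<Rightarrow> real" where
  "gap_const N = min (1 / real N) (exp (- 1)) / 2"

text \<open>The two favourable events: the most likely token \<open>m\<close> has \<open>U m > 1 - D\<close>; or \<open>U m \<le> exp (- P m)\<close>
  and some other token has \<open>U w > exp (- P w)\<close>. In the second case every token with score above \<open>-1\<close>,
  in particular the selected one, differs from \<open>m\<close>, so it has \<open>U > exp (- P w) \<ge> exp (- D) \<ge> 1 - D\<close>.\<close>

lemma gumbel_dec_gap_pointwise:
  fixes P :: "'w::finite \<Rightarrow> real"
  assumes "\<And>w. 0 \<le> P w" "P m = 1 - D" "0 < P m" "\<And>w. P w \<le> P m" "\<And>w. w \<noteq> m \<Longrightarrow> P w \<le> D"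
    and u: "\<And>w. 0 < u w" "\<And>w. u w < 1"
    and "1 - D < u m \<or> (u m \<le> exp (- P m) \<and> (\<exists>w. w \<noteq> m \<and> 0 < P w \<and> exp (- P w) < u w))"
  shows "1 - D < u (gumbel_dec P u)"
proof -
  define S where "S = gumbel_dec P u"
  have S: "0 < P S" "\<And>v. 0 < P v \<Longrightarrow> ln (u v) / P v \<le> ln (u S) / P S"
    using gumbel_dec_props(1)[of P m u] gumbel_dec_props(2)[of P m _ u] assms(3) by (auto simp: S_def)
  show ?thesis unfolding S_def[symmetric] using assms(8)
  proof
    assume m: "1 - D < u m"
    \<comment> \<open>The logarithm is negative and \<open>P S \<le> P m\<close>, so scaling by
      \<open>P S / P m\<close> moves it towards 0.\<close>
    have "ln (u m) \<le> ln (u m) * (P S / P m)"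
      using assms(3,4) u S(1) by (simp add: field_simps ln_less_zero mult_le_cancel_left)
    also have "\<dots> = P S * (ln (u m) / P m)" by simp
    also have "\<dots> \<le> P S * (ln (u S) / P S)" using S assms(3) by (intro mult_left_mono) auto
    finally have "ln (u m) \<le> ln (u S)" using S(1) by simp
    then show "1 - D < u S" using m u by simp
  next
    assume "u m \<le> exp (- P m) \<and> (\<exists>w. w \<noteq> m \<and> 0 < P w \<and> exp (- P w) < u w)"
    then obtain w where um: "u m \<le> exp (- P m)" and w: "0 < P w" "exp (- P w) < u w" by blast
    have "ln (exp (- P w)) < ln (u w)" using w u by (subst ln_less_cancel_iff) auto
    then have "- P w < ln (u w)" by simp
    then have "- 1 < ln (u w) / P w" using w by (simp add: field_simps)
    also have "\<dots> \<le> ln (u S) / P S" using S w by simp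
    finally have lS: "- P S < ln (u S)" using S(1) by (simp add: field_simps)
    have "S \<noteq> m"
    proof
      assume "S = m"
      then have "ln (exp (- P m)) < ln (u m)" using lS by simp
      then have "exp (- P m) < u m" using u by (subst (asm) ln_less_cancel_iff) auto
      then show False using um by simp
    qed
    have "1 - D \<le> exp (- D)" using exp_ge_add_one_self[of "- D"] by simp
    also have "\<dots> \<le> exp (- P S)" using assms(5)[OF \<open>S \<noteq> m\<close>] by simp
    also have "\<dots> < exp (ln (u S))" using lS by simp
    finally show "1 - D < u S" using u by simp
  qed
qed

text \<open>The thresholds \<open>exp (- P w)\<close> multiply to \<open>exp (- D)\<close> over the
  tokens other than \<open>m\<close>, whatever the individual probabilities. The first favourable
  event has probability \<open>D\<close>, and the second adds
  \<open>b * (1 - exp (- D))\<close>.\<close>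

lemma gumbel_dec_gap:
  fixes P :: "'w::finite \<Rightarrow> real"
  assumes P: "prob_vec P" "Delta_of P = D"
  shows "D + gap_const CARD('w) * D \<le> measure unifs {u. 1 - D < u (gumbel_dec P u)}"
proof -
  interpret prob_space "unifs :: ('w \<Rightarrow> real) measure" by (rule prob_space_unifs)
  obtain m where m: "P m = 1 - D" "\<And>w. P w \<le> P m" "1 / real CARD('w) \<le> 1 - D" "1 - D \<le> 1"
    "(\<Sum>w\<in>UNIV - {m}. P w) = D" "\<And>w. w \<noteq> m \<Longrightarrow> P w \<le> D"
    using prob_vec_top[OF P] by metis
  have nn: "0 \<le> P w" for w using P by (simp add: prob_vec_def)
  have "0 < 1 / real CARD('w)" by simp
  then have Pm: "0 < P m" and D: "0 \<le> D" "D \<le> 1" using m by linarith+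
  \<comment> \<open>The bound \<open>b \<le> P m = 1 - D\<close> makes the two favourable events
    disjoint, and \<open>b \<le> exp (- P m)\<close> is what the pointwise lemma asks for.\<close>
  define b where "b = min (P m) (exp (- P m))"
  have b: "0 < b" "b \<le> P m" "b \<le> exp (- P m)" "b \<le> 1" using Pm m by (auto simp: b_def)
  let ?A = "{u :: 'w \<Rightarrow> real. u m \<in> {1 - D<..}}"
  let ?B = "{u :: 'w \<Rightarrow> real. u m \<in> {..b}}"
  let ?C = "{u :: 'w \<Rightarrow> real. \<forall>w. u w \<in> {..if w = m then b else exp (- P w)}}"
  have coord [measurable]: "(\<lambda>u. u w) \<in> borel_measurable (unifs :: ('w \<Rightarrow> real) measure)" for w
    by measurable
  have ev: "?A \<in> events" "?B \<in> events" "?C \<in> events"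
  proof -
    have "{u \<in> space unifs. 1 - D < u m} \<in> events" "{u \<in> space unifs. u m \<le> b} \<in> events"
      "{u \<in> space unifs. \<forall>w. u w \<le> (if w = m then b else exp (- P w))} \<in> events"
      by measurable
    then show "?A \<in> events" "?B \<in> events" "?C \<in> events" by simp_all
  qed
  have A: "prob ?A = D"
    using measure_unif_greaterThan[of "1 - D"] D by (subst measure_unifs_coord) auto
  have B: "prob ?B = b"
    using b by (subst measure_unifs_coord) (auto simp: measure_unif_atMost)
  have C: "prob ?C = b * exp (- D)"
  proof -
    have "prob ?C = (\<Prod>w\<in>UNIV. measure unif {..if w = m then b else exp (- P w)})"
      by (intro measure_unifs_box) auto
    also have "\<dots> = (\<Prod>w\<in>UNIV. if w = m then b else exp (- P w))"
      using b nn by (intro prod.cong refl measure_unif_atMost) auto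
    also have "\<dots> = b * (\<Prod>w\<in>UNIV - {m}. if w = m then b else exp (- P w))"
      by (subst prod.remove[of _ m]) auto
    also have "(\<Prod>w\<in>UNIV - {m}. if w = m then b else exp (- P w)) = (\<Prod>w\<in>UNIV - {m}. exp (- P w))"
      by (intro prod.cong) auto
    also have "\<dots> = exp (- D)" by (simp add: exp_sum[symmetric] sum_negf m(5))
    finally show ?thesis .
  qed
  have "?C \<subseteq> ?B" by auto
  then have BC: "prob (?B - ?C) = b - b * exp (- D)" using ev B C by (simp add: finite_measure_Diff)
  have "b \<le> 1 - D" using b m by simp
  then have "?A \<inter> (?B - ?C) = {}" by auto
  then have ABC: "prob (?A \<union> (?B - ?C)) = D + (b - b * exp (- D))"
    using ev A BC by (subst finite_measure_Union) auto
  have "exp (- D) \<le> 1 - D / 2"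
  proof -
    have "exp (- D) = 1 / exp D" by (simp add: exp_minus divide_inverse)
    also have "\<dots> \<le> 1 / (1 + D)" using exp_ge_add_one_self[of D] D by (intro divide_left_mono) auto
    also have "\<dots> \<le> 1 - D / 2" using D mult_right_mono[of D 1 D] by (simp add: field_simps)
    finally show ?thesis .
  qed
  then have "b * exp (- D) \<le> b * (1 - D / 2)" using b by (intro mult_left_mono) auto
  moreover have "gap_const CARD('w) * D \<le> b / 2 * D"
    using D m unfolding gap_const_def b_def
    by (intro mult_right_mono divide_right_mono min.mono) auto
  ultimately have "D + gap_const CARD('w) * D \<le> prob (?A \<union> (?B - ?C))"
    unfolding ABC by (simp add: algebra_simps)
  also have "\<dots> \<le> prob {u. 1 - D < u (gumbel_dec P u)}"
  proof (rule finite_measure_mono_AE)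
    show "AE u in unifs. u \<in> ?A \<union> (?B - ?C) \<longrightarrow> u \<in> {u. 1 - D < u (gumbel_dec P u)}"
      using AE_unifs_Ioo
    proof eventually_elim
      case (elim u)
      show ?case
      proof
        assume u: "u \<in> ?A \<union> (?B - ?C)"
        have "1 - D < u m \<or> (u m \<le> exp (- P m) \<and> (\<exists>w. w \<noteq> m \<and> 0 < P w \<and> exp (- P w) < u w))"
        proof (cases "u \<in> ?A")
          case False
          then have "u m \<le> b" "u \<notin> ?C" using u by auto
          then obtain w where w: "w \<noteq> m" "exp (- P w) < u w" by (auto split: if_splits)
          \<comment> \<open>A token of probability 0 would need \<open>u w > 1\<close>.\<close>
          have "P w \<noteq> 0" using w elim by (metis exp_zero less_asym minus_zero)
          then show ?thesis using w \<open>u m \<le> b\<close> b nn[of w] by force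
        qed simp
        then show "u \<in> {u. 1 - D < u (gumbel_dec P u)}"
          using gumbel_dec_gap_pointwise[of P m D u] nn m Pm elim by auto
      qed
    qed
    have [measurable]: "(\<lambda>u. gumbel_dec P u) \<in> measurable unifs (count_space UNIV)"
      by (rule gumbel_dec_measurable) (auto simp: space_PiM measurable_ident_sets[OF sets_unifs])
    have "{u \<in> space unifs. \<exists>w. gumbel_dec P u = w \<and> 1 - D < u w} \<in> events"
      by measurable
    then show "{u. 1 - D < u (gumbel_dec P u)} \<in> events" by simp
  qed
  finally show ?thesis .
qed

section \<open>The watermark model\<close>

lemma prob_vec_bounds:
  fixes p :: "'w::finite \<Rightarrow> real"
  assumes "prob_vec p"
  shows "0 \<le> p w" "p w \<le> 1"
  using assms member_le_sum[of w UNIV p] by (auto simp: prob_vec_def)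

text \<open>An average over a fresh \<open>u\<close> with the token distribution frozen. A token
  drawn independently of \<open>u\<close> exceeds \<open>1 - D\<close> with probability exactly
  \<open>D\<close>, so the gain comes from the watermarked part alone.\<close>

lemma expectation_unifs_gap:
  fixes p :: "'w::finite \<Rightarrow> real"
  assumes p: "prob_vec p" "Delta_of p = D" and e: "0 \<le> eps" "eps \<le> 1"
  shows "D + eps * (gap_const CARD('w) * D) \<le>
    (\<integral>u. eps * indicator {u. 1 - D < u (gumbel_dec p u)} u + (1 - eps) * (\<Sum>w\<in>UNIV. p w * indicator {u. u w \<in> {1 - D<..}} u) \<partial>unifs)"
proof -
  interpret prob_space "unifs :: ('w \<Rightarrow> real) measure" by (rule prob_space_unifs)
  obtain m where m: "1 / real CARD('w) \<le> 1 - D" "1 - D \<le> 1" using prob_vec_top[OF p] by metis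
  have "0 < 1 / real CARD('w)" by simp
  then have D: "0 \<le> D" "D \<le> 1" using m by linarith+
  have ev1: "{u. 1 - D < u (gumbel_dec p u)} \<in> events"
  proof -
    have [measurable]: "(\<lambda>u. gumbel_dec p u) \<in> measurable unifs (count_space UNIV)"
      by (rule gumbel_dec_measurable) (auto simp: space_PiM measurable_ident_sets[OF sets_unifs])
    have [measurable]: "(\<lambda>u. u w) \<in> borel_measurable (unifs :: ('w \<Rightarrow> real) measure)" for w by measurable
    have "{u \<in> space unifs. \<exists>w. gumbel_dec p u = w \<and> 1 - D < u w} \<in> events" by measurable
    then show ?thesis by simp
  qed
  have ev2: "{u. u w \<in> {1 - D<..}} \<in> events" for w :: 'w
  proof -
    have [measurable]: "(\<lambda>u. u w) \<in> borel_measurable (unifs :: ('w \<Rightarrow> real) measure)" by measurable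
    have "{u \<in> space unifs. 1 - D < u w} \<in> events" by measurable
    then show ?thesis by simp
  qed
  have "(\<integral>u. eps * indicator E u + (1 - eps) * (\<Sum>w\<in>UNIV. p w * indicator (F w) u) \<partial>unifs)
    = eps * prob E + (1 - eps) * (\<Sum>w\<in>UNIV. p w * prob (F w))"
    if E: "E \<in> events" and F: "\<And>w. F w \<in> events" for E and F :: "'w \<Rightarrow> ('w \<Rightarrow> real) set"
  proof -
    have [simp]: "integrable unifs (indicator A :: _ \<Rightarrow> real)" if "A \<in> events" for A
      using that by (simp add: emeasure_eq_measure)
    have int: "integrable unifs (\<lambda>u. \<Sum>w\<in>UNIV. p w * indicator (F w) u)"
      using F by (intro Bochner_Integration.integrable_sum integrable_mult_right) auto
    have eq: "(\<integral>u. (\<Sum>w\<in>UNIV. p w * indicator (F w) u) \<partial>unifs) = (\<Sum>w\<in>UNIV. p w * prob (F w))"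
      using F by (subst Bochner_Integration.integral_sum) auto
    have "(\<integral>u. eps * indicator E u + (1 - eps) * (\<Sum>w\<in>UNIV. p w * indicator (F w) u) \<partial>unifs)
      = (\<integral>u. eps * indicator E u \<partial>unifs) + (\<integral>u. (1 - eps) * (\<Sum>w\<in>UNIV. p w * indicator (F w) u) \<partial>unifs)"
      using E by (intro Bochner_Integration.integral_add integrable_mult_right int) auto
    then show ?thesis using E unfolding integral_mult_right_zero eq by simp
  qed
  from this[OF ev1 ev2] have "(\<integral>u. eps * indicator {u. 1 - D < u (gumbel_dec p u)} u + (1 - eps) * (\<Sum>w\<in>UNIV. p w * indicator {u. u w \<in> {1 - D<..}} u) \<partial>unifs)
    = eps * prob {u. 1 - D < u (gumbel_dec p u)} + (1 - eps) * (\<Sum>w\<in>UNIV. p w * prob {u. u w \<in> {1 - D<..}})" .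
  also have "(\<Sum>w\<in>UNIV. p w * prob {u. u w \<in> {1 - D<..}}) = (\<Sum>w\<in>UNIV. p w * D)"
    using measure_unif_greaterThan[of "1 - D"] D by (intro sum.cong refl, subst measure_unifs_coord) auto
  also have "\<dots> = D" using p by (simp add: sum_distrib_right[symmetric] prob_vec_def)
  finally have eq: "(\<integral>u. eps * indicator {u. 1 - D < u (gumbel_dec p u)} u + (1 - eps) * (\<Sum>w\<in>UNIV. p w * indicator {u. u w \<in> {1 - D<..}} u) \<partial>unifs)
    = eps * prob {u. 1 - D < u (gumbel_dec p u)} + (1 - eps) * D" .
  have "eps * (D + gap_const CARD('w) * D) \<le> eps * prob {u. 1 - D < u (gumbel_dec p u)}"
    using gumbel_dec_gap[OF p] e by (intro mult_left_mono) auto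
  then show ?thesis unfolding eq by (simp add: algebra_simps)
qed

section \<open>Conditioning on the history\<close>

locale watermark =
  fixes M :: "'a measure" and n :: nat and eps D :: real
    and P U :: "nat \<Rightarrow> 'a \<Rightarrow> 'w::finite \<Rightarrow> real" and W :: "nat \<Rightarrow> 'a \<Rightarrow> 'w"
  assumes wm: "wm_model M n eps D P U W"
begin

sublocale prob_space M using wm by (simp add: wm_model_def)

lemma eps: "0 \<le> eps" "eps \<le> 1" using wm by (auto simp: wm_model_def)

lemma meas [measurable]:
  assumes "t \<in> {1..n}"
  shows "P t \<in> measurable M (PiM UNIV (\<lambda>_. borel))" "U t \<in> measurable M (PiM UNIV (\<lambda>_. borel))"
    "W t \<in> measurable M (count_space UNIV)"
  using wm assms by (auto simp: wm_model_def)

lemma prob_vec_P: "t \<in> {1..n} \<Longrightarrow> \<omega> \<in> space M \<Longrightarrow> prob_vec (P t \<omega>)"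
  and Delta_P: "t \<in> {1..n} \<Longrightarrow> \<omega> \<in> space M \<Longrightarrow> Delta_of (P t \<omega>) = D"
  using wm by (auto simp: wm_model_def)

lemma distr_U: "t \<in> {1..n} \<Longrightarrow> distr M (PiM UNIV (\<lambda>_. borel)) (U t) = unifs"
  and indep: "t \<in> {1..n} \<Longrightarrow> indep_set (Fsig M P U W t) (sig_of M (U t))"
  and indep_U: "indep_vars (\<lambda>_. PiM UNIV (\<lambda>_. borel)) U {1..n}"
  and law_W: "t \<in> {1..n} \<Longrightarrow> A \<in> sigma_sets (space M) (Fsig M P U W t \<union> sig_of M (U t)) \<Longrightarrow>
     measure M (A \<inter> {\<omega>\<in>space M. W t \<omega> = w}) =
      (\<integral>\<omega>. indicator A \<omega> * (eps * (if gumbel_dec (P t \<omega>) (U t \<omega>) = w then 1 else 0)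
                                      + (1 - eps) * P t \<omega> w) \<partial>M)"
  using wm by (auto simp: wm_model_def)

definition Fgen :: "nat \<Rightarrow> 'a set set" where
  "Fgen t = (\<Union>j\<in>{1..t}. {P j -` B \<inter> space M | B. B \<in> sets (PiM UNIV (\<lambda>_. borel))})
    \<union> (\<Union>j\<in>{1..<t}. {W j -` B \<inter> space M | B. True})
    \<union> (\<Union>j\<in>{1..<t}. {U j -` B \<inter> space M | B. B \<in> sets (PiM UNIV (\<lambda>_. borel))})"

text \<open>Presents \<open>Fsig\<close> as the sets of a measure space, so that measurability with
  respect to the history is an ordinary measurability statement.\<close>

definition Fmeas :: "nat \<Rightarrow> 'a measure" where
  "Fmeas t = sigma (space M) (Fgen t)"

lemma Fgen_Pow: "Fgen t \<subseteq> Pow (space M)"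
  unfolding Fgen_def by auto

lemma space_Fmeas [simp]: "space (Fmeas t) = space M"
  unfolding Fmeas_def using Fgen_Pow by simp

lemma sets_Fmeas: "sets (Fmeas t) = Fsig M P U W t"
  unfolding Fmeas_def Fsig_def Fgen_def[symmetric] using Fgen_Pow by simp

lemma P_Fmeas: "1 \<le> j \<Longrightarrow> j \<le> t \<Longrightarrow> t \<le> n \<Longrightarrow> P j \<in> measurable (Fmeas t) (PiM UNIV (\<lambda>_. borel))"
  unfolding measurable_def using measurable_space[OF meas(1)[of j]]
  by (auto simp: sets_Fmeas Fsig_def space_PiM intro!: sigma_sets.Basic)

lemma U_Fmeas: "1 \<le> j \<Longrightarrow> j < t \<Longrightarrow> t \<le> n \<Longrightarrow> U j \<in> measurable (Fmeas t) (PiM UNIV (\<lambda>_. borel))"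
  unfolding measurable_def using measurable_space[OF meas(2)[of j]]
  by (auto simp: sets_Fmeas Fsig_def space_PiM intro!: sigma_sets.Basic)

lemma W_Fmeas: "1 \<le> j \<Longrightarrow> j < t \<Longrightarrow> t \<le> n \<Longrightarrow> W j \<in> measurable (Fmeas t) (count_space UNIV)"
proof (rule measurableI)
  fix B assume "1 \<le> j" "j < t"
  then show "W j -` B \<inter> space (Fmeas t) \<in> sets (Fmeas t)"
    unfolding space_Fmeas sets_Fmeas Fsig_def
    by (intro sigma_sets.Basic UnI1[OF UnI2] UN_I[of j]) auto
qed simp

lemma sets_Fmeas_M:
  assumes "t \<in> {1..n}"
  shows "sets (Fmeas t) \<subseteq> sets M"
  unfolding Fmeas_def
proof (subst sets_measure_of[OF Fgen_Pow], rule sets.sigma_sets_subset)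
  show "Fgen t \<subseteq> sets M"
    using assms unfolding Fgen_def
    by (auto intro!: measurable_sets[OF meas(1)] measurable_sets[OF meas(2)] measurable_sets[OF meas(3)])
qed

lemma Y_measurable:
  assumes "U j \<in> measurable N (PiM UNIV (\<lambda>_. borel))" "W j \<in> measurable N (count_space UNIV)"
  shows "(\<lambda>\<omega>. Yobs U W \<omega> j) \<in> borel_measurable N"
proof -
  have "(\<lambda>\<omega>. U j \<omega> w) \<in> borel_measurable N" for w
    using assms(1) by measurable
  then show ?thesis unfolding Yobs_def
    by (rule measurable_compose_countable[OF _ assms(2)])
qed

text \<open>Carrying the indicator of \<open>A\<close> along with \<open>P t\<close> puts everything
  needed from the history into one random variable, so independence becomes a product law to which
  Fubini applies.\<close>

lemma indep_pair:
  assumes t: "t \<in> {1..n}" and A: "A \<in> Fsig M P U W t"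
  shows "distr M ((borel \<Otimes>\<^sub>M PiM UNIV (\<lambda>_. borel)) \<Otimes>\<^sub>M PiM UNIV (\<lambda>_. borel)) (\<lambda>\<omega>. ((indicator A \<omega> :: real, P t \<omega>), U t \<omega>))
    = distr M (borel \<Otimes>\<^sub>M PiM UNIV (\<lambda>_. borel)) (\<lambda>\<omega>. (indicator A \<omega> :: real, P t \<omega>)) \<Otimes>\<^sub>M unifs"
proof -
  let ?B = "PiM (UNIV :: 'w set) (\<lambda>_. borel :: real measure)"
  let ?X = "\<lambda>\<omega>. (indicator A \<omega> :: real, P t \<omega>)"
  have X: "?X \<in> measurable (Fmeas t) (borel \<Otimes>\<^sub>M ?B)"
    using A t P_Fmeas[of t t] by (intro measurable_Pair borel_measurable_indicator) (auto simp: sets_Fmeas)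
  then have XM: "?X \<in> measurable M (borel \<Otimes>\<^sub>M ?B)"
    using sets_Fmeas_M[OF t] by (auto simp: measurable_def)
  interpret U: prob_space "unifs :: ('w \<Rightarrow> real) measure" by (rule prob_space_unifs)
  interpret X: prob_space "distr M (borel \<Otimes>\<^sub>M ?B) ?X" by (rule prob_space_distr) fact
  note [measurable] = XM meas(2)[OF t]
  show ?thesis
  proof (rule pair_measure_eqI[symmetric])
    fix C E assume CE: "C \<in> sets (distr M (borel \<Otimes>\<^sub>M ?B) ?X)" "E \<in> sets (unifs :: ('w \<Rightarrow> real) measure)"
    then have CE' [measurable]: "C \<in> sets (borel \<Otimes>\<^sub>M ?B)" "E \<in> sets ?B" by (auto simp: sets_unifs)
    have 1: "?X -` C \<inter> space M \<in> Fsig M P U W t"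
      using measurable_sets[OF X CE'(1)] by (simp add: sets_Fmeas)
    have 2: "U t -` E \<inter> space M \<in> sig_of M (U t)"
      unfolding sig_of_def using CE'(2) by (intro sigma_sets.Basic CollectI exI[of _ E] conjI refl)
    have "emeasure (distr M (borel \<Otimes>\<^sub>M ?B) ?X) C * emeasure unifs E
      = emeasure M (?X -` C \<inter> space M) * emeasure M (U t -` E \<inter> space M)"
      unfolding distr_U[OF t, symmetric] by (simp only: emeasure_distr[OF XM CE'(1)] emeasure_distr[OF meas(2)[OF t] CE'(2)])
    also have "\<dots> = emeasure M ((?X -` C \<inter> space M) \<inter> (U t -` E \<inter> space M))"
      using indep_setD[OF indep[OF t] 1 2] by (simp add: emeasure_eq_measure ennreal_mult)
    also have "(?X -` C \<inter> space M) \<inter> (U t -` E \<inter> space M) = (\<lambda>\<omega>. (?X \<omega>, U t \<omega>)) -` (C \<times> E) \<inter> space M"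
      by auto
    also have "emeasure M \<dots> = emeasure (distr M ((borel \<Otimes>\<^sub>M ?B) \<Otimes>\<^sub>M ?B) (\<lambda>\<omega>. (?X \<omega>, U t \<omega>))) (C \<times> E)"
      by (rule emeasure_distr[symmetric]) measurable
    finally show "emeasure (distr M (borel \<Otimes>\<^sub>M ?B) ?X) C * emeasure unifs E
      = emeasure (distr M ((borel \<Otimes>\<^sub>M ?B) \<Otimes>\<^sub>M ?B) (\<lambda>\<omega>. (?X \<omega>, U t \<omega>))) (C \<times> E)" .
  next
    show "sets (distr M (borel \<Otimes>\<^sub>M ?B) ?X \<Otimes>\<^sub>M (unifs :: ('w \<Rightarrow> real) measure))
      = sets (distr M ((borel \<Otimes>\<^sub>M ?B) \<Otimes>\<^sub>M ?B) (\<lambda>\<omega>. (?X \<omega>, U t \<omega>)))"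
      by (simp add: sets_unifs cong: sets_pair_measure_cong)
  qed (rule X.sigma_finite_measure_axioms U.sigma_finite_measure_axioms)+
qed

definition hit :: "nat \<Rightarrow> 'a set" where
  "hit t = {\<omega> \<in> space M. 1 - D < Yobs U W \<omega> t}"

lemma hit_sets: "t \<in> {1..n} \<Longrightarrow> hit t \<in> events"
  unfolding hit_def using Y_measurable[OF meas(2,3)[of t]] by measurable

lemma hit_Fsig: "1 \<le> j \<Longrightarrow> j < t \<Longrightarrow> t \<le> n \<Longrightarrow> hit j \<in> Fsig M P U W t"
  unfolding hit_def sets_Fmeas[symmetric] space_Fmeas[of t, symmetric]
  using Y_measurable[OF U_Fmeas W_Fmeas, of j t] by measurable

text \<open>Once the value \<open>w\<close> of the token is fixed,
  \<open>1 - D < U t \<omega> w\<close> is an event of \<open>U t\<close> alone, so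
  \<open>law_W\<close> applies to its intersection with \<open>A\<close>; summing over
  \<open>w\<close> collapses the point mass at the decoded token.\<close>

lemma prob_hit_eq:
  assumes t: "t \<in> {1..n}" and A: "A \<in> Fsig M P U W t"
  shows "prob (A \<inter> hit t) = (\<integral>\<omega>. indicator A \<omega> *
     (eps * indicator {u. 1 - D < u (gumbel_dec (P t \<omega>) u)} (U t \<omega>) +
      (1 - eps) * (\<Sum>w\<in>UNIV. P t \<omega> w * indicator {u. u w \<in> {1 - D<..}} (U t \<omega>))) \<partial>M)"
proof -
  have AM: "A \<in> events" using A sets_Fmeas_M[OF t] by (auto simp: sets_Fmeas)
  note [measurable] = AM meas[OF t]
  let ?E = "\<lambda>w. {\<omega> \<in> space M. 1 - D < U t \<omega> w}"
  have Uw [measurable]: "(\<lambda>\<omega>. U t \<omega> w) \<in> borel_measurable M" "(\<lambda>\<omega>. P t \<omega> w) \<in> borel_measurable M" for w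
    by measurable
  have [measurable]: "(\<lambda>\<omega>. gumbel_dec (P t \<omega>) (U t \<omega>)) \<in> measurable M (count_space UNIV)"
    by measurable
  have E: "A \<inter> ?E w \<in> sigma_sets (space M) (Fsig M P U W t \<union> sig_of M (U t))" for w
  proof -
    let ?S = "sigma (space M) (Fsig M P U W t \<union> sig_of M (U t))"
    have pow: "Fsig M P U W t \<union> sig_of M (U t) \<subseteq> Pow (space M)"
      using sets.sets_into_space[of _ "Fmeas t"] unfolding sets_Fmeas sig_of_def
      by (auto dest: sigma_sets_into_sp[rotated])
    have "{u. 1 - D < u w} \<in> sets (PiM UNIV (\<lambda>_. borel))"
    proof -
      have [measurable]: "(\<lambda>u. u w) \<in> borel_measurable (PiM (UNIV :: 'w set) (\<lambda>_. borel))" by measurable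
      have "{u \<in> space (PiM UNIV (\<lambda>_. borel)). 1 - D < u w} \<in> sets (PiM (UNIV :: 'w set) (\<lambda>_. borel))"
        by measurable
      then show ?thesis by (simp add: space_PiM)
    qed
    then have "U t -` {u. 1 - D < u w} \<inter> space M \<in> sig_of M (U t)"
      unfolding sig_of_def by (intro sigma_sets.Basic CollectI exI[of _ "{u. 1 - D < u w}"] conjI refl)
    moreover have "U t -` {u. 1 - D < u w} \<inter> space M = ?E w" by auto
    ultimately have "?E w \<in> sets ?S" "A \<in> sets ?S"
      using A pow by (auto intro: sigma_sets.Basic)
    then have "A \<inter> ?E w \<in> sets ?S" by (rule sets.Int[rotated])
    then show ?thesis using pow by simp
  qed
  have "prob (A \<inter> hit t) = prob (\<Union>w. (A \<inter> ?E w) \<inter> {\<omega> \<in> space M. W t \<omega> = w})"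
    by (intro arg_cong[where f = prob]) (auto simp: hit_def Yobs_def)
  also have "\<dots> = (\<Sum>w\<in>UNIV. prob ((A \<inter> ?E w) \<inter> {\<omega> \<in> space M. W t \<omega> = w}))"
    by (intro finite_measure_finite_Union) (auto simp: disjoint_family_on_def image_subset_iff)
  also have "\<dots> = (\<Sum>w\<in>UNIV. \<integral>\<omega>. indicator (A \<inter> ?E w) \<omega> * (eps * (if gumbel_dec (P t \<omega>) (U t \<omega>) = w then 1 else 0)
                                      + (1 - eps) * P t \<omega> w) \<partial>M)"
    by (intro sum.cong refl law_W[OF t E])
  also have "\<dots> = (\<integral>\<omega>. (\<Sum>w\<in>UNIV. indicator (A \<inter> ?E w) \<omega> * (eps * (if gumbel_dec (P t \<omega>) (U t \<omega>) = w then 1 else 0)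
                                      + (1 - eps) * P t \<omega> w)) \<partial>M)"
  proof (rule Bochner_Integration.integral_sum[symmetric])
    fix w
    have bd: "\<bar>P t \<omega> w\<bar> \<le> 1" if "\<omega> \<in> space M" for \<omega>
    proof -
      show ?thesis using prob_vec_bounds[OF prob_vec_P[OF t that], of w] by simp
    qed
    show "integrable M (\<lambda>\<omega>. indicator (A \<inter> ?E w) \<omega> * (eps * (if gumbel_dec (P t \<omega>) (U t \<omega>) = w then 1 else 0)
                                      + (1 - eps) * P t \<omega> w))"
    proof (rule integrable_const_bound[where B = 2])
      show "AE \<omega> in M. norm (indicator (A \<inter> ?E w) \<omega> * (eps * (if gumbel_dec (P t \<omega>) (U t \<omega>) = w then 1 else 0)
                                      + (1 - eps) * P t \<omega> w)) \<le> 2"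
      proof (rule AE_I2)
        fix \<omega> assume "\<omega> \<in> space M"
        have "\<bar>(1 - eps) * P t \<omega> w\<bar> \<le> 1 * 1"
          unfolding abs_mult using bd[OF \<open>\<omega> \<in> space M\<close>] eps by (intro mult_mono) auto
        then show "norm (indicator (A \<inter> ?E w) \<omega> * (eps * (if gumbel_dec (P t \<omega>) (U t \<omega>) = w then 1 else 0)
                                      + (1 - eps) * P t \<omega> w)) \<le> 2"
          using eps by (auto simp: indicator_def)
      qed
    qed measurable
  qed
  also have "\<dots> = (\<integral>\<omega>. indicator A \<omega> *
     (eps * indicator {u. 1 - D < u (gumbel_dec (P t \<omega>) u)} (U t \<omega>) +
      (1 - eps) * (\<Sum>w\<in>UNIV. P t \<omega> w * indicator {u. u w \<in> {1 - D<..}} (U t \<omega>))) \<partial>M)"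
  proof (rule Bochner_Integration.integral_cong[OF refl])
    fix \<omega> assume "\<omega> \<in> space M"
    let ?g = "gumbel_dec (P t \<omega>) (U t \<omega>)"
    have "(\<Sum>w\<in>UNIV. indicator (A \<inter> ?E w) \<omega> * (eps * (if ?g = w then 1 else 0) + (1 - eps) * P t \<omega> w))
      = indicator A \<omega> * (eps * (\<Sum>w\<in>UNIV. if w = ?g then indicator (?E w) \<omega> else 0) + (1 - eps) * (\<Sum>w\<in>UNIV. P t \<omega> w * indicator (?E w) \<omega>))"
      unfolding distrib_left sum_distrib_left sum.distrib[symmetric]
      by (intro sum.cong) (auto simp: indicator_def algebra_simps)
    also have "(\<Sum>w\<in>UNIV. if w = ?g then indicator (?E w) \<omega> else 0 :: real) = indicator (?E ?g) \<omega>"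
      by simp
    finally show "(\<Sum>w\<in>UNIV. indicator (A \<inter> ?E w) \<omega> * (eps * (if ?g = w then 1 else 0) + (1 - eps) * P t \<omega> w))
      = indicator A \<omega> * (eps * indicator {u. 1 - D < u (gumbel_dec (P t \<omega>) u)} (U t \<omega>) +
      (1 - eps) * (\<Sum>w\<in>UNIV. P t \<omega> w * indicator {u. u w \<in> {1 - D<..}} (U t \<omega>)))"
      using \<open>\<omega> \<in> space M\<close> by (simp add: indicator_def)
  qed
  finally show ?thesis .
qed

end

section \<open>Type II error\<close>

text \<open>The witness is the order statistic whose index is the number \<open>k\<close> of
  p-values below \<open>v\<close>. The condition \<open>k < n\<close> keeps \<open>u\<close> below
  1, and \<open>y t < 1\<close> keeps the p-value positive, as \<open>Kplus\<close> demands.\<close>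

lemma trgof_reject_if_excess:
  fixes y :: "nat \<Rightarrow> real"
  assumes n: "0 < n" and s: "- 1 \<le> s" "s \<le> 2" and c: "c \<le> 1 / real n" "c \<le> v"
    and y1: "\<And>t. t \<in> {1..n} \<Longrightarrow> y t < 1"
    and k: "k = card {t \<in> {1..n}. 1 - v < y t}" "k < n"
    and v: "0 < v" "0 < d" and ex: "real n * (v + d) \<le> real k"
    and big: "(1 + \<delta>) * ln (ln (real n)) \<le> real n * (d\<^sup>2 / (2 * (v + d)))"
  shows "trgof_reject s c \<delta> n y"
proof -
  have k': "k = card {t \<in> {1..n}. 1 - y t < v}"
    unfolding k(1) by (intro arg_cong[where f = card]) auto
  have "0 < real n * (v + d)" using n v by simp
  then have k0: "0 < k" using ex by linarith
  then have kn: "k \<in> {1..n}" "k + 1 \<in> {1..n}" using k by auto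
  have pv: "pord n y k < v" using pord_less_iff[OF kn(1), of y v] k' by simp
  \<comment> \<open>The next order statistic is at least \<open>v \<ge> c\<close>, so the truncation
    admits the index \<open>k\<close>.\<close>
  have "\<not> pord n y (k + 1) < v" using pord_less_iff[OF kn(2), of y v] k' by simp
  then have cv: "c \<le> pord n y (k + 1)" using c by linarith
  have p0: "0 < pord n y k"
  proof -
    have "card {t \<in> {1..n}. 1 - y t \<le> pord n y k} \<noteq> 0" using card_le_pord[OF kn(1), of y] k0 by linarith
    then have "{t \<in> {1..n}. 1 - y t \<le> pord n y k} \<noteq> {}" by (metis card.empty)
    then obtain t where "t \<in> {1..n}" "1 - y t \<le> pord n y k" by auto
    then show ?thesis using y1[of t] by linarith
  qed
  define u where "u = real k / real n"
  have u: "v + d \<le> u" "u < 1" using ex k n by (auto simp: u_def field_simps)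
  \<comment> \<open>Written as \<open>(u - v) * (1 - v / u) / 2\<close>, the bound is a product of
    factors increasing in \<open>u\<close>, so \<open>u\<close> may be lowered to
    \<open>v + d\<close>.\<close>
  have "d\<^sup>2 / (2 * (v + d)) = d * (d / (v + d)) / 2" by (simp add: power2_eq_square)
  also have "\<dots> \<le> (u - v) * ((u - v) / u) / 2"
  proof -
    have "v / u \<le> v / (v + d)" using u v by (intro divide_left_mono) auto
    moreover have "(u - v) / u = 1 - v / u" "d / (v + d) = 1 - v / (v + d)" using u v by (auto simp: field_simps)
    ultimately have "d / (v + d) \<le> (u - v) / u" by simp
    then show ?thesis using u v by (intro divide_right_mono mult_mono) auto
  qed
  also have "\<dots> = (u - v)\<^sup>2 / (2 * u)" by (simp add: power2_eq_square)
  also have "\<dots> \<le> (u - pord n y k)\<^sup>2 / (2 * u)"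
    using u v pv by (intro divide_right_mono power_mono) auto
  also have "\<dots> \<le> Kdiv s u (pord n y k)" using p0 pv u v s by (intro Kdiv_lower) auto
  also have "\<dots> = Kplus s u (pord n y k)" using p0 pv u v by (simp add: Kplus_def)
  finally have "real n * (d\<^sup>2 / (2 * (v + d))) \<le> real n * Kplus s u (pord n y k)"
    by (intro mult_left_mono) auto
  then have "(1 + \<delta>) * ln (ln (real n)) \<le> real n * Kplus s (real k / real n) (pord n y k)"
    using big unfolding u_def by linarith
  moreover have "1 / real n \<le> 1" using n by simp
  ultimately show ?thesis
    using trgof_reject_iff[OF n, of c s \<delta> y] c cv kn by force
qed

context watermark begin

text \<open>The conditional lower bound, tested on history events. By \<open>indep_pair\<close> the
  current \<open>U t\<close> may be integrated out first with \<open>P t\<close> frozen, where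
  \<open>expectation_unifs_gap\<close> applies.\<close>

lemma prob_hit_ge:
  assumes t: "t \<in> {1..n}" and A: "A \<in> Fsig M P U W t"
  shows "prob A * (D + eps * (gap_const CARD('w) * D)) \<le> prob (A \<inter> hit t)"
proof -
  let ?B = "PiM (UNIV :: 'w set) (\<lambda>_. borel :: real measure)"
  let ?R = "borel \<Otimes>\<^sub>M ?B :: (real \<times> ('w \<Rightarrow> real)) measure"
  let ?X = "\<lambda>\<omega>. (indicator A \<omega> :: real, P t \<omega>)"
  define f where "f x u = fst x * (eps * indicator {v. 1 - D < v (gumbel_dec (snd x) v)} u +
      (1 - eps) * (\<Sum>w\<in>UNIV. snd x w * indicator {v. v w \<in> {1 - D<..}} u))" for x :: "real \<times> ('w \<Rightarrow> real)" and u
  have AM [measurable]: "A \<in> events" using A sets_Fmeas_M[OF t] by (auto simp: sets_Fmeas)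
  note [measurable] = meas[OF t]
  have XM [measurable]: "?X \<in> measurable M ?R" by measurable
  have f [measurable]: "(\<lambda>z. f (fst z) (snd z)) \<in> borel_measurable (?R \<Otimes>\<^sub>M ?B)"
  proof -
    have [measurable]: "(\<lambda>z. snd z w) \<in> borel_measurable (?R \<Otimes>\<^sub>M ?B)" "(\<lambda>z. snd (fst z) w) \<in> borel_measurable (?R \<Otimes>\<^sub>M ?B)" for w
      by measurable
    have g: "(\<lambda>z. gumbel_dec (snd (fst z)) (snd z)) \<in> measurable (?R \<Otimes>\<^sub>M ?B) (count_space UNIV)"
      by (rule gumbel_dec_measurable) measurable
    have [measurable]: "(\<lambda>z. snd z (gumbel_dec (snd (fst z)) (snd z))) \<in> borel_measurable (?R \<Otimes>\<^sub>M ?B)"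
      by (rule measurable_compose_countable[OF _ g]) measurable
    have "(\<lambda>z. fst (fst z) * (eps * (if 1 - D < snd z (gumbel_dec (snd (fst z)) (snd z)) then 1 else 0) +
      (1 - eps) * (\<Sum>w\<in>UNIV. snd (fst z) w * (if 1 - D < snd z w then 1 else 0)))) \<in> borel_measurable (?R \<Otimes>\<^sub>M ?B)"
      by measurable
    then show ?thesis unfolding f_def by (simp add: indicator_def of_bool_def)
  qed
  have bd: "\<bar>f (?X \<omega>) (U t \<omega>)\<bar> \<le> 1 + real CARD('w)" if \<omega>: "\<omega> \<in> space M" for \<omega>
  proof -
    have "\<bar>\<Sum>w\<in>UNIV. P t \<omega> w * indicator {v. v w \<in> {1 - D<..}} (U t \<omega>)\<bar> \<le> (\<Sum>w\<in>(UNIV::'w set). 1)"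
      using prob_vec_bounds[OF prob_vec_P[OF t \<omega>]] by (intro order_trans[OF sum_abs] sum_mono) (auto simp: indicator_def)
    then have "\<bar>(1 - eps) * (\<Sum>w\<in>UNIV. P t \<omega> w * indicator {v. v w \<in> {1 - D<..}} (U t \<omega>))\<bar> \<le> 1 * real CARD('w)"
      unfolding abs_mult using eps by (intro mult_mono) auto
    moreover have "\<bar>eps * indicator {v. 1 - D < v (gumbel_dec (P t \<omega>) v)} (U t \<omega>)\<bar> \<le> 1"
      using eps by (auto simp: indicator_def)
    ultimately show ?thesis unfolding f_def fst_conv snd_conv by (cases "\<omega> \<in> A") (auto simp del: mem_Collect_eq)
  qed
  have int: "integrable M (\<lambda>\<omega>. f (?X \<omega>) (U t \<omega>))"
  proof (rule integrable_const_bound[where B = "1 + real CARD('w)"])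
    show "(\<lambda>\<omega>. f (?X \<omega>) (U t \<omega>)) \<in> borel_measurable M"
      using measurable_compose[OF measurable_Pair[OF XM meas(2)[OF t]] f] by simp
  qed (use bd in auto)
  let ?J = "distr M ?R ?X \<Otimes>\<^sub>M (unifs :: ('w \<Rightarrow> real) measure)"
  interpret V: prob_space "unifs :: ('w \<Rightarrow> real) measure" by (rule prob_space_unifs)
  interpret X: prob_space "distr M ?R ?X" by (rule prob_space_distr) fact
  interpret XV: pair_sigma_finite "distr M ?R ?X" "unifs :: ('w \<Rightarrow> real) measure" ..
  have J: "distr M (?R \<Otimes>\<^sub>M ?B) (\<lambda>\<omega>. (?X \<omega>, U t \<omega>)) = ?J" by (rule indep_pair[OF t A])
  have pair [measurable]: "(\<lambda>\<omega>. (?X \<omega>, U t \<omega>)) \<in> measurable M (?R \<Otimes>\<^sub>M ?B)" by measurable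
  have intJ: "integrable ?J (\<lambda>z. f (fst z) (snd z))"
    unfolding J[symmetric] using int by (subst integrable_distr_eq[OF pair f]) simp
  have intX: "integrable (distr M ?R ?X) (\<lambda>x. \<integral>u. f x u \<partial>unifs)"
    using XV.integrable_fst'[OF intJ] by simp
  then have intX': "integrable M (\<lambda>\<omega>. \<integral>u. f (?X \<omega>) u \<partial>unifs)"
    by (subst (asm) integrable_distr_eq[OF XM]) (auto intro: borel_measurable_integrable)
  have "prob A * (D + eps * (gap_const CARD('w) * D)) = (\<integral>\<omega>. indicator A \<omega> * (D + eps * (gap_const CARD('w) * D)) \<partial>M)"
    by simp
  also have "\<dots> \<le> (\<integral>\<omega>. (\<integral>u. f (?X \<omega>) u \<partial>unifs) \<partial>M)"
  proof (rule integral_mono[OF _ intX'])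
    show "integrable M (\<lambda>\<omega>. indicator A \<omega> * (D + eps * (gap_const CARD('w) * D)))"
      using AM by (intro integrable_mult_left integrable_real_indicator) (auto simp: emeasure_eq_measure)
    fix \<omega> assume \<omega>: "\<omega> \<in> space M"
    have "(\<integral>u. f (?X \<omega>) u \<partial>unifs) = indicator A \<omega> * (\<integral>u. eps * indicator {u. 1 - D < u (gumbel_dec (P t \<omega>) u)} u + (1 - eps) * (\<Sum>w\<in>UNIV. P t \<omega> w * indicator {u. u w \<in> {1 - D<..}} u) \<partial>unifs)"
      unfolding f_def fst_conv snd_conv by (rule integral_mult_right_zero)
    also have "\<dots> \<ge> indicator A \<omega> * (D + eps * (gap_const CARD('w) * D))"
      using \<omega> by (intro mult_left_mono expectation_unifs_gap prob_vec_P[OF t] Delta_P[OF t] eps) auto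
    finally show "indicator A \<omega> * (D + eps * (gap_const CARD('w) * D)) \<le> (\<integral>u. f (?X \<omega>) u \<partial>unifs)" .
  qed
  also have "\<dots> = (\<integral>x. (\<integral>u. f x u \<partial>unifs) \<partial>distr M ?R ?X)"
    using intX by (subst integral_distr[OF XM]) (auto intro: borel_measurable_integrable)
  also have "\<dots> = (\<integral>z. f (fst z) (snd z) \<partial>?J)"
    using XV.integral_fst'[OF intJ] by simp
  also have "\<dots> = (\<integral>\<omega>. f (?X \<omega>) (U t \<omega>) \<partial>M)"
    unfolding J[symmetric] by (subst integral_distr[OF pair f]) simp
  also have "\<dots> = prob (A \<inter> hit t)"
    unfolding prob_hit_eq[OF t A] f_def by simp
  finally show ?thesis .
qed

section \<open>The number of hits: generating function and tail bounds\<close>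

definition cnt :: "nat \<Rightarrow> 'a \<Rightarrow> nat" where
  "cnt t \<omega> = card {j \<in> {1..t}. \<omega> \<in> hit j}"

lemma cnt_Suc: "cnt (Suc t) \<omega> = cnt t \<omega> + (if \<omega> \<in> hit (Suc t) then 1 else 0)"
proof -
  have "{j \<in> {1..Suc t}. \<omega> \<in> hit j} = {j \<in> {1..t}. \<omega> \<in> hit j} \<union> (if \<omega> \<in> hit (Suc t) then {Suc t} else {})"
    by (auto simp: le_Suc_eq)
  then show ?thesis unfolding cnt_def by (simp add: card_insert_if)
qed

lemma cnt_le: "cnt t \<omega> \<le> t"
proof -
  have "card {j \<in> {1..t}. \<omega> \<in> hit j} \<le> card {1..t}" by (rule card_mono) auto
  then show ?thesis by (simp add: cnt_def)
qed

lemma cnt_eq_sum: "real (cnt t \<omega>) = (\<Sum>j\<in>{1..t}. indicator (hit j) \<omega>)"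
  by (induction t) (auto simp: cnt_Suc, simp add: cnt_def)

text \<open>The history of step \<open>Suc t\<close> contains tokens and uniforms only up to step
  \<open>t\<close>, hence the shift of the index.\<close>

lemma cnt_Fsig:
  assumes "Suc t \<le> n"
  shows "{\<omega> \<in> space M. cnt t \<omega> = k} \<in> Fsig M P U W (Suc t)"
proof -
  have [measurable]: "hit j \<in> sets (Fmeas (Suc t))" if "j \<in> {1..t}" for j
    unfolding sets_Fmeas using hit_Fsig[of j "Suc t"] that assms by simp
  have "{\<omega> \<in> space (Fmeas (Suc t)). (\<Sum>j\<in>{1..t}. indicator (hit j) \<omega>) = real k} \<in> sets (Fmeas (Suc t))"
    by measurable
  also have "{\<omega> \<in> space (Fmeas (Suc t)). (\<Sum>j\<in>{1..t}. indicator (hit j) \<omega>) = real k} = {\<omega> \<in> space M. cnt t \<omega> = k}"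
    unfolding cnt_eq_sum[symmetric] by simp
  finally show ?thesis unfolding sets_Fmeas .
qed

lemma cnt_measurable [measurable]:
  assumes "t \<le> n"
  shows "cnt t \<in> measurable M (count_space UNIV)"
proof -
  have [measurable]: "hit j \<in> events" if "j \<in> {1..t}" for j
    using hit_sets[of j] that assms by simp
  have "{\<omega> \<in> space M. (\<Sum>j\<in>{1..t}. indicator (hit j) \<omega>) = real k} \<in> events" for k
    by measurable
  then have "{\<omega> \<in> space M. cnt t \<omega> = k} \<in> events" for k
    unfolding cnt_eq_sum[symmetric] by simp
  moreover have "cnt t -` {k} \<inter> space M = {\<omega> \<in> space M. cnt t \<omega> = k}" for k by auto
  ultimately show ?thesis by (subst measurable_count_space_eq2_countable) auto
qed

text \<open>A hit multiplies \<open>x ^ cnt t\<close> by \<open>x \<le> 1\<close>, so a lower bound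
  on its conditional probability gives an upper bound here. On each level set of
  \<open>cnt t\<close>, a history event, \<open>prob_hit_ge\<close> provides it.\<close>

lemma pgf_step:
  assumes t: "Suc t \<le> n" and x: "0 \<le> x" "x \<le> 1" and \<pi>: "\<pi> = D + eps * (gap_const CARD('w) * D)"
  shows "(\<integral>\<omega>. x ^ cnt (Suc t) \<omega> \<partial>M) \<le> (1 - (1 - x) * \<pi>) * (\<integral>\<omega>. x ^ cnt t \<omega> \<partial>M)"
proof -
  let ?E = "\<lambda>k. {\<omega> \<in> space M. cnt t \<omega> = k}"
  note [measurable] = cnt_measurable[of t] cnt_measurable[of "Suc t"]
  have t': "t \<le> n" "Suc t \<in> {1..n}" using t by auto
  have h: "hit (Suc t) \<in> events" using hit_sets t' by blast
  have E: "?E k \<in> events" for k using cnt_measurable[OF t'(1)] by measurable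
  have sum1: "(\<Sum>k\<le>t. x ^ k * indicator (?E k \<inter> B) \<omega>) = x ^ cnt t \<omega> * indicator B \<omega>" if "\<omega> \<in> space M" for \<omega> B
  proof -
    have "(\<Sum>k\<le>t. x ^ k * indicator (?E k \<inter> B) \<omega>) = (\<Sum>k\<le>t. if k = cnt t \<omega> then x ^ k * indicator B \<omega> else 0)"
      using that by (intro sum.cong) (auto simp: indicator_def)
    then show ?thesis using cnt_le[of t \<omega>] by simp
  qed
  have int: "(\<integral>\<omega>. x ^ cnt t \<omega> * indicator B \<omega> \<partial>M) = (\<Sum>k\<le>t. x ^ k * prob (?E k \<inter> B))"
    "integrable M (\<lambda>\<omega>. x ^ cnt t \<omega> * indicator B \<omega>)" if B: "B \<in> events" for B
  proof -
    have EB: "?E k \<inter> B \<in> events" for k using E B by (rule sets.Int)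
    have i: "integrable M (\<lambda>\<omega>. \<Sum>k\<le>t. x ^ k * indicator (?E k \<inter> B) \<omega>)"
      using EB by (intro Bochner_Integration.integrable_sum integrable_mult_right integrable_real_indicator) (auto simp: emeasure_eq_measure)
    then show "integrable M (\<lambda>\<omega>. x ^ cnt t \<omega> * indicator B \<omega>)"
      by (subst Bochner_Integration.integrable_cong[OF refl sum1[symmetric]])
    have "(\<integral>\<omega>. x ^ cnt t \<omega> * indicator B \<omega> \<partial>M) = (\<integral>\<omega>. (\<Sum>k\<le>t. x ^ k * indicator (?E k \<inter> B) \<omega>) \<partial>M)"
      by (intro Bochner_Integration.integral_cong refl sum1[symmetric])
    also have "\<dots> = (\<Sum>k\<le>t. \<integral>\<omega>. x ^ k * indicator (?E k \<inter> B) \<omega> \<partial>M)"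
      using EB by (intro Bochner_Integration.integral_sum integrable_mult_right integrable_real_indicator) (auto simp: emeasure_eq_measure)
    also have "\<dots> = (\<Sum>k\<le>t. x ^ k * prob (?E k \<inter> B))"
      using EB by (intro sum.cong refl) (simp add: measure_space_inter)
    finally show "(\<integral>\<omega>. x ^ cnt t \<omega> * indicator B \<omega> \<partial>M) = (\<Sum>k\<le>t. x ^ k * prob (?E k \<inter> B))" .
  qed
  have int1: "(\<integral>\<omega>. x ^ cnt t \<omega> \<partial>M) = (\<Sum>k\<le>t. x ^ k * prob (?E k))" "integrable M (\<lambda>\<omega>. x ^ cnt t \<omega>)"
  proof -
    have eq: "x ^ cnt t \<omega> = x ^ cnt t \<omega> * indicator (space M) \<omega>" if "\<omega> \<in> space M" for \<omega> using that by simp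
    have "?E k \<inter> space M = ?E k" for k by auto
    then have "(\<integral>\<omega>. x ^ cnt t \<omega> * indicator (space M) \<omega> \<partial>M) = (\<Sum>k\<le>t. x ^ k * prob (?E k))"
      using int(1)[OF sets.top] by simp
    then show "(\<integral>\<omega>. x ^ cnt t \<omega> \<partial>M) = (\<Sum>k\<le>t. x ^ k * prob (?E k))"
      by (subst Bochner_Integration.integral_cong[OF refl eq])
    show "integrable M (\<lambda>\<omega>. x ^ cnt t \<omega>)"
      using int(2)[OF sets.top] by (subst Bochner_Integration.integrable_cong[OF refl eq])
  qed
  have "(\<integral>\<omega>. x ^ cnt (Suc t) \<omega> \<partial>M) = (\<integral>\<omega>. x ^ cnt t \<omega> - (1 - x) * (x ^ cnt t \<omega> * indicator (hit (Suc t)) \<omega>) \<partial>M)"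
    by (intro Bochner_Integration.integral_cong refl) (auto simp: cnt_Suc indicator_def algebra_simps)
  also have "\<dots> = (\<integral>\<omega>. x ^ cnt t \<omega> \<partial>M) - (1 - x) * (\<integral>\<omega>. x ^ cnt t \<omega> * indicator (hit (Suc t)) \<omega> \<partial>M)"
    using int1(2) int(2)[OF h] by (simp only: Bochner_Integration.integral_diff integrable_mult_right integral_mult_right_zero)
  also have "(\<integral>\<omega>. x ^ cnt t \<omega> * indicator (hit (Suc t)) \<omega> \<partial>M) \<ge> \<pi> * (\<integral>\<omega>. x ^ cnt t \<omega> \<partial>M)"
    unfolding int(1)[OF h] int1(1) sum_distrib_left
  proof (rule sum_mono)
    fix k
    have "prob (?E k) * \<pi> \<le> prob (?E k \<inter> hit (Suc t))"
      unfolding \<pi> by (rule prob_hit_ge[OF t'(2) cnt_Fsig[OF t]])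
    then have "x ^ k * (prob (?E k) * \<pi>) \<le> x ^ k * prob (?E k \<inter> hit (Suc t))"
      using x by (intro mult_left_mono) auto
    then show "\<pi> * (x ^ k * prob (?E k)) \<le> x ^ k * prob (?E k \<inter> hit (Suc t))" by (simp add: mult_ac)
  qed
  then have "(\<integral>\<omega>. x ^ cnt t \<omega> \<partial>M) - (1 - x) * (\<integral>\<omega>. x ^ cnt t \<omega> * indicator (hit (Suc t)) \<omega> \<partial>M)
     \<le> (\<integral>\<omega>. x ^ cnt t \<omega> \<partial>M) - (1 - x) * (\<pi> * (\<integral>\<omega>. x ^ cnt t \<omega> \<partial>M))"
    using x by (intro diff_left_mono mult_left_mono) auto
  finally show ?thesis by (simp add: algebra_simps)
qed

lemma pgf_bound:
  assumes "t \<le> n" and x: "0 \<le> x" "x \<le> 1" and \<pi>: "\<pi> = D + eps * (gap_const CARD('w) * D)" "\<pi> \<le> 1"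
  shows "(\<integral>\<omega>. x ^ cnt t \<omega> \<partial>M) \<le> (1 - (1 - x) * \<pi>) ^ t"
  using assms(1)
proof (induction t)
  case 0
  then show ?case by (simp add: cnt_def prob_space)
next
  case (Suc t)
  have "(1 - x) * \<pi> \<le> (1 - x) * 1" using x \<pi> by (intro mult_left_mono) auto
  then have "0 \<le> 1 - (1 - x) * \<pi>" using x by simp
  moreover have "(\<integral>\<omega>. x ^ cnt t \<omega> \<partial>M) \<le> (1 - (1 - x) * \<pi>) ^ t" using Suc by simp
  ultimately have "(1 - (1 - x) * \<pi>) * (\<integral>\<omega>. x ^ cnt t \<omega> \<partial>M) \<le> (1 - (1 - x) * \<pi>) ^ Suc t"
    by (simp add: mult_left_mono)
  then show ?case using pgf_step[OF Suc.prems x \<pi>(1)] by linarith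
qed

text \<open>The generating function bound is that of independent indicators of mean
  \<open>\<pi>\<close>, so the usual lower-tail Chernoff estimate goes through.\<close>

lemma chernoff_cnt:
  assumes n: "0 < n" and \<pi>: "\<pi> = D + eps * (gap_const CARD('w) * D)" and \<eta>: "0 \<le> \<eta>" "\<eta> < 1" "0 \<le> \<pi>"
  shows "prob {\<omega> \<in> space M. real (cnt n \<omega>) \<le> real n * \<pi> * (1 - \<eta>)} \<le> exp (- (real n * \<pi> * \<eta>\<^sup>2 / 2))"
proof -
  have t1: "1 \<in> {1..n}" using n by simp
  have "space M \<in> Fsig M P U W 1" unfolding sets_Fmeas[symmetric] by (metis sets.top space_Fmeas)
  from prob_hit_ge[OF t1 this] have "\<pi> \<le> prob (space M \<inter> hit 1)" by (simp add: \<pi> prob_space)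
  then have \<pi>1: "\<pi> \<le> 1" using prob_le_1 order_trans by blast
  \<comment> \<open>The optimal parameter: it makes the exponent the rate function of
    \<open>bennett_lower_neg\<close>.\<close>
  define x where "x = 1 - \<eta>"
  have x: "0 < x" "x \<le> 1" using \<eta> by (auto simp: x_def)
  define m where "m = real n * \<pi> * (1 - \<eta>)"
  let ?S = "{\<omega> \<in> space M. real (cnt n \<omega>) \<le> m}"
  have [measurable]: "cnt n \<in> measurable M (count_space UNIV)" by (rule cnt_measurable) simp
  have S: "?S \<in> events" by measurable
  have int: "integrable M (\<lambda>\<omega>. x ^ cnt n \<omega>)"
    by (rule integrable_const_bound[where B = 1]) (use x in \<open>auto simp: power_le_one\<close>)
  have "x powr m * prob ?S = (\<integral>\<omega>. x powr m * indicator ?S \<omega> \<partial>M)" using S by (simp add: measure_space_inter)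
  also have "\<dots> \<le> (\<integral>\<omega>. x ^ cnt n \<omega> \<partial>M)"
  proof (rule integral_mono[OF _ int])
    show "integrable M (\<lambda>\<omega>. x powr m * indicator ?S \<omega>)"
      using S by (intro integrable_mult_right integrable_real_indicator) (auto simp: emeasure_eq_measure)
    fix \<omega> assume "\<omega> \<in> space M"
    have "x powr m \<le> x ^ cnt n \<omega>" if "real (cnt n \<omega>) \<le> m"
      using that x powr_mono'[of "real (cnt n \<omega>)" m x] by (simp add: powr_realpow)
    then show "x powr m * indicator ?S \<omega> \<le> x ^ cnt n \<omega>" using x by (auto simp: indicator_def)
  qed
  also have "\<dots> \<le> (1 - \<eta> * \<pi>) ^ n"
    using pgf_bound[of n x \<pi>] x \<pi> \<pi>1 by (simp add: x_def)
  also have "\<dots> \<le> exp (- (\<eta> * \<pi>)) ^ n"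
  proof (rule power_mono)
    show "1 - \<eta> * \<pi> \<le> exp (- (\<eta> * \<pi>))" using exp_ge_add_one_self[of "- (\<eta> * \<pi>)"] by simp
    have "\<eta> * \<pi> \<le> 1 * 1" using \<eta> \<pi>1 by (intro mult_mono) auto
    then show "0 \<le> 1 - \<eta> * \<pi>" by simp
  qed
  also have "\<dots> = exp (- (real n * \<pi> * \<eta>))" by (simp add: exp_of_nat_mult[symmetric])
  finally have "prob ?S \<le> exp (- (real n * \<pi> * \<eta>)) / x powr m" using x by (simp add: field_simps)
  also have "\<dots> = exp (- (real n * \<pi> * ((1 - \<eta>) * ln (1 - \<eta>) + \<eta>)))"
    using x by (simp add: powr_def exp_diff[symmetric] m_def x_def algebra_simps)
  also have "\<dots> \<le> exp (- (real n * \<pi> * (\<eta>\<^sup>2 / 2)))"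
    using mult_left_mono[OF bennett_lower_neg[OF \<eta>(1,2)], of "real n * \<pi>"] \<eta>(3) by simp
  finally show ?thesis unfolding m_def by simp
qed

text \<open>If step \<open>t\<close> is a hit, some coordinate of \<open>U t\<close> exceeds
  \<open>1 - D\<close>, whichever token was selected. These events are independent over
  \<open>t\<close>, and each fails with probability \<open>(1 - D) ^ CARD('w)\<close>, which stays
  away from 0 even if \<open>D\<close> does not tend to 0.\<close>

lemma prob_all_hit:
  assumes n: "0 < n" and D: "1 / real CARD('w) \<le> 1 - D" "0 \<le> D"
  shows "prob {\<omega> \<in> space M. cnt n \<omega> = n} \<le> (1 - (1 / real CARD('w)) ^ CARD('w)) ^ n"
proof -
  let ?B = "PiM (UNIV :: 'w set) (\<lambda>_. borel :: real measure)"
  let ?E = "{u :: 'w \<Rightarrow> real. \<exists>w. 1 - D < u w}"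
  have E: "?E \<in> sets ?B"
  proof -
    have [measurable]: "(\<lambda>u. u w) \<in> borel_measurable ?B" for w by measurable
    have "{u \<in> space ?B. \<exists>w. 1 - D < u w} \<in> sets ?B" by measurable
    then show ?thesis by (simp add: space_PiM)
  qed
  have D1: "0 \<le> 1 - D" using D by (meson divide_nonneg_nonneg of_nat_0_le_iff order_trans zero_le_one)
  interpret V: prob_space "unifs :: ('w \<Rightarrow> real) measure" by (rule prob_space_unifs)
  have pE: "measure unifs ?E \<le> 1 - (1 / real CARD('w)) ^ CARD('w)"
  proof -
    have c: "- ?E = {u. \<forall>w. u w \<in> {..1 - D}}" by (simp add: Collect_neg_eq[symmetric] not_less)
    have "V.prob (space unifs - ?E) = 1 - V.prob ?E" using E by (intro V.prob_compl) (simp add: sets_unifs)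
    moreover have "space unifs - ?E = {u. \<forall>w. u w \<in> {..1 - D}}" using c by auto
    moreover have "V.prob {u. \<forall>w. u w \<in> {..1 - D}} = (\<Prod>w\<in>(UNIV :: 'w set). 1 - D)"
      using D D1 by (subst measure_unifs_box) (auto simp: measure_unif_atMost)
    moreover have "(1 / real CARD('w)) ^ CARD('w) \<le> (1 - D) ^ CARD('w)" using D by (intro power_mono) auto
    ultimately show ?thesis by simp
  qed
  have UE: "U t -` ?E \<inter> space M \<in> events" if "t \<in> {1..n}" for t
    using measurable_sets[OF meas(2)[OF that] E] .
  have "prob {\<omega> \<in> space M. cnt n \<omega> = n} \<le> prob (\<Inter>t\<in>{1..n}. U t -` ?E \<inter> space M)"
  proof (rule finite_measure_mono)
    show "(\<Inter>t\<in>{1..n}. U t -` ?E \<inter> space M) \<in> events" using UE n by (intro sets.finite_INT) auto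
    show "{\<omega> \<in> space M. cnt n \<omega> = n} \<subseteq> (\<Inter>t\<in>{1..n}. U t -` ?E \<inter> space M)"
    proof safe
      fix \<omega> t assume \<omega>: "\<omega> \<in> space M" "cnt n \<omega> = n" and t: "t \<in> {1..n}"
      have "{j \<in> {1..n}. \<omega> \<in> hit j} = {1..n}"
        using \<omega>(2) unfolding cnt_def by (intro card_subset_eq) auto
      then have "\<omega> \<in> hit t" using t by blast
      then show "\<omega> \<in> U t -` ?E" by (auto simp: hit_def Yobs_def)
    qed
  qed
  also have "\<dots> = (\<Prod>t\<in>{1..n}. prob (U t -` ?E \<inter> space M))"
    using n E by (intro indep_varsD[OF indep_U]) auto
  also have "\<dots> = (\<Prod>t\<in>{1..n}. measure unifs ?E)"
  proof (rule prod.cong[OF refl])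
    fix t assume t: "t \<in> {1..n}"
    show "prob (U t -` ?E \<inter> space M) = measure unifs ?E"
      unfolding distr_U[OF t, symmetric] using E by (rule measure_distr[OF meas(2)[OF t], symmetric])
  qed
  also have "\<dots> = (measure unifs ?E) ^ n" by simp
  also have "\<dots> \<le> (1 - (1 / real CARD('w)) ^ CARD('w)) ^ n" using pE by (intro power_mono) auto
  finally show ?thesis .
qed

text \<open>The token may depend on all of \<open>U t\<close>, so every coordinate is kept below
  1.\<close>

lemma AE_Y_less_1: "AE \<omega> in M. \<forall>t\<in>{1..n}. Yobs U W \<omega> t < 1"
proof (rule AE_finite_allI)
  fix t assume t: "t \<in> {1..n}"
  have "AE u in distr M (PiM UNIV (\<lambda>_. borel)) (U t). \<forall>w. 0 < u w \<and> u w < 1"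
    unfolding distr_U[OF t] by (rule AE_unifs_Ioo)
  then have "AE \<omega> in M. \<forall>w. 0 < U t \<omega> w \<and> U t \<omega> w < 1"
    by (rule AE_distrD[OF meas(2)[OF t]])
  then show "AE \<omega> in M. Yobs U W \<omega> t < 1" by eventually_elim (simp add: Yobs_def)
qed simp

text \<open>One quantity \<open>X\<close> plays both roles: a lower bound for the scaled statistic
  when the count is large enough, and the exponent for the probability that it is not.\<close>

lemma type_II_bound:
  fixes s c \<delta> :: real
  defines "X \<equiv> real n * D * eps\<^sup>2 * (gap_const CARD('w))\<^sup>2 / 16"
  assumes n: "0 < n" and s: "- 1 \<le> s" "s \<le> 2" and c: "c \<le> 1 / real n" "1 / real n \<le> D"
    and e: "0 < eps" and big: "(1 + \<delta>) * ln (ln (real n)) \<le> X"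
  shows "prob {\<omega> \<in> space M. \<not> trgof_reject s c \<delta> n (Yobs U W \<omega>)}
     \<le> exp (- X) + (1 - (1 / real CARD('w)) ^ CARD('w)) ^ n"
proof -
  define g where "g = gap_const CARD('w)"
  have "g \<le> exp (- 1) / 2" "exp (- 1) \<le> (1::real)" unfolding g_def gap_const_def by simp_all
  moreover have "0 < g" by (simp add: g_def gap_const_def)
  ultimately have g: "0 < g" "g \<le> 1" by linarith+
  obtain \<omega>0 where \<omega>0: "\<omega>0 \<in> space M" using not_empty by blast
  have t1: "1 \<in> {1..n}" using n by simp
  have Dc: "1 / real CARD('w) \<le> 1 - D"
    by (rule prob_vec_top[OF prob_vec_P[OF t1 \<omega>0] Delta_P[OF t1 \<omega>0]])
  have "0 < 1 / real n" using n by simp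
  then have D: "0 < D" "0 \<le> D" using c by linarith+
  \<comment> \<open>Half of the guaranteed mean excess is kept as \<open>d\<close>;
    \<open>\<eta>\<close> is the relative deficit with \<open>\<pi> * (1 - \<eta>) = D + d\<close>.
    The 16 arises from \<open>d \<le> D\<close> in \<open>X1\<close> and from
    \<open>1 + eps * g \<le> 2\<close> in \<open>X2\<close>.\<close>
  define d where "d = eps * g * D / 2"
  define \<pi> where "\<pi> = D + eps * (g * D)"
  define \<eta> where "\<eta> = eps * g / 2 / (1 + eps * g)"
  have eg: "0 < eps * g" "eps * g \<le> 1" using e g eps mult_mono[of eps 1 g 1] by auto
  have \<pi>: "\<pi> = D * (1 + eps * g)" "0 \<le> \<pi>" using D eg by (auto simp: \<pi>_def algebra_simps)
  have \<eta>: "0 \<le> \<eta>" "\<eta> < 1" using eg by (auto simp: \<eta>_def field_simps)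
  have mean: "\<pi> * (1 - \<eta>) = D + d"
  proof -
    have "1 + eps * g \<noteq> 0" using eg by linarith
    then have "(1 + eps * g) * \<eta> = eps * g / 2" 
      unfolding \<eta>_def times_divide_eq_right[of "1 + eps * g" "eps * g / 2"] by (rule nonzero_mult_div_cancel_left)
    then have "(1 + eps * g) * (1 - \<eta>) = 1 + eps * g / 2" by (simp only: right_diff_distrib mult_1_right)
    then have "D * ((1 + eps * g) * (1 - \<eta>)) = D * (1 + eps * g / 2)" by simp
    then show ?thesis unfolding \<pi>(1) d_def by (simp add: algebra_simps)
  qed
  have d: "0 < d" "d \<le> D" using eg D mult_right_mono[OF eg(2), of D] by (auto simp: d_def)
  have X1: "X \<le> real n * (d\<^sup>2 / (2 * (D + d)))"
  proof -
    have "X = real n * (d\<^sup>2 / (4 * D))" using D by (simp add: X_def d_def g_def power2_eq_square)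
    also have "\<dots> \<le> real n * (d\<^sup>2 / (2 * (D + d)))"
      using d D by (intro mult_left_mono divide_left_mono) auto
    finally show ?thesis .
  qed
  have X2: "X \<le> real n * \<pi> * \<eta>\<^sup>2 / 2"
  proof -
    have "\<pi> * \<eta>\<^sup>2 = D * (eps * g)\<^sup>2 / 4 / (1 + eps * g)"
    proof -
      have "D * h * (e / 2 / h)\<^sup>2 = D * e\<^sup>2 / 4 / h" if "h \<noteq> 0" for e h
        using that by (simp add: power2_eq_square)
      moreover have "1 + eps * g \<noteq> 0" using eg by linarith
      ultimately show ?thesis unfolding \<pi>(1) \<eta>_def by blast
    qed
    also have "\<dots> \<ge> D * (eps * g)\<^sup>2 / 4 / 2" using eg D by (intro divide_left_mono) auto
    finally have "D * (eps * g)\<^sup>2 / 8 \<le> \<pi> * \<eta>\<^sup>2" by simp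
    then have "real n * (D * (eps * g)\<^sup>2 / 8) \<le> real n * (\<pi> * \<eta>\<^sup>2)" by (rule mult_left_mono) simp
    then show ?thesis by (simp add: X_def g_def power_mult_distrib mult_ac)
  qed
  let ?S1 = "{\<omega> \<in> space M. real (cnt n \<omega>) \<le> real n * \<pi> * (1 - \<eta>)}"
  let ?S2 = "{\<omega> \<in> space M. cnt n \<omega> = n}"
  have [measurable]: "cnt n \<in> measurable M (count_space UNIV)" by (rule cnt_measurable) simp
  have S: "?S1 \<in> events" "?S2 \<in> events" by measurable
  have "prob {\<omega> \<in> space M. \<not> trgof_reject s c \<delta> n (Yobs U W \<omega>)} \<le> prob (?S1 \<union> ?S2)"
  proof (rule finite_measure_mono_AE)
    show "AE \<omega> in M. \<omega> \<in> {\<omega> \<in> space M. \<not> trgof_reject s c \<delta> n (Yobs U W \<omega>)} \<longrightarrow> \<omega> \<in> ?S1 \<union> ?S2"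
      using AE_Y_less_1
    proof eventually_elim
      case (elim \<omega>)
      show ?case
      proof (rule impI, rule ccontr)
        assume "\<omega> \<in> {\<omega> \<in> space M. \<not> trgof_reject s c \<delta> n (Yobs U W \<omega>)}" "\<omega> \<notin> ?S1 \<union> ?S2"
        then have \<omega>: "\<omega> \<in> space M" "\<not> trgof_reject s c \<delta> n (Yobs U W \<omega>)"
          and k: "real n * \<pi> * (1 - \<eta>) < real (cnt n \<omega>)" "cnt n \<omega> \<noteq> n" by auto
        have kc: "cnt n \<omega> = card {t \<in> {1..n}. 1 - D < Yobs U W \<omega> t}"
          unfolding cnt_def hit_def using \<omega>(1) by simp
        have kn: "cnt n \<omega> < n" using k(2) cnt_le[of n \<omega>] by simp
        have "real n * (D + d) \<le> real (cnt n \<omega>)" using k(1) mean by (simp add: mult.assoc)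
        then have "trgof_reject s c \<delta> n (Yobs U W \<omega>)"
          using elim c big X1
          by (intro trgof_reject_if_excess[OF n s c(1) _ _ kc kn D(1) d(1)]) auto
        then show False using \<omega> by simp
      qed
    qed
    show "?S1 \<union> ?S2 \<in> events" using S by (rule sets.Un)
  qed
  also have "\<dots> \<le> prob ?S1 + prob ?S2" using S by (rule measure_Un_le)
  also have "prob ?S1 \<le> exp (- (real n * \<pi> * \<eta>\<^sup>2 / 2))"
    by (rule chernoff_cnt[OF n _ \<eta> \<pi>(2)]) (simp add: \<pi>_def g_def)
  also have "\<dots> \<le> exp (- X)" using X2 by simp
  also have "prob ?S2 \<le> (1 - (1 / real CARD('w)) ^ CARD('w)) ^ n"
    by (rule prob_all_hit[OF n Dc D(2)])
  finally show ?thesis by simp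
qed

end

section \<open>Rates and conclusion\<close>

theorem theorem4p3:
  fixes p q \<delta> s :: real
    and eps Delta c :: "nat \<Rightarrow> real"
    and M :: "nat \<Rightarrow> 'a measure"
    and P U :: "nat \<Rightarrow> nat \<Rightarrow> 'a \<Rightarrow> 'w::finite \<Rightarrow> real"
    and W :: "nat \<Rightarrow> nat \<Rightarrow> 'a \<Rightarrow> 'w"
  assumes "p \<ge> 0" and "0 \<le> q" and "q \<le> 1" and "q + 2 * p < 1"
    and "\<delta> > 0" and "-1 \<le> s" and "s \<le> 2"
    and "\<And>n. 0 \<le> c n \<and> c n \<le> 1 / real n"
    and "\<exists>C1 C2. C1 > 0 \<and> C2 > 0 \<and>
           (\<forall>n\<ge>1. C1 * real n powr (-p) \<le> eps n \<and> eps n \<le> C2 * real n powr (-p))"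
    and "\<exists>C1 C2. C1 > 0 \<and> C2 > 0 \<and>
           (\<forall>n\<ge>1. C1 * real n powr (-q) \<le> Delta n \<and> Delta n \<le> C2 * real n powr (-q))"
    and "\<And>n. wm_model (M n) n (eps n) (Delta n) (P n) (U n) (W n)"
  shows "(\<lambda>n. measure (H0_law n) {y \<in> space (H0_law n). trgof_reject s (c n) \<delta> n y}
            + measure (M n) {\<omega> \<in> space (M n). \<not> trgof_reject s (c n) \<delta> n (Yobs (U n) (W n) \<omega>)})
         \<longlonglongrightarrow> 0"
proof -
  obtain A where A: "0 < A" "\<And>n. 1 \<le> n \<Longrightarrow> A * real n powr (-p) \<le> eps n" using assms(9) by blast
  obtain B where B: "0 < B" "\<And>n. 1 \<le> n \<Longrightarrow> B * real n powr (-q) \<le> Delta n" using assms(10) by blast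
  define g where "g = gap_const CARD('w)"
  have g: "0 < g" by (simp add: g_def gap_const_def)
  define C where "C = B * A\<^sup>2 * g\<^sup>2 / 16"
  have C: "0 < C" using A B g by (simp add: C_def)
  \<comment> \<open>The order of \<open>n * Delta n * (eps n)\<^sup>2\<close> is at least
    \<open>n powr r\<close>, which beats log log n for any \<open>r > 0\<close>.\<close>
  define r where "r = 1 - q - 2 * p"
  have r: "0 < r" using assms(4) by (simp add: r_def)
  have q1: "q < 1" using assms(1,4) by linarith
  let ?b = "\<lambda>n::nat. exp (- (C * real n powr r)) + (1 - (1 / real CARD('w)) ^ CARD('w)) ^ n"
  let ?II = "\<lambda>n. measure (M n) {\<omega> \<in> space (M n). \<not> trgof_reject s (c n) \<delta> n (Yobs (U n) (W n) \<omega>)}"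
  have le: "\<forall>\<^sub>F n in sequentially. ?II n \<le> ?b n"
  proof -
    have "\<forall>\<^sub>F n::nat in sequentially. (1 + \<delta>) * ln (ln (real n)) \<le> C * real n powr r"
      using C r by real_asymp
    \<comment> \<open>This uses \<open>q < 1\<close> and places the cutoff \<open>Delta n\<close>
      above \<open>1 / n\<close>, hence above \<open>c n\<close>.\<close>
    moreover have "\<forall>\<^sub>F n::nat in sequentially. 1 / real n \<le> B * real n powr (-q)"
      using B(1) q1 by real_asymp
    ultimately show ?thesis using eventually_ge_at_top[of "1::nat"]
    proof eventually_elim
      case (elim n)
      interpret watermark "M n" n "eps n" "Delta n" "P n" "U n" "W n"
        using assms(11) by unfold_locales
      have n: "0 < n" "0 < real n" using elim by auto
      have D: "B * real n powr (-q) \<le> Delta n" and e: "A * real n powr (-p) \<le> eps n" using A B elim by auto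
      have e0: "0 < A * real n powr (-p)" using A n by simp
      have X: "C * real n powr r \<le> real n * Delta n * (eps n)\<^sup>2 * g\<^sup>2 / 16"
      proof -
        have "real n powr r = real n powr (1 + (-q) + (-p) + (-p))" by (simp add: r_def)
        also have "\<dots> = real n * real n powr (-q) * (real n powr (-p))\<^sup>2"
          using n by (simp only: powr_add powr_one power2_eq_square mult.assoc)
        finally have "C * real n powr r = real n * (B * real n powr (-q)) * (A * real n powr (-p))\<^sup>2 * g\<^sup>2 / 16"
          by (simp add: C_def power_mult_distrib)
        also have "\<dots> \<le> real n * Delta n * (eps n)\<^sup>2 * g\<^sup>2 / 16"
          using D e e0 B(1) n less_le_trans[OF mult_pos_pos[OF B(1)] D]
          by (intro divide_right_mono mult_right_mono mult_mono mult_left_mono power_mono) auto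
        finally show ?thesis .
      qed
      have "?II n \<le> exp (- (real n * Delta n * (eps n)\<^sup>2 * g\<^sup>2 / 16)) + (1 - (1 / real CARD('w)) ^ CARD('w)) ^ n"
        unfolding g_def
      proof (rule type_II_bound[OF n(1) assms(6,7)])
        show "c n \<le> 1 / real n" using assms(8) by blast
        show "1 / real n \<le> Delta n" using elim D by linarith
        show "0 < eps n" using e0 e by linarith
        show "(1 + \<delta>) * ln (ln (real n)) \<le> real n * Delta n * (eps n)\<^sup>2 * (gap_const CARD('w))\<^sup>2 / 16"
          using elim X unfolding g_def by linarith
      qed
      also have "exp (- (real n * Delta n * (eps n)\<^sup>2 * g\<^sup>2 / 16)) \<le> exp (- (C * real n powr r))"
        using X by simp
      finally show ?case by simp
    qed
  qed
  have w: "0 < (1 / real CARD('w)) ^ CARD('w)" "(1 / real CARD('w)) ^ CARD('w) \<le> 1"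
    by (auto intro!: power_le_one simp: Suc_le_eq)
  have "(\<lambda>n::nat. exp (- (C * real n powr r))) \<longlonglongrightarrow> 0" using C r by real_asymp
  moreover have "(\<lambda>n. (1 - (1 / real CARD('w)) ^ CARD('w)) ^ n) \<longlonglongrightarrow> 0"
    using w by (intro LIMSEQ_realpow_zero) auto
  ultimately have "?b \<longlonglongrightarrow> 0 + 0" by (rule tendsto_add)
  then have b0: "?b \<longlonglongrightarrow> 0" by (simp only: add_0_left)
  have "?II \<longlonglongrightarrow> 0"
    by (rule tendsto_sandwich[OF _ le tendsto_const b0]) simp
  moreover have "(\<lambda>n. measure (H0_law n) {y \<in> space (H0_law n). trgof_reject s (c n) \<delta> n y}) \<longlonglongrightarrow> 0"
    using assms(5-8) by (intro type_I_tendsto) auto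
  ultimately show ?thesis
    using tendsto_add[of "\<lambda>n. measure (H0_law n) {y \<in> space (H0_law n). trgof_reject s (c n) \<delta> n y}" 0 sequentially ?II 0]
    by (simp only: add_0_left)
qed

end
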